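(* Let $A\to B$ be a rank-$n$ algebra, let $T,N,T',N'\in B$, and let $f\colon Q_B(T',N')\to Q_B(T,N)$ be an isomorphism (resp. a norm-preserving homomorphism) of $B$-algebras, given by $x\mapsto Ux+C$ with $U,C\in B$. Then the assignment $$x\mapsto s_n(U)\,x+\sum_{k=1}^n2^{k-1}s_{k,n-k}(C,UT)$$ defines an isomorphism (resp. a norm-preserving homomorphism) of $A$-algebras $$\mathrm{Nm}_{B/A}(f)\colon\mathrm{Nm}_{B/A}Q_B(T',N')\to\mathrm{Nm}_{B/A}Q_B(T,N).$$
   Context: All rings and algebras are commutative and unital. A ring homomorphism $A\to B$ is a rank-$n$ algebra if $B$ is projective of constant rank $n$ as an $A$-module; a quadratic algebra is a rank-$2$ algebra. Norm function: for a rank-$n$ algebra $A\to B$, $s_n\colon B\to A$ sends $b$ to the determinant of multiplication by $b$ on $B$ (computed locally on $A$ where $B$ is free, then glued). It commutes with base change. For natural numbers $k_1+\dots+k_m=n$ and $b_1,\dots,b_m\in B$, the polarized form $s_{k_1,\dots,k_m}(b_1,\dots,b_m)\in A$ is the coefficient of $\lambda_1^{k_1}\cdots\lambda_m^{k_m}$ in $s_n(\lambda_1b_1+\dots+\lambda_mb_m)$, computed for $A[\lambda_1,\dots,\lambda_m]\to B[\lambda_1,\dots,\lambda_m]$. For a ring $R$, a homomorphism $E\to E'$ of quadratic $R$-algebras is norm-preserving if it is an $R$-algebra homomorphism commuting with the norm functions $s_2\colon E\to R$ and $s_2\colon E'\to R$. Based quadratic algebras: for a ring $R$ and $t,m\in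 R$ write $Q_R(t,m)=R[x]/(x^2-tx+m)$, with chosen generator $x$. For a rank-$n$ algebra $A\to B$ and $T,N\in B$, $$\mathrm{Nm}_{B/A}Q_B(T,N):=Q_A\Bigl(s_n(T),\ \sum_{k=1}^n(-4)^{k-1}s_{k,n-k}(N,T^2)\Bigr).$$ *)

theory Defs
  imports "HOL-Algebra.UnivPoly" "HOL-Algebra.QuotRing" "HOL-Combinatorics.Permutations"
begin

section \<open>Algebras and modules\<close>

text \<open>
  An algebra over a commutative ring \<open>A\<close> is a commutative ring \<open>B\<close> together with its structure map
  \<open>\<phi> \<in> ring_hom A B\<close>.  Maps between carriers are only ever compared on the carriers.
\<close>

definition alg_module :: "('b, 'm) ring_scheme \<Rightarrow> ('a \<Rightarrow> 'b) \<Rightarrow> ('a, 'b) module" where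
  "alg_module B \<phi> =
    \<lparr>carrier = carrier B, monoid.mult = monoid.mult B, one = one B,
     zero = zero B, add = add B,
     smult = (\<lambda>a b. \<phi> a \<otimes>\<^bsub>B\<^esub> b)\<rparr>"

text \<open>The free module of rank \<open>m\<close>; multiplication and unit are the (irrelevant) pointwise ones.\<close>

definition free_module :: "('a, 'm) ring_scheme \<Rightarrow> nat \<Rightarrow> ('a, nat \<Rightarrow> 'a) module" where
  "free_module R m =
    \<lparr>carrier = {..<m} \<rightarrow>\<^sub>E carrier R,
     monoid.mult = (\<lambda>v w. \<lambda>i\<in>{..<m}. v i \<otimes>\<^bsub>R\<^esub> w i),
     one = (\<lambda>i\<in>{..<m}. \<one>\<^bsub>R\<^esub>),
     zero = (\<lambda>i\<in>{..<m}. \<zero>\<^bsub>R\<^esub>),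
     add = (\<lambda>v w. \<lambda>i\<in>{..<m}. v i \<oplus>\<^bsub>R\<^esub> w i),
     smult = (\<lambda>a v. \<lambda>i\<in>{..<m}. a \<otimes>\<^bsub>R\<^esub> v i)\<rparr>"

definition linear_maps ::
  "('a, 'm) ring_scheme \<Rightarrow> ('a, 'b, 'n) module_scheme \<Rightarrow> ('a, 'c, 'k) module_scheme \<Rightarrow> ('b \<Rightarrow> 'c) set"
where
  "linear_maps R M M' =
    {h. h \<in> carrier M \<rightarrow> carrier M' \<and>
        (\<forall>x\<in>carrier M. \<forall>y\<in>carrier M. h (x \<oplus>\<^bsub>M\<^esub> y) = h x \<oplus>\<^bsub>M'\<^esub> h y) \<and>
        (\<forall>a\<in>carrier R. \<forall>x\<in>carrier M. h (a \<odot>\<^bsub>M\<^esub> x) = a \<odot>\<^bsub>M'\<^esub> h x)}"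

text \<open>
  Finitely generated projective: a direct summand of a free module of finite rank.  (Constancy of the
  rank, a natural number, is a notion for finitely generated projective modules.)
\<close>

definition fg_projective :: "('a, 'm) ring_scheme \<Rightarrow> ('a, 'b, 'n) module_scheme \<Rightarrow> bool" where
  "fg_projective R M \<longleftrightarrow>
    (\<exists>m. \<exists>\<iota>\<in>linear_maps R M (free_module R m). \<exists>\<pi>\<in>linear_maps R (free_module R m) M.
       \<forall>x\<in>carrier M. \<pi> (\<iota> x) = x)"

definition coord_vector ::
  "('a, 'm) ring_scheme \<Rightarrow> ('a, 'b, 'n) module_scheme \<Rightarrow> nat \<Rightarrow> (nat \<Rightarrow> 'b) \<Rightarrow> 'b \<Rightarrow> (nat \<Rightarrow> 'a) \<Rightarrow> bool"
where
  "coord_vector R M n e x c \<longleftrightarrow>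
    c \<in> {..<n} \<rightarrow>\<^sub>E carrier R \<and> x = (\<Oplus>\<^bsub>M\<^esub>i\<in>{..<n}. c i \<odot>\<^bsub>M\<^esub> e i)"

definition is_basis ::
  "('a, 'm) ring_scheme \<Rightarrow> ('a, 'b, 'n) module_scheme \<Rightarrow> nat \<Rightarrow> (nat \<Rightarrow> 'b) \<Rightarrow> bool" where
  "is_basis R M n e \<longleftrightarrow>
    e \<in> {..<n} \<rightarrow> carrier M \<and> (\<forall>x\<in>carrier M. \<exists>!c. coord_vector R M n e x c)"

definition coords ::
  "('a, 'm) ring_scheme \<Rightarrow> ('a, 'b, 'n) module_scheme \<Rightarrow> nat \<Rightarrow> (nat \<Rightarrow> 'b) \<Rightarrow> 'b \<Rightarrow> nat \<Rightarrow> 'a" where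
  "coords R M n e x = (THE c. coord_vector R M n e x c)"

definition determinant :: "('a, 'm) ring_scheme \<Rightarrow> nat \<Rightarrow> (nat \<Rightarrow> nat \<Rightarrow> 'a) \<Rightarrow> 'a" where
  "determinant R n M =
    (\<Oplus>\<^bsub>R\<^esub>p\<in>{p. p permutes {..<n}}. [(sign p)] \<cdot>\<^bsub>R\<^esub> (\<Otimes>\<^bsub>R\<^esub>i\<in>{..<n}. M i (p i)))"

definition mult_matrix ::
  "('a, 'm) ring_scheme \<Rightarrow> ('a, 'b, 'n) module_scheme \<Rightarrow> nat \<Rightarrow> (nat \<Rightarrow> 'b) \<Rightarrow> 'b \<Rightarrow> nat \<Rightarrow> nat \<Rightarrow> 'a"
where
  "mult_matrix R M n e b = (\<lambda>i j. coords R M n e (b \<otimes>\<^bsub>M\<^esub> e j) i)"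


section \<open>Localization\<close>

text \<open>\<open>S\<close> is meant to be a multiplicative subset of the commutative ring \<open>R\<close>.\<close>

definition frac_rel :: "('a, 'm) ring_scheme \<Rightarrow> 'a set \<Rightarrow> (('a \<times> 'a) \<times> ('a \<times> 'a)) set" where
  "frac_rel R S =
    {((r, s), (r', s')). r \<in> carrier R \<and> r' \<in> carrier R \<and> s \<in> S \<and> s' \<in> S \<and>
       (\<exists>u\<in>S. u \<otimes>\<^bsub>R\<^esub> (s' \<otimes>\<^bsub>R\<^esub> r) = u \<otimes>\<^bsub>R\<^esub> (s \<otimes>\<^bsub>R\<^esub> r'))}"

definition fraction :: "('a, 'm) ring_scheme \<Rightarrow> 'a set \<Rightarrow> 'a \<Rightarrow> 'a \<Rightarrow> ('a \<times> 'a) set" where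
  "fraction R S r s = frac_rel R S `` {(r, s)}"

definition localize :: "('a, 'm) ring_scheme \<Rightarrow> 'a set \<Rightarrow> ('a \<times> 'a) set ring" where
  "localize R S =
    \<lparr>carrier = (carrier R \<times> S) // frac_rel R S,
     monoid.mult = (\<lambda>X Y. \<Union>(r, s)\<in>X. \<Union>(r', s')\<in>Y. fraction R S (r \<otimes>\<^bsub>R\<^esub> r') (s \<otimes>\<^bsub>R\<^esub> s')),
     one = fraction R S \<one>\<^bsub>R\<^esub> \<one>\<^bsub>R\<^esub>,
     zero = fraction R S \<zero>\<^bsub>R\<^esub> \<one>\<^bsub>R\<^esub>,
     add = (\<lambda>X Y. \<Union>(r, s)\<in>X. \<Union>(r', s')\<in>Y.
              fraction R S (s' \<otimes>\<^bsub>R\<^esub> r \<oplus>\<^bsub>R\<^esub> s \<otimes>\<^bsub>R\<^esub> r') (s \<otimes>\<^bsub>R\<^esub> s'))\<rparr>"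

text \<open>
  For an \<open>A\<close>-algebra \<open>\<phi> : A \<rightarrow> B\<close> and \<open>S \<subseteq> A\<close>, the localization of \<open>B\<close> at \<open>S\<close> is the
  ring \<open>localize B (\<phi> ` S)\<close>, an algebra over \<open>localize A S\<close> via \<open>a/s \<mapsto> \<phi>(a)/\<phi>(s)\<close>.
\<close>

definition localize_map ::
  "('b, 'm) ring_scheme \<Rightarrow> ('a \<Rightarrow> 'b) \<Rightarrow> 'a set \<Rightarrow> ('a \<times> 'a) set \<Rightarrow> ('b \<times> 'b) set" where
  "localize_map B \<phi> S X = (\<Union>(a, s)\<in>X. fraction B (\<phi> ` S) (\<phi> a) (\<phi> s))"

definition localize_module ::
  "('b, 'm) ring_scheme \<Rightarrow> ('a \<Rightarrow> 'b) \<Rightarrow> 'a set \<Rightarrow> (('a \<times> 'a) set, ('b \<times> 'b) set) module" where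
  "localize_module B \<phi> S = alg_module (localize B (\<phi> ` S)) (localize_map B \<phi> S)"

definition powers :: "('a, 'm) ring_scheme \<Rightarrow> 'a \<Rightarrow> 'a set" where
  "powers R f = range (\<lambda>k::nat. f [^]\<^bsub>R\<^esub> k)"


section \<open>Algebras of rank \<open>n\<close> and their norms\<close>

text \<open>The rank of \<open>B\<close> at a prime \<open>p\<close> is that of the free module \<open>B\<^sub>p\<close> over \<open>A\<^sub>p\<close>.\<close>

definition rank_algebra ::
  "('a, 'm) ring_scheme \<Rightarrow> ('b, 'n) ring_scheme \<Rightarrow> ('a \<Rightarrow> 'b) \<Rightarrow> nat \<Rightarrow> bool" where
  "rank_algebra A B \<phi> n \<longleftrightarrow>
    cring A \<and> cring B \<and> \<phi> \<in> ring_hom A B \<and>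
    fg_projective A (alg_module B \<phi>) \<and>
    (\<forall>p. primeideal p A \<longrightarrow>
      (\<exists>e. is_basis (localize A (carrier A - p)) (localize_module B \<phi> (carrier A - p)) n e))"

text \<open>
  \<open>s\<^sub>n(b)\<close> is the element of \<open>A\<close> whose image in \<open>A\<^sub>f\<close> is the determinant of multiplication by \<open>b\<close>
  on \<open>B\<^sub>f\<close>, whenever \<open>f\<close> is such that \<open>B\<^sub>f\<close> is free of rank \<open>n\<close> over \<open>A\<^sub>f\<close>.
\<close>

definition is_alg_norm ::
  "('a, 'm) ring_scheme \<Rightarrow> ('b, 'n) ring_scheme \<Rightarrow> ('a \<Rightarrow> 'b) \<Rightarrow> nat \<Rightarrow> 'b \<Rightarrow> 'a \<Rightarrow> bool" where
  "is_alg_norm A B \<phi> n b a \<longleftrightarrow>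
    a \<in> carrier A \<and>
    (\<forall>f\<in>carrier A. \<forall>e.
       is_basis (localize A (powers A f)) (localize_module B \<phi> (powers A f)) n e \<longrightarrow>
       fraction A (powers A f) a \<one>\<^bsub>A\<^esub> =
         determinant (localize A (powers A f)) n
           (mult_matrix (localize A (powers A f)) (localize_module B \<phi> (powers A f)) n e
             (fraction B (\<phi> ` powers A f) b \<one>\<^bsub>B\<^esub>)))"

definition alg_norm ::
  "('a, 'm) ring_scheme \<Rightarrow> ('b, 'n) ring_scheme \<Rightarrow> ('a \<Rightarrow> 'b) \<Rightarrow> nat \<Rightarrow> 'b \<Rightarrow> 'a" where
  "alg_norm A B \<phi> n b = (THE a. is_alg_norm A B \<phi> n b a)"

definition UP_map :: "('a \<Rightarrow> 'b) \<Rightarrow> (nat \<Rightarrow> 'a) \<Rightarrow> nat \<Rightarrow> 'b" where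
  "UP_map \<phi> p = (\<lambda>i. \<phi> (p i))"

text \<open>
  The polarized form \<open>s\<^bsub>k,l\<^esub>(b, c)\<close> in two arguments.  The ring \<open>R[\<lambda>\<^sub>1, \<lambda>\<^sub>2]\<close> is rendered as
  \<open>UP (UP R)\<close>, where \<open>\<lambda>\<^sub>1\<close> is the outer and \<open>\<lambda>\<^sub>2\<close> the inner variable.
\<close>

definition polarized_norm ::
  "('a, 'm) ring_scheme \<Rightarrow> ('b, 'n) ring_scheme \<Rightarrow> ('a \<Rightarrow> 'b) \<Rightarrow> nat \<Rightarrow> nat \<Rightarrow> nat \<Rightarrow> 'b \<Rightarrow> 'b \<Rightarrow> 'a"
where
  "polarized_norm A B \<phi> n k l b c =
    coeff (UP A)
      (coeff (UP (UP A))
        (alg_norm (UP (UP A)) (UP (UP B)) (UP_map (UP_map \<phi>)) n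
          (monom (UP (UP B)) (monom (UP B) b 0) 1 \<oplus>\<^bsub>UP (UP B)\<^esub>
           monom (UP (UP B)) (monom (UP B) c 1) 0))
        k)
      l"


section \<open>Homomorphisms\<close>

definition alg_hom ::
  "('r, 'm) ring_scheme \<Rightarrow> ('e, 'n) ring_scheme \<Rightarrow> ('r \<Rightarrow> 'e) \<Rightarrow> ('d, 'k) ring_scheme \<Rightarrow> ('r \<Rightarrow> 'd) \<Rightarrow>
    ('e \<Rightarrow> 'd) \<Rightarrow> bool" where
  "alg_hom R E \<iota> E' \<iota>' h \<longleftrightarrow> h \<in> ring_hom E E' \<and> (\<forall>r\<in>carrier R. h (\<iota> r) = \<iota>' r)"

definition alg_iso ::
  "('r, 'm) ring_scheme \<Rightarrow> ('e, 'n) ring_scheme \<Rightarrow> ('r \<Rightarrow> 'e) \<Rightarrow> ('d, 'k) ring_scheme \<Rightarrow> ('r \<Rightarrow> 'd) \<Rightarrow>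
    ('e \<Rightarrow> 'd) \<Rightarrow> bool" where
  "alg_iso R E \<iota> E' \<iota>' h \<longleftrightarrow> alg_hom R E \<iota> E' \<iota>' h \<and> h \<in> ring_iso E E'"

definition norm_preserving_hom ::
  "('r, 'm) ring_scheme \<Rightarrow> ('e, 'n) ring_scheme \<Rightarrow> ('r \<Rightarrow> 'e) \<Rightarrow> ('d, 'k) ring_scheme \<Rightarrow> ('r \<Rightarrow> 'd) \<Rightarrow>
    ('e \<Rightarrow> 'd) \<Rightarrow> bool" where
  "norm_preserving_hom R E \<iota> E' \<iota>' h \<longleftrightarrow>
    alg_hom R E \<iota> E' \<iota>' h \<and>
    (\<forall>y\<in>carrier E. alg_norm R E' \<iota>' 2 (h y) = alg_norm R E \<iota> 2 y)"


section \<open>Based quadratic algebras\<close>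

definition quad_ideal :: "('r, 'm) ring_scheme \<Rightarrow> 'r \<Rightarrow> 'r \<Rightarrow> (nat \<Rightarrow> 'r) set" where
  "quad_ideal R t m =
    PIdl\<^bsub>UP R\<^esub> (monom (UP R) \<one>\<^bsub>R\<^esub> 2 \<ominus>\<^bsub>UP R\<^esub> monom (UP R) t 1 \<oplus>\<^bsub>UP R\<^esub> monom (UP R) m 0)"

definition quad :: "('r, 'm) ring_scheme \<Rightarrow> 'r \<Rightarrow> 'r \<Rightarrow> (nat \<Rightarrow> 'r) set ring" where
  "quad R t m = UP R Quot quad_ideal R t m"

definition quad_const :: "('r, 'm) ring_scheme \<Rightarrow> 'r \<Rightarrow> 'r \<Rightarrow> 'r \<Rightarrow> (nat \<Rightarrow> 'r) set" where
  "quad_const R t m r = quad_ideal R t m +>\<^bsub>UP R\<^esub> monom (UP R) r 0"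

definition quad_gen :: "('r, 'm) ring_scheme \<Rightarrow> 'r \<Rightarrow> 'r \<Rightarrow> (nat \<Rightarrow> 'r) set" where
  "quad_gen R t m = quad_ideal R t m +>\<^bsub>UP R\<^esub> monom (UP R) \<one>\<^bsub>R\<^esub> 1"

text \<open>The element \<open>u x + c\<close> of \<open>Q\<^sub>R(t, m)\<close>.\<close>

definition quad_elem :: "('r, 'm) ring_scheme \<Rightarrow> 'r \<Rightarrow> 'r \<Rightarrow> 'r \<Rightarrow> 'r \<Rightarrow> (nat \<Rightarrow> 'r) set" where
  "quad_elem R t m u c =
    quad_const R t m u \<otimes>\<^bsub>quad R t m\<^esub> quad_gen R t m \<oplus>\<^bsub>quad R t m\<^esub> quad_const R t m c"

definition quad_iso :: "('r, 'm) ring_scheme \<Rightarrow> 'r \<times> 'r \<Rightarrow> 'r \<times> 'r \<Rightarrow>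
    ((nat \<Rightarrow> 'r) set \<Rightarrow> (nat \<Rightarrow> 'r) set) \<Rightarrow> bool" where
  "quad_iso R = (\<lambda>(t', m') (t, m).
    alg_iso R (quad R t' m') (quad_const R t' m') (quad R t m) (quad_const R t m))"

definition quad_norm_preserving :: "('r, 'm) ring_scheme \<Rightarrow> 'r \<times> 'r \<Rightarrow> 'r \<times> 'r \<Rightarrow>
    ((nat \<Rightarrow> 'r) set \<Rightarrow> (nat \<Rightarrow> 'r) set) \<Rightarrow> bool" where
  "quad_norm_preserving R = (\<lambda>(t', m') (t, m).
    norm_preserving_hom R (quad R t' m') (quad_const R t' m') (quad R t m) (quad_const R t m))"

text \<open>The parameters \<open>(t, m)\<close> for which \<open>Nm\<^bsub>B/A\<^esub> Q\<^sub>B(T, N) = Q\<^sub>A(t, m)\<close>.\<close>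

definition Nm_params ::
  "('a, 'm) ring_scheme \<Rightarrow> ('b, 'n) ring_scheme \<Rightarrow> ('a \<Rightarrow> 'b) \<Rightarrow> nat \<Rightarrow> 'b \<Rightarrow> 'b \<Rightarrow> 'a \<times> 'a" where
  "Nm_params A B \<phi> n T N =
    (alg_norm A B \<phi> n T,
     \<Oplus>\<^bsub>A\<^esub>k\<in>{1..n}. [((-4 :: int) ^ (k - 1))] \<cdot>\<^bsub>A\<^esub>
       (polarized_norm A B \<phi> n k (n - k) N (T [^]\<^bsub>B\<^esub> (2::nat))))"

end

theory Submission
  imports Defs "Jordan_Normal_Form.Determinant"
begin

text \<open>
  A homomorphism \<open>x \<mapsto> U x + C\<close> that is an isomorphism or preserves norms satisfies \<open>T' = U T + 2 C\<close> and
  \<open>N' = U\<^sup>2 N + U T C + C\<^sup>2\<close>, and conversely these two relations (with \<open>U\<close> a unit in the first case) define such a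
  homomorphism.  So the claim is that the relations descend to \<open>A\<close>.  For the first one this is the expansion of
  \<open>s\<^sub>n(U T + 2 C)\<close>.  For the second one write \<open>h\<^sub>\<kappa>(b, c)\<close> for the polynomial \<open>(s\<^sub>n(c + \<kappa> b) - s\<^sub>n(c)) / \<kappa>\<close> in \<open>\<kappa>\<close>,
  and put \<open>W = U T\<close> and \<open>Z = W C + C\<^sup>2\<close>, so that \<open>T'\<^sup>2 = W\<^sup>2 + 4 Z\<close> and \<open>N' = U\<^sup>2 N + Z\<close>.  Then \<open>h\<^sub>-\<^sub>4(N', T'\<^sup>2)\<close> splits as
  \<open>h\<^sub>-\<^sub>4(U\<^sup>2 N, W\<^sup>2) + h\<^sub>4(Z, W\<^sup>2)\<close>, and the last term is evaluated, without dividing by \<open>4\<close>, by comparing norms over \<open>A[v]\<close>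
  in \<open>(W + (1 + v) C) (v W + (1 + v) C) = v W\<^sup>2 + (1 + v)\<^sup>2 Z\<close>, cancelling \<open>(1 + v)\<^sup>2\<close> and setting \<open>v = 1\<close>.

  The norm is handled globally: if \<open>(g, \<theta>)\<close> is a finite dual basis of \<open>B\<close>, then \<open>s\<^sub>n(b)\<close> is the determinant of the matrix
  \<open>\<delta>\<^sub>i\<^sub>j - \<theta>\<^sub>i(g\<^sub>j) + \<theta>\<^sub>i(b g\<^sub>j)\<close>, which is \<open>b\<close> on \<open>B\<close> and the identity on a complement of \<open>B\<close> in a free module.
\<close>


text \<open>Determinants and their block identities are taken from type-class rings, whereas
  \<open>A\<close>, \<open>B\<close> and the polynomial rings over them are carrier-based. The
  bridge is the free commutative ring on the elements of a carrier: it is a type-class ring,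
  evaluation maps it onto the carrier, and identities of generic matrices specialize along it. The
  price is that facts special to \<open>A\<close>, such as the vanishing of polarized norms of the
  wrong degree, hold only after evaluation; hence the many equations of the form
  \<open>h x = h y\<close>. The product over \<open>A[v]\<close> arises as follows. Norms in
  \<open>W^2 + 4 Z = (W + 2 C)^2\<close> alone determine only four times the wanted quotient, and
  \<open>4\<close> may be a zero divisor. A deformation that still factors is needed:
  \<open>(W + r C) (v W + r C) = v W^2 + r (1 + v) W C + r^2 C^2\<close> is a combination of
  \<open>W^2\<close> and \<open>Z\<close> as soon as \<open>r = 1 + v\<close>, and
  \<open>1 + v\<close> is never a zero divisor, its constant term being \<open>1\<close>.\<close>

section \<open>Free commutative rings and their evaluation\<close>

datatype 'a ring_term =
    Var 'a | Zero | One | Add "'a ring_term" "'a ring_term" | Mul "'a ring_term" "'a ring_term"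
  | Neg "'a ring_term"

text \<open>The congruence generated by the axioms of commutative rings, so that the quotient is the
  free commutative ring on \<open>'a\<close>. With generators and relations every ring law is a
  rule, and evaluation is well defined by one induction (\<open>term_value_eq\<close>).\<close>

inductive ring_term_eq :: "'a ring_term \<Rightarrow> 'a ring_term \<Rightarrow> bool" where
  refl: "ring_term_eq a a"
| sym: "ring_term_eq a b \<Longrightarrow> ring_term_eq b a"
| trans: "ring_term_eq a b \<Longrightarrow> ring_term_eq b c \<Longrightarrow> ring_term_eq a c"
| add_cong: "ring_term_eq a b \<Longrightarrow> ring_term_eq c d \<Longrightarrow> ring_term_eq (Add a c) (Add b d)"
| mul_cong: "ring_term_eq a b \<Longrightarrow> ring_term_eq c d \<Longrightarrow> ring_term_eq (Mul a c) (Mul b d)"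
| neg_cong: "ring_term_eq a b \<Longrightarrow> ring_term_eq (Neg a) (Neg b)"
| add_assoc: "ring_term_eq (Add (Add a b) c) (Add a (Add b c))"
| add_comm: "ring_term_eq (Add a b) (Add b a)"
| add_zero: "ring_term_eq (Add Zero a) a"
| add_neg: "ring_term_eq (Add (Neg a) a) Zero"
| mul_assoc: "ring_term_eq (Mul (Mul a b) c) (Mul a (Mul b c))"
| mul_comm: "ring_term_eq (Mul a b) (Mul b a)"
| mul_one: "ring_term_eq (Mul One a) a"
| distrib: "ring_term_eq (Mul (Add a b) c) (Add (Mul a c) (Mul b c))"

quotient_type 'a free_ring = "'a ring_term" / ring_term_eq
  by (intro equivpI reflpI sympI transpI) (auto intro: ring_term_eq.intros)

text \<open>Evaluation of all variables at zero. It separates \<open>Zero\<close> from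
  \<open>One\<close>, as the class axiom \<open>0 \<noteq> 1\<close> requires.\<close>

primrec int_value :: "'a ring_term \<Rightarrow> int" where
  "int_value (Var x) = 0"
| "int_value Zero = 0"
| "int_value One = 1"
| "int_value (Add a b) = int_value a + int_value b"
| "int_value (Mul a b) = int_value a * int_value b"
| "int_value (Neg a) = - int_value a"

lemma int_value_eq: "ring_term_eq a b \<Longrightarrow> int_value a = int_value b"
  by (induction rule: ring_term_eq.induct) (auto simp: algebra_simps)

instantiation free_ring :: (type) comm_ring_1
begin

lift_definition zero_free_ring :: "'a free_ring" is Zero .
lift_definition one_free_ring :: "'a free_ring" is One .
lift_definition plus_free_ring :: "'a free_ring \<Rightarrow> 'a free_ring \<Rightarrow> 'a free_ring" is Add
  by (rule ring_term_eq.add_cong)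
lift_definition times_free_ring :: "'a free_ring \<Rightarrow> 'a free_ring \<Rightarrow> 'a free_ring" is Mul
  by (rule ring_term_eq.mul_cong)
lift_definition uminus_free_ring :: "'a free_ring \<Rightarrow> 'a free_ring" is Neg
  by (rule ring_term_eq.neg_cong)
definition minus_free_ring :: "'a free_ring \<Rightarrow> 'a free_ring \<Rightarrow> 'a free_ring" where
  "minus_free_ring a b = a + - b"

instance
proof
  fix a b c :: "'a free_ring"
  show "a + b + c = a + (b + c)" by transfer (rule ring_term_eq.add_assoc)
  show "a + b = b + a" by transfer (rule ring_term_eq.add_comm)
  show "0 + a = a" by transfer (rule ring_term_eq.add_zero)
  show "- a + a = 0" by transfer (rule ring_term_eq.add_neg)
  show "a - b = a + - b" by (rule minus_free_ring_def)
  show "a * b * c = a * (b * c)" by transfer (rule ring_term_eq.mul_assoc)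
  show "a * b = b * a" by transfer (rule ring_term_eq.mul_comm)
  show "1 * a = a" by transfer (rule ring_term_eq.mul_one)
  show "(a + b) * c = a * c + b * c" by transfer (rule ring_term_eq.distrib)
  show "(0 :: 'a free_ring) \<noteq> 1" by transfer (use int_value_eq in fastforce)
qed

end

text \<open>Variables outside the carrier get the default \<open>\<zero>\<close>, so evaluation is
  defined on terms over the whole type and always lands in the carrier.\<close>

primrec term_value :: "('a, 'm) ring_scheme \<Rightarrow> 'a ring_term \<Rightarrow> 'a" where
  "term_value R (Var x) = (if x \<in> carrier R then x else \<zero>\<^bsub>R\<^esub>)"
| "term_value R Zero = \<zero>\<^bsub>R\<^esub>"
| "term_value R One = \<one>\<^bsub>R\<^esub>"
| "term_value R (Add a b) = term_value R a \<oplus>\<^bsub>R\<^esub> term_value R b"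
| "term_value R (Mul a b) = term_value R a \<otimes>\<^bsub>R\<^esub> term_value R b"
| "term_value R (Neg a) = \<ominus>\<^bsub>R\<^esub> term_value R a"

lemma (in cring) term_value_closed: "term_value R a \<in> carrier R"
  by (induction a) auto

lemma (in cring) term_value_eq: "ring_term_eq a b \<Longrightarrow> term_value R a = term_value R b"
  by (induction rule: ring_term_eq.induct)
     (simp_all add: term_value_closed a_ac m_ac l_distr r_distr l_neg r_neg)

definition free_value :: "('a, 'm) ring_scheme \<Rightarrow> 'a free_ring \<Rightarrow> 'a" where
  "free_value R x = term_value R (rep_free_ring x)"

definition free_var :: "'a \<Rightarrow> 'a free_ring" where
  "free_var a = abs_free_ring (Var a)"

lemma (in cring) free_value_abs: "free_value R (abs_free_ring t) = term_value R t"
proof -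
  have "ring_term_eq (rep_free_ring (abs_free_ring t)) t"
    by (rule Quotient_rep_abs[OF Quotient_free_ring]) (rule ring_term_eq.refl)
  thus ?thesis unfolding free_value_def by (rule term_value_eq)
qed

lemma (in cring) free_value_var: "a \<in> carrier R \<Longrightarrow> free_value R (free_var a) = a"
  by (simp add: free_var_def free_value_abs)

text \<open>A ring homomorphism from a type-class ring to a carrier-based one. The instances are
  \<open>free_value R\<close>, its coefficientwise extensions to polynomials, and its composites
  with carrier-based homomorphisms.\<close>

locale class_hom = cring R for R (structure) +
  fixes h :: "'x :: comm_ring_1 \<Rightarrow> 'a"
  assumes closed [simp, intro]: "h x \<in> carrier R"
    and one: "h 1 = \<one>"
    and add: "h (x + y) = h x \<oplus> h y"
    and mult: "h (x * y) = h x \<otimes> h y"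
begin

lemma zero: "h 0 = \<zero>"
  using add[of 0 0] by (metis add.r_cancel_one' add_0 closed)

lemma uminus: "h (- x) = \<ominus> h x"
  using add[of "- x" x] by (metis ab_left_minus minus_equality closed zero)

lemma diff: "h (x - y) = h x \<ominus> h y"
  using add[of x "- y"] by (simp add: uminus a_minus_def)

lemma sum: "h (\<Sum>i\<in>I. f i) = (\<Oplus>i\<in>I. h (f i))" if "finite I"
  using that by induction (auto simp: zero add)

lemma prod: "h (\<Prod>i\<in>I. f i) = (\<Otimes>i\<in>I. h (f i))" if "finite I"
  using that by induction (auto simp: one mult)

lemma power: "h (x ^ k) = h x [^] k"
  by (induction k) (auto simp: one mult m_comm)

lemma of_nat: "h (of_nat k * x) = [k] \<cdot> h x"
proof (induction k)
  case (Suc k)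
  thus ?case by (simp add: add distrib_right add.nat_pow_Suc a_comm)
qed (simp add: zero)

lemma of_int: "h (of_int k * x) = [k] \<cdot> h x"
proof (cases "k \<ge> 0")
  case True
  then obtain n where "k = int n" using nonneg_int_cases by blast
  thus ?thesis by (simp add: of_nat add_pow_int_ge)
next
  case False
  then obtain n where "k = - int n" by (metis nle_le nonpos_int_cases)
  thus ?thesis using False by (simp add: uminus of_nat add.int_pow_neg add_pow_int_ge)
qed

lemmas hom_simps = zero one uminus diff add mult sum prod power

end

lemma (in cring) class_hom_free_value: "class_hom R (free_value R)"
proof unfold_locales
  fix x y :: "'a free_ring"
  show "free_value R x \<in> carrier R" by (simp add: free_value_def term_value_closed)
  show "free_value R 1 = \<one>" by (simp add: one_free_ring_def free_value_abs)
  obtain s t where st: "x = abs_free_ring s" "y = abs_free_ring t"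
    by (metis Quotient_abs_rep Quotient_free_ring)
  show "free_value R (x + y) = free_value R x \<oplus> free_value R y"
    by (simp add: st plus_free_ring.abs_eq free_value_abs)
  show "free_value R (x * y) = free_value R x \<otimes> free_value R y"
    by (simp add: st times_free_ring.abs_eq free_value_abs)
qed

text \<open>Elements of \<open>UP R\<close> are themselves functions from indices to coefficients,
  so the coefficientwise image needs no constructor. Iteration reaches
  \<open>UP (UP R)\<close>.\<close>

definition UP_hom :: "('x :: comm_ring_1 \<Rightarrow> 'a) \<Rightarrow> 'x poly \<Rightarrow> nat \<Rightarrow> 'a" where
  "UP_hom h p = (\<lambda>i. h (Polynomial.coeff p i))"

lemma (in class_hom) UP_hom_closed: "UP_hom h p \<in> carrier (UP R)"
proof -
  have "bound \<zero> (degree p) (UP_hom h p)"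
    by (auto simp: bound_def UP_hom_def coeff_eq_0 zero)
  thus ?thesis by (auto simp: UP_def UP_hom_def)
qed

lemma (in class_hom) coeff_UP_hom: "UnivPoly.coeff (UP R) (UP_hom h p) i = h (Polynomial.coeff p i)"
proof -
  have "UP_hom h p \<in> up R" using UP_hom_closed[of p] by (simp add: UP_def)
  hence "UnivPoly.coeff (UP R) (UP_hom h p) i = UP_hom h p i" by (simp add: UP_def)
  thus ?thesis by (simp only: UP_hom_def)
qed

lemma (in class_hom) class_hom_UP: "class_hom (UP R) (UP_hom h)"
proof -
  interpret P: UP_cring R "UP R" by (simp_all add: UP_cring_def is_cring)
  show ?thesis
  proof unfold_locales
    fix x y :: "'x poly"
    show "UP_hom h x \<in> carrier (UP R)" by (rule UP_hom_closed)
    show "UP_hom h 1 = \<one>\<^bsub>UP R\<^esub>"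
      by (intro P.up_eqI) (auto simp: coeff_UP_hom UP_hom_closed one zero)
    show "UP_hom h (x + y) = UP_hom h x \<oplus>\<^bsub>UP R\<^esub> UP_hom h y"
      by (intro P.up_eqI) (auto simp: coeff_UP_hom UP_hom_closed add)
    show "UP_hom h (x * y) = UP_hom h x \<otimes>\<^bsub>UP R\<^esub> UP_hom h y"
      by (intro P.up_eqI) (auto simp: coeff_UP_hom UP_hom_closed coeff_mult sum mult)
  qed
qed

lemma (in class_hom) UP_hom_const: "UP_hom h [:a:] = UnivPoly.monom (UP R) (h a) 0"
proof -
  interpret P: UP_cring R "UP R" by (simp_all add: UP_cring_def is_cring)
  show ?thesis by (intro P.up_eqI) (auto simp: coeff_UP_hom UP_hom_closed zero coeff_pCons split: nat.splits)
qed

section \<open>Determinants\<close>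

text \<open>Matrices are functions of two indices, as in \<open>determinant\<close>; the detour
  through the matrix type makes multiplicativity and block formulas applicable.\<close>

definition class_det :: "nat \<Rightarrow> (nat \<Rightarrow> nat \<Rightarrow> 'x :: comm_ring_1) \<Rightarrow> 'x" where
  "class_det n M = det (mat n n (\<lambda>(i, j). M i j))"

lemma class_det_eq:
  "class_det n M = (\<Sum>p | p permutes {..<n}. of_int (sign p) * (\<Prod>i<n. M i (p i)))"
proof -
  have "class_det n M = (\<Sum>p | p permutes {0..<n}. signof p * (\<Prod>i = 0..<n. mat n n (\<lambda>(i, j). M i j) $$ (i, p i)))"
    by (simp add: class_det_def det_def)
  also have "\<dots> = (\<Sum>p | p permutes {..<n}. of_int (sign p) * (\<Prod>i<n. M i (p i)))"
  proof (rule sum.cong)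
    fix p :: "nat \<Rightarrow> nat" assume "p \<in> {p. p permutes {..<n}}"
    hence "p i < n" if "i < n" for i using permutes_in_image[of p "{..<n}" i] that by auto
    thus "signof p * (\<Prod>i = 0..<n. mat n n (\<lambda>(i, j). M i j) $$ (i, p i)) =
        of_int (sign p) * (\<Prod>i<n. M i (p i))"
      by (simp add: atLeast0LessThan)
  qed (simp add: atLeast0LessThan)
  finally show ?thesis .
qed

text \<open>Both sides are Leibniz sums, polynomials with integer coefficients in the entries, which
  ring homomorphisms respect.\<close>

lemma (in class_hom) determinant_hom:
  "determinant R n (\<lambda>i j. h (M i j)) = h (class_det n M)"
  unfolding determinant_def class_det_eq
  by (simp add: sum prod of_int finite_permutations)

lemma (in cring) determinant_cong:
  assumes "\<And>i j. i < n \<Longrightarrow> j < n \<Longrightarrow> M i j = M' i j"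
    and "\<And>i j. i < n \<Longrightarrow> j < n \<Longrightarrow> M' i j \<in> carrier R"
  shows "determinant R n M = determinant R n M'"
  unfolding determinant_def
proof (rule finsum_cong')
  show "{p. p permutes {..<n}} = {p. p permutes {..<n}}" by simp
  have *: "p i < n" if "p permutes {..<n}" "i < n" for p :: "nat \<Rightarrow> nat" and i
    using permutes_in_image[OF that(1)] that(2) by auto
  show "(\<lambda>p. [sign p] \<cdot> (\<Otimes>i\<in>{..<n}. M' i (p i))) \<in> {p. p permutes {..<n}} \<rightarrow> carrier R"
    using assms(2) * by (auto intro!: finprod_closed add.int_pow_closed)
  fix p :: "nat \<Rightarrow> nat" assume "p \<in> {p. p permutes {..<n}}"
  hence p: "p permutes {..<n}" by simp
  have "(\<Otimes>i\<in>{..<n}. M i (p i)) = (\<Otimes>i\<in>{..<n}. M' i (p i))"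
    using assms *[OF p] by (intro finprod_cong') auto
  thus "[sign p] \<cdot> (\<Otimes>i\<in>{..<n}. M i (p i)) = [sign p] \<cdot> (\<Otimes>i\<in>{..<n}. M' i (p i))" by simp
qed

text \<open>Naming each entry by its own variable exhibits any determinant in \<open>R\<close> as
  the value of a generic one; this is how type-class identities enter \<open>R\<close>.\<close>

lemma (in cring) determinant_free_value:
  assumes "\<And>i j. i < n \<Longrightarrow> j < n \<Longrightarrow> M i j \<in> carrier R"
  shows "determinant R n M = free_value R (class_det n (\<lambda>i j. free_var (M i j)))"
proof -
  interpret class_hom R "free_value R" by (rule class_hom_free_value)
  show ?thesis unfolding determinant_hom[symmetric]
    by (rule determinant_cong) (auto simp: assms free_value_var)
qed

lemma (in cring) determinant_closed:
  assumes "\<And>i j. i < n \<Longrightarrow> j < n \<Longrightarrow> M i j \<in> carrier R"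
  shows "determinant R n M \<in> carrier R"
proof -
  interpret class_hom R "free_value R" by (rule class_hom_free_value)
  show ?thesis by (simp add: determinant_free_value assms)
qed

lemma det_block_one:
  assumes "M \<in> carrier_mat m m"
  shows "det (four_block_mat M (0\<^sub>m m k) (0\<^sub>m k m) (1\<^sub>m k)) = (det M :: 'x :: comm_ring_1)"
proof (induction k)
  case 0
  have "four_block_mat M (0\<^sub>m m 0) (0\<^sub>m 0 m) (1\<^sub>m 0) = M"
    using assms by (intro eq_matI) auto
  thus ?case by simp
next
  case (Suc k)
  let ?N = "four_block_mat M (0\<^sub>m m k) (0\<^sub>m k m) (1\<^sub>m k)"
  have "four_block_mat M (0\<^sub>m m (Suc k)) (0\<^sub>m (Suc k) m) (1\<^sub>m (Suc k)) =
        four_block_mat ?N (0\<^sub>m (m + k) 1) (0\<^sub>m 1 (m + k)) (1\<^sub>m 1)"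
    using assms by (intro eq_matI) auto
  moreover have "?N \<in> carrier_mat (m + k) (m + k)" using assms by simp
  ultimately show ?case
    using Suc by (simp add: det_four_block_mat_upper_right_zero_col)
qed

lemma det_one_block:
  assumes "M \<in> carrier_mat m m"
  shows "det (four_block_mat (1\<^sub>m k) (0\<^sub>m k m) (0\<^sub>m m k) M) = (det M :: 'x :: comm_ring_1)"
proof (induction k)
  case 0
  have "four_block_mat (1\<^sub>m 0) (0\<^sub>m 0 m) (0\<^sub>m m 0) M = M"
    using assms by (intro eq_matI) auto
  thus ?case by simp
next
  case (Suc k)
  let ?N = "four_block_mat (1\<^sub>m k) (0\<^sub>m k m) (0\<^sub>m m k) M"
  have "four_block_mat (1\<^sub>m (Suc k)) (0\<^sub>m (Suc k) m) (0\<^sub>m m (Suc k)) M =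
        four_block_mat (1\<^sub>m 1) (0\<^sub>m 1 (k + m)) (0\<^sub>m (k + m) 1) ?N"
    using assms by (intro eq_matI) auto
  moreover have "?N \<in> carrier_mat (k + m) (k + m)" using assms by simp
  moreover from this have "det (four_block_mat (1\<^sub>m 1) (0\<^sub>m 1 (k + m)) (0\<^sub>m (k + m) 1) ?N) = det (1\<^sub>m 1 :: 'x mat) * det ?N"
    by (intro det_four_block_mat_lower_left_zero_col[OF _ _ HOL.refl]) auto
  ultimately show ?case using Suc by (simp del: One_nat_def)
qed

text \<open>The matrix factors as \<open>diag(M, 1)\<close>, times the unipotent matrix with lower
  left block \<open>Y\<close>, times \<open>diag(1, N)\<close>.\<close>

lemma det_lower_block_triangular:
  fixes M :: "'x :: comm_ring_1 mat"
  assumes M: "M \<in> carrier_mat m m" and Y: "Y \<in> carrier_mat n m" and N: "N \<in> carrier_mat n n"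
  shows "det (four_block_mat M (0\<^sub>m m n) Y N) = det M * det N"
proof -
  let ?D = "four_block_mat (1\<^sub>m m) (0\<^sub>m m n) (0\<^sub>m n m) N"
  let ?T = "four_block_mat (1\<^sub>m m) (0\<^sub>m m n) Y (1\<^sub>m n)"
  let ?E = "four_block_mat M (0\<^sub>m m n) (0\<^sub>m n m) (1\<^sub>m n)"
  have c: "?D \<in> carrier_mat (m + n) (m + n)" "?T \<in> carrier_mat (m + n) (m + n)"
    "?E \<in> carrier_mat (m + n) (m + n)"
    using M Y N by auto
  have "?T * ?D = four_block_mat (1\<^sub>m m) (0\<^sub>m m n) Y N"
    using M Y N by (subst mult_four_block_mat[of _ m m _ n _ n _ _ m _ n]) auto
  hence "?E * (?T * ?D) = four_block_mat M (0\<^sub>m m n) Y N"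
    using M Y N by (simp add: mult_four_block_mat[of _ m m _ n _ n _ _ m _ n])
  hence "det (four_block_mat M (0\<^sub>m m n) Y N) = det ?E * (det ?T * det ?D)"
    using c by (metis det_mult mult_carrier_mat)
  moreover have "det ?T = 1"
  proof -
    have "det ?T = prod_list (diag_mat ?T)"
      by (rule det_lower_triangular[OF _ c(2)]) (use Y in auto)
    also have "diag_mat ?T = replicate (m + n) 1"
      by (rule nth_equalityI) (use Y in \<open>auto simp: diag_mat_def\<close>)
    finally show ?thesis by simp
  qed
  ultimately show ?thesis
    using det_block_one[OF M] det_one_block[OF N] by simp
qed

text \<open>Sylvester's identity \<open>det (1 + X Y) = det (1 + Y X)\<close>, homogenized so that no division is needed:
  both sides compute the determinant of the block matrix with rows \<open>(c, -X)\<close> and \<open>(Y, 1)\<close>.\<close>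

lemma det_sylvester:
  fixes X :: "'x :: comm_ring_1 mat"
  assumes X: "X \<in> carrier_mat m n" and Y: "Y \<in> carrier_mat n m"
  shows "c ^ n * det (c \<cdot>\<^sub>m 1\<^sub>m m + X * Y) = c ^ m * det (c \<cdot>\<^sub>m 1\<^sub>m n + Y * X)"
proof -
  \<comment> \<open>\<open>?L\<close> on the left and \<open>?R\<close> on the right both clear the
    block \<open>-X\<close> of \<open>?K\<close>, leaving \<open>c + X Y\<close> in the upper left
    corner and \<open>c + Y X\<close> in the lower right one respectively. Of the two homogenizing
    powers, \<open>c ^ n\<close> is \<open>det ?R\<close> and \<open>c ^ m\<close> comes from the
    untouched corner of \<open>?K * ?R\<close>.\<close>
  let ?K = "four_block_mat (c \<cdot>\<^sub>m 1\<^sub>m m) (- X) Y (1\<^sub>m n)"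
  let ?L = "four_block_mat (1\<^sub>m m) X (0\<^sub>m n m) (1\<^sub>m n)"
  let ?R = "four_block_mat (1\<^sub>m m) X (0\<^sub>m n m) (c \<cdot>\<^sub>m 1\<^sub>m n)"
  have K: "?K \<in> carrier_mat (m + n) (m + n)" and R: "?R \<in> carrier_mat (m + n) (m + n)"
    and L: "?L \<in> carrier_mat (m + n) (m + n)"
    using X Y by auto
  have XY: "X * Y \<in> carrier_mat m m" and YX: "Y * X \<in> carrier_mat n n" using X Y by auto
  have "?L * ?K = four_block_mat (c \<cdot>\<^sub>m 1\<^sub>m m + X * Y) (0\<^sub>m m n) Y (1\<^sub>m n)"
    using X Y XY
    by (subst mult_four_block_mat[of _ m m _ n _ n _ _ m _ n]) (auto simp: uminus_l_inv_mat)
  moreover have "?K * ?R = four_block_mat (c \<cdot>\<^sub>m 1\<^sub>m m) (0\<^sub>m m n) Y (c \<cdot>\<^sub>m 1\<^sub>m n + Y * X)"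
  proof -
    have "c \<cdot>\<^sub>m 1\<^sub>m m * X = c \<cdot>\<^sub>m X" "X * (c \<cdot>\<^sub>m 1\<^sub>m n) = c \<cdot>\<^sub>m X"
      using X by (auto simp: mult_smult_assoc_mat[of _ m m] mult_smult_distrib[of _ m n])
    thus ?thesis
      using X Y YX comm_add_mat[OF YX, of "c \<cdot>\<^sub>m 1\<^sub>m n"]
      by (subst mult_four_block_mat[of _ m m _ n _ n _ _ m _ n]) auto
  qed
  moreover have "det ?L = 1"
  proof -
    have "det ?L = prod_list (diag_mat ?L)"
      by (rule det_upper_triangular[OF _ L]) (use X in \<open>auto simp: upper_triangular_def\<close>)
    also have "diag_mat ?L = replicate (m + n) 1"
      by (rule nth_equalityI) (use X in \<open>auto simp: diag_mat_def\<close>)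
    finally show ?thesis by simp
  qed
  moreover have "det ?R = c ^ n"
  proof -
    have "det ?R = prod_list (diag_mat ?R)"
      by (rule det_upper_triangular[OF _ R]) (use X in \<open>auto simp: upper_triangular_def\<close>)
    also have "diag_mat ?R = replicate m 1 @ replicate n c"
      by (rule nth_equalityI) (use X in \<open>auto simp: diag_mat_def nth_append\<close>)
    finally show ?thesis by simp
  qed
  moreover have "det (?L * ?K) = det ?L * det ?K" "det (?K * ?R) = det ?K * det ?R"
    by (rule det_mult[OF L K], rule det_mult[OF K R])
  moreover have "det (four_block_mat (c \<cdot>\<^sub>m 1\<^sub>m m + X * Y) (0\<^sub>m m n) Y (1\<^sub>m n)) = det (c \<cdot>\<^sub>m 1\<^sub>m m + X * Y)"
    using XY Y by (subst det_lower_block_triangular) auto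
  moreover have "det (four_block_mat (c \<cdot>\<^sub>m 1\<^sub>m m) (0\<^sub>m m n) Y (c \<cdot>\<^sub>m 1\<^sub>m n + Y * X)) =
      c ^ m * det (c \<cdot>\<^sub>m 1\<^sub>m n + Y * X)"
    using YX Y by (subst det_lower_block_triangular) auto
  ultimately show ?thesis by (simp add: mult.commute)
qed

lemma class_det_mult:
  "class_det n (\<lambda>i j. \<Sum>k<n. M i k * N k j) = class_det n M * class_det n N"
proof -
  have "mat n n (\<lambda>(i, j). \<Sum>k<n. M i k * N k j) = mat n n (\<lambda>(i, j). M i j) * mat n n (\<lambda>(i, j). N i j)"
    by (intro eq_matI) (auto simp: scalar_prod_def atLeast0LessThan)
  thus ?thesis by (simp add: class_det_def det_mult[of _ n])
qed

lemma class_det_sylvester: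
  "c ^ n * class_det m (\<lambda>i j. (if i = j then c else 0) + (\<Sum>k<n. X i k * Y k j)) =
   c ^ m * class_det n (\<lambda>i j. (if i = j then c else 0) + (\<Sum>k<m. Y i k * X k j))"
proof -
  let ?X = "mat m n (\<lambda>(i, j). X i j)" and ?Y = "mat n m (\<lambda>(i, j). Y i j)"
  have "mat m m (\<lambda>(i, j). (if i = j then c else 0) + (\<Sum>k<n. X i k * Y k j)) = c \<cdot>\<^sub>m 1\<^sub>m m + ?X * ?Y"
    by (intro eq_matI) (auto simp: scalar_prod_def atLeast0LessThan)
  moreover have "mat n n (\<lambda>(i, j). (if i = j then c else 0) + (\<Sum>k<m. Y i k * X k j)) = c \<cdot>\<^sub>m 1\<^sub>m n + ?Y * ?X"
    by (intro eq_matI) (auto simp: scalar_prod_def atLeast0LessThan)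
  ultimately show ?thesis
    unfolding class_det_def by (simp only: det_sylvester[of ?X m n ?Y] mat_carrier)
qed

lemma class_det_cong:
  "(\<And>i j. i < n \<Longrightarrow> j < n \<Longrightarrow> M i j = N i j) \<Longrightarrow> class_det n M = class_det n N"
  unfolding class_det_def by (intro arg_cong[of _ _ det] cong_mat) auto

lemma class_det_smult: "class_det n (\<lambda>i j. c * M i j) = c ^ n * class_det n M"
proof -
  have "mat n n (\<lambda>(i, j). c * M i j) = c \<cdot>\<^sub>m mat n n (\<lambda>(i, j). M i j)"
    by (intro eq_matI) auto
  thus ?thesis by (simp add: class_det_def)
qed

lemma class_det_two: "class_det 2 M = M 0 0 * M 1 1 - M 0 1 * M 1 0"
proof -
  have "{..<2 :: nat} = insert 0 {1}" "1 \<notin> {0 :: nat}" by auto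
  thus ?thesis
    unfolding class_det_eq
    by (simp add: sum_over_permutations_insert permutes_sing sign_swap_id sign_id)
qed

lemma class_det_one: "class_det n (\<lambda>i j. if i = j then 1 else 0) = (1 :: 'x :: comm_ring_1)"
proof -
  have "mat n n (\<lambda>(i, j). if i = j then 1 else 0) = (1\<^sub>m n :: 'x mat)"
    by (intro eq_matI) auto
  thus ?thesis by (simp add: class_det_def)
qed

lemma (in comm_ring_hom) hom_class_det: "hom (class_det n M) = class_det n (\<lambda>i j. hom (M i j))"
proof -
  have "map_mat hom (mat n n (\<lambda>(i, j). M i j)) = mat n n (\<lambda>(i, j). hom (M i j))"
    by (intro eq_matI) auto
  thus ?thesis unfolding class_det_def hom_det[symmetric] by simp
qed

context cring
begin

text \<open>The pattern of this and the next two lemmas: entries are replaced by free variables, the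
  type-class identity is applied to the generic matrices, and the result is evaluated.\<close>

lemma determinant_mult:
  assumes M: "\<And>i j. i < n \<Longrightarrow> j < n \<Longrightarrow> M i j \<in> carrier R"
    and N: "\<And>i j. i < n \<Longrightarrow> j < n \<Longrightarrow> N i j \<in> carrier R"
  shows "determinant R n (\<lambda>i j. \<Oplus>k\<in>{..<n}. M i k \<otimes> N k j) = determinant R n M \<otimes> determinant R n N"
proof -
  interpret h: class_hom R "free_value R" by (rule class_hom_free_value)
  let ?v = "\<lambda>x. free_value R (free_var x)"
  have "determinant R n (\<lambda>i j. \<Oplus>k\<in>{..<n}. M i k \<otimes> N k j) =
        determinant R n (\<lambda>i j. free_value R (\<Sum>k<n. free_var (M i k) * free_var (N k j)))"
    by (rule determinant_cong) (auto simp: h.hom_simps free_value_var M N intro!: finsum_cong')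
  also have "\<dots> = free_value R (class_det n (\<lambda>i j. free_var (M i j)) * class_det n (\<lambda>i j. free_var (N i j)))"
    by (simp add: h.determinant_hom class_det_mult)
  also have "\<dots> = determinant R n M \<otimes> determinant R n N"
    by (simp add: h.mult determinant_free_value M N)
  finally show ?thesis .
qed

lemma determinant_sylvester:
  assumes c: "c \<in> carrier R"
    and X: "\<And>i j. i < m \<Longrightarrow> j < n \<Longrightarrow> X i j \<in> carrier R"
    and Y: "\<And>i j. i < n \<Longrightarrow> j < m \<Longrightarrow> Y i j \<in> carrier R"
  shows "c [^] n \<otimes> determinant R m (\<lambda>i j. (if i = j then c else \<zero>) \<oplus> (\<Oplus>k\<in>{..<n}. X i k \<otimes> Y k j)) =
         c [^] m \<otimes> determinant R n (\<lambda>i j. (if i = j then c else \<zero>) \<oplus> (\<Oplus>k\<in>{..<m}. Y i k \<otimes> X k j))"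
proof -
  interpret h: class_hom R "free_value R" by (rule class_hom_free_value)
  let ?c = "free_var c" and ?X = "\<lambda>i k. free_var (X i k)" and ?Y = "\<lambda>i k. free_var (Y i k)"
  have 1: "determinant R m (\<lambda>i j. (if i = j then c else \<zero>) \<oplus> (\<Oplus>k\<in>{..<n}. X i k \<otimes> Y k j)) =
        determinant R m (\<lambda>i j. free_value R ((if i = j then ?c else 0) + (\<Sum>k<n. ?X i k * ?Y k j)))"
    by (rule determinant_cong) (auto simp: h.hom_simps free_value_var X Y c intro!: finsum_cong' arg_cong2[of _ _ _ _ "(\<oplus>)"])
  have 2: "determinant R n (\<lambda>i j. (if i = j then c else \<zero>) \<oplus> (\<Oplus>k\<in>{..<m}. Y i k \<otimes> X k j)) =
        determinant R n (\<lambda>i j. free_value R ((if i = j then ?c else 0) + (\<Sum>k<m. ?Y i k * ?X k j)))"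
    by (rule determinant_cong) (auto simp: h.hom_simps free_value_var X Y c intro!: finsum_cong' arg_cong2[of _ _ _ _ "(\<oplus>)"])
  have "c [^] n = free_value R (?c ^ n)" "c [^] m = free_value R (?c ^ m)"
    by (simp_all add: h.power free_value_var c)
  thus ?thesis unfolding 1 2 h.determinant_hom
    by (simp only: h.mult[symmetric] class_det_sylvester)
qed

lemma determinant_smult:
  assumes c: "c \<in> carrier R" and M: "\<And>i j. i < n \<Longrightarrow> j < n \<Longrightarrow> M i j \<in> carrier R"
  shows "determinant R n (\<lambda>i j. c \<otimes> M i j) = c [^] n \<otimes> determinant R n M"
proof -
  interpret h: class_hom R "free_value R" by (rule class_hom_free_value)
  have "determinant R n (\<lambda>i j. c \<otimes> M i j) =
        determinant R n (\<lambda>i j. free_value R (free_var c * free_var (M i j)))"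
    by (rule determinant_cong) (auto simp: h.hom_simps free_value_var M c)
  also have "\<dots> = free_value R (free_var c ^ n * class_det n (\<lambda>i j. free_var (M i j)))"
    by (simp add: h.determinant_hom class_det_smult)
  also have "\<dots> = c [^] n \<otimes> determinant R n M"
    by (simp add: h.mult h.power determinant_free_value M free_value_var c)
  finally show ?thesis .
qed

text \<open>Both sides are values of the same generic determinant under \<open>free_value R\<close>
  followed by \<open>h\<close>, which is again a \<open>class_hom\<close>.\<close>

lemma determinant_ring_hom:
  assumes "cring R'" "h \<in> Ring.ring_hom R R'"
    and M: "\<And>i j. i < n \<Longrightarrow> j < n \<Longrightarrow> M i j \<in> carrier R"
  shows "determinant R' n (\<lambda>i j. h (M i j)) = h (determinant R n M)"
proof -
  interpret R': cring R' by fact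
  interpret h: ring_hom_cring R R' h by unfold_locales fact
  interpret v: class_hom R "free_value R" by (rule class_hom_free_value)
  interpret hv: class_hom R' "\<lambda>x. h (free_value R x)"
    by unfold_locales (auto simp: v.one v.add v.mult)
  have "determinant R' n (\<lambda>i j. h (M i j)) = determinant R' n (\<lambda>i j. h (free_value R (free_var (M i j))))"
    by (rule R'.determinant_cong) (auto simp: free_value_var M)
  also have "\<dots> = h (determinant R n M)"
    by (simp add: hv.determinant_hom determinant_free_value M)
  finally show ?thesis .
qed

end

section \<open>Localization of commutative rings\<close>

text \<open>The operations of \<open>localize\<close> are unions over all pairs of representatives.
  Once the result does not depend on the representatives, the union is one of a nonempty family of
  equal sets.\<close>

lemma Union_pairs_const:
  assumes "p \<in> P" "q \<in> Q" "\<And>a x b y. (a, x) \<in> P \<Longrightarrow> (b, y) \<in> Q \<Longrightarrow> g a x b y = c"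
  shows "(\<Union>(a, x)\<in>P. \<Union>(b, y)\<in>Q. g a x b y) = c"
proof -
  have "(\<Union>(b, y)\<in>Q. g a x b y) = c" if "(a, x) \<in> P" for a x
    using assms(2,3) that by (force split: prod.splits)
  thus ?thesis using assms(1) by (force split: prod.splits)
qed

locale localization = cring R for R (structure) + fixes S
  assumes S_subset: "S \<subseteq> carrier R"
    and S_one: "\<one> \<in> S"
    and S_mult: "s \<in> S \<Longrightarrow> t \<in> S \<Longrightarrow> s \<otimes> t \<in> S"
begin

lemma S_carrier [simp]: "s \<in> S \<Longrightarrow> s \<in> carrier R"
  using S_subset by auto

lemmas S_simps [simp] = S_one S_mult

lemma equiv_frac_rel: "equiv (carrier R \<times> S) (frac_rel R S)"
proof (rule equivI)
  show "frac_rel R S \<subseteq> (carrier R \<times> S) \<times> carrier R \<times> S"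
    by (auto simp: frac_rel_def)
  show "refl_on (carrier R \<times> S) (frac_rel R S)"
    by (auto simp: refl_on_def frac_rel_def)
  show "sym (frac_rel R S)"
    by (intro symI) (force simp: frac_rel_def)
  show "trans (frac_rel R S)"
  proof (rule transI, safe)
    fix r s r' s' r'' s''
    assume "((r, s), (r', s')) \<in> frac_rel R S" "((r', s'), (r'', s'')) \<in> frac_rel R S"
    then obtain u v where *: "r \<in> carrier R" "r' \<in> carrier R" "r'' \<in> carrier R"
        "s \<in> S" "s' \<in> S" "s'' \<in> S" "u \<in> S" "v \<in> S"
        "u \<otimes> (s' \<otimes> r) = u \<otimes> (s \<otimes> r')" "v \<otimes> (s'' \<otimes> r') = v \<otimes> (s' \<otimes> r'')"
      by (auto simp: frac_rel_def)
    \<comment> \<open>For transitivity the two witnesses \<open>u\<close> and \<open>v\<close> are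
      multiplied together and with the middle denominator \<open>s'\<close>, so that both given
      relations can be applied in turn.\<close>
    have "(u \<otimes> v \<otimes> s') \<otimes> (s'' \<otimes> r) = v \<otimes> s'' \<otimes> (u \<otimes> (s' \<otimes> r))"
      using *(1-8) by (simp add: m_ac)
    also have "\<dots> = u \<otimes> s \<otimes> (v \<otimes> (s'' \<otimes> r'))"
      unfolding *(9) using *(1-8) by (simp add: m_ac)
    also have "\<dots> = (u \<otimes> v \<otimes> s') \<otimes> (s \<otimes> r'')"
      unfolding *(10) using *(1-8) by (simp add: m_ac)
    finally show "((r, s), (r'', s'')) \<in> frac_rel R S"
      using *(1-8) by (auto simp: frac_rel_def intro!: bexI[of _ "u \<otimes> v \<otimes> s'"])
  qed
qed

lemma fraction_eq_iff:
  assumes "r \<in> carrier R" "s \<in> S" "r' \<in> carrier R" "s' \<in> S"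
  shows "fraction R S r s = fraction R S r' s' \<longleftrightarrow> (\<exists>u\<in>S. u \<otimes> (s' \<otimes> r) = u \<otimes> (s \<otimes> r'))"
  unfolding fraction_def
  using assms by (subst eq_equiv_class_iff[OF equiv_frac_rel]) (auto simp: frac_rel_def)

lemma mem_fraction:
  assumes "r \<in> carrier R" "s \<in> S"
  shows "(r', s') \<in> fraction R S r s \<longleftrightarrow> r' \<in> carrier R \<and> s' \<in> S \<and> fraction R S r' s' = fraction R S r s"
proof
  assume "(r', s') \<in> fraction R S r s"
  thus "r' \<in> carrier R \<and> s' \<in> S \<and> fraction R S r' s' = fraction R S r s"
    using equiv_class_eq[OF equiv_frac_rel, of "(r, s)" "(r', s')"] by (auto simp: fraction_def frac_rel_def)
next
  assume *: "r' \<in> carrier R \<and> s' \<in> S \<and> fraction R S r' s' = fraction R S r s"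
  thus "(r', s') \<in> fraction R S r s"
    using equiv_class_self[OF equiv_frac_rel, of "(r', s')"] by (auto simp: fraction_def)
qed

lemma fraction_self: "r \<in> carrier R \<Longrightarrow> s \<in> S \<Longrightarrow> (r, s) \<in> fraction R S r s"
  by (simp add: mem_fraction)

lemma fraction_closed [simp]:
  "r \<in> carrier R \<Longrightarrow> s \<in> S \<Longrightarrow> fraction R S r s \<in> carrier (localize R S)"
  by (auto simp: localize_def fraction_def intro!: quotientI)

lemma localize_cases:
  assumes "X \<in> carrier (localize R S)"
  obtains r s where "r \<in> carrier R" "s \<in> S" "X = fraction R S r s"
  using assms by (auto simp: localize_def fraction_def elim!: quotientE)

lemma fraction_mult:
  assumes "r \<in> carrier R" "s \<in> S" "r' \<in> carrier R" "s' \<in> S"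
  shows "fraction R S r s \<otimes>\<^bsub>localize R S\<^esub> fraction R S r' s' = fraction R S (r \<otimes> r') (s \<otimes> s')"
proof -
  have "fraction R S (a \<otimes> b) (x \<otimes> y) = fraction R S (r \<otimes> r') (s \<otimes> s')"
    if "(a, x) \<in> fraction R S r s" "(b, y) \<in> fraction R S r' s'" for a x b y
  proof -
    have c: "a \<in> carrier R" "x \<in> S" "b \<in> carrier R" "y \<in> S"
      using that assms by (auto simp: mem_fraction)
    have "fraction R S a x = fraction R S r s" "fraction R S b y = fraction R S r' s'"
      using that assms by (auto simp: mem_fraction)
    then obtain u v where uv: "u \<in> S" "u \<otimes> (s \<otimes> a) = u \<otimes> (x \<otimes> r)" "v \<in> S" "v \<otimes> (s' \<otimes> b) = v \<otimes> (y \<otimes> r')"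
      using assms c by (auto simp: fraction_eq_iff)
    have "(u \<otimes> v) \<otimes> ((s \<otimes> s') \<otimes> (a \<otimes> b)) = (u \<otimes> (s \<otimes> a)) \<otimes> (v \<otimes> (s' \<otimes> b))"
      using assms c uv(1,3) by (simp add: m_ac)
    also have "\<dots> = (u \<otimes> v) \<otimes> ((x \<otimes> y) \<otimes> (r \<otimes> r'))"
      unfolding uv(2,4) using assms c uv(1,3) by (simp add: m_ac)
    finally show ?thesis
      using assms c uv(1,3) by (subst fraction_eq_iff) (auto intro!: bexI[of _ "u \<otimes> v"])
  qed
  from Union_pairs_const[OF fraction_self[OF assms(1,2)] fraction_self[OF assms(3,4)] this]
  show ?thesis unfolding localize_def by simp
qed

lemma fraction_add:
  assumes "r \<in> carrier R" "s \<in> S" "r' \<in> carrier R" "s' \<in> S"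
  shows "fraction R S r s \<oplus>\<^bsub>localize R S\<^esub> fraction R S r' s' = fraction R S (s' \<otimes> r \<oplus> s \<otimes> r') (s \<otimes> s')"
proof -
  have "fraction R S (y \<otimes> a \<oplus> x \<otimes> b) (x \<otimes> y) = fraction R S (s' \<otimes> r \<oplus> s \<otimes> r') (s \<otimes> s')"
    if "(a, x) \<in> fraction R S r s" "(b, y) \<in> fraction R S r' s'" for a x b y
  proof -
    have c: "a \<in> carrier R" "x \<in> S" "b \<in> carrier R" "y \<in> S"
      using that assms by (auto simp: mem_fraction)
    have "fraction R S a x = fraction R S r s" "fraction R S b y = fraction R S r' s'"
      using that assms by (auto simp: mem_fraction)
    then obtain u v where uv: "u \<in> S" "u \<otimes> (s \<otimes> a) = u \<otimes> (x \<otimes> r)" "v \<in> S" "v \<otimes> (s' \<otimes> b) = v \<otimes> (y \<otimes> r')"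
      using assms c by (auto simp: fraction_eq_iff)
    have "(u \<otimes> v) \<otimes> ((s \<otimes> s') \<otimes> (y \<otimes> a \<oplus> x \<otimes> b)) =
        (v \<otimes> s' \<otimes> y) \<otimes> (u \<otimes> (s \<otimes> a)) \<oplus> (u \<otimes> s \<otimes> x) \<otimes> (v \<otimes> (s' \<otimes> b))"
      using assms c uv(1,3) by (simp add: m_ac r_distr l_distr)
    also have "\<dots> = (u \<otimes> v) \<otimes> ((x \<otimes> y) \<otimes> (s' \<otimes> r \<oplus> s \<otimes> r'))"
      unfolding uv(2,4) using assms c uv(1,3) by (simp add: m_ac r_distr l_distr)
    finally show ?thesis
      using assms c uv(1,3) by (subst fraction_eq_iff) (auto intro!: bexI[of _ "u \<otimes> v"])
  qed
  from Union_pairs_const[OF fraction_self[OF assms(1,2)] fraction_self[OF assms(3,4)] this]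
  show ?thesis unfolding localize_def by simp
qed

lemma fraction_eqI:
  assumes "r \<in> carrier R" "s \<in> S" "r' \<in> carrier R" "s' \<in> S" "s' \<otimes> r = s \<otimes> r'"
  shows "fraction R S r s = fraction R S r' s'"
  using assms by (subst fraction_eq_iff) (auto intro!: bexI[of _ \<one>])

lemma fraction_expand:
  assumes "r \<in> carrier R" "s \<in> S" "t \<in> S"
  shows "fraction R S (t \<otimes> r) (t \<otimes> s) = fraction R S r s"
  using assms by (intro fraction_eqI) (auto simp: m_ac)

lemma fraction_add_same:
  assumes "r \<in> carrier R" "s \<in> S" "r' \<in> carrier R"
  shows "fraction R S r s \<oplus>\<^bsub>localize R S\<^esub> fraction R S r' s = fraction R S (r \<oplus> r') s"
  using assms fraction_expand[of "r \<oplus> r'" s s] by (simp add: fraction_add r_distr)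

lemma one_localize: "\<one>\<^bsub>localize R S\<^esub> = fraction R S \<one> \<one>"
  and zero_localize: "\<zero>\<^bsub>localize R S\<^esub> = fraction R S \<zero> \<one>"
  by (simp_all add: localize_def)

lemma fraction_zero: "s \<in> S \<Longrightarrow> fraction R S \<zero> s = \<zero>\<^bsub>localize R S\<^esub>"
  unfolding zero_localize by (intro fraction_eqI) auto

lemma cring_localize: "cring (localize R S)"
proof (rule cringI)
  show "abelian_group (localize R S)"
  proof (rule abelian_groupI)
    fix X assume X: "X \<in> carrier (localize R S)"
    then obtain r s where rs: "r \<in> carrier R" "s \<in> S" "X = fraction R S r s" by (rule localize_cases)
    show "\<zero>\<^bsub>localize R S\<^esub> \<oplus>\<^bsub>localize R S\<^esub> X = X"
      using rs by (simp add: zero_localize fraction_add)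
    show "\<exists>Y\<in>carrier (localize R S). Y \<oplus>\<^bsub>localize R S\<^esub> X = \<zero>\<^bsub>localize R S\<^esub>"
      using rs by (intro bexI[of _ "fraction R S (\<ominus> r) s"]) (simp_all add: fraction_add_same l_neg fraction_zero)
    fix Y assume Y: "Y \<in> carrier (localize R S)"
    then obtain r' s' where rs': "r' \<in> carrier R" "s' \<in> S" "Y = fraction R S r' s'" by (rule localize_cases)
    show "X \<oplus>\<^bsub>localize R S\<^esub> Y \<in> carrier (localize R S)"
      using rs rs' by (simp add: fraction_add)
    show "X \<oplus>\<^bsub>localize R S\<^esub> Y = Y \<oplus>\<^bsub>localize R S\<^esub> X"
      using rs rs' by (simp add: fraction_add a_comm m_comm)
    fix Z assume Z: "Z \<in> carrier (localize R S)"
    then obtain r'' s'' where rs'': "r'' \<in> carrier R" "s'' \<in> S" "Z = fraction R S r'' s''" by (rule localize_cases)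
    show "X \<oplus>\<^bsub>localize R S\<^esub> Y \<oplus>\<^bsub>localize R S\<^esub> Z = X \<oplus>\<^bsub>localize R S\<^esub> (Y \<oplus>\<^bsub>localize R S\<^esub> Z)"
      using rs rs' rs'' by (simp add: fraction_add r_distr l_distr m_ac a_ac)
  qed (simp add: zero_localize)
  show "Group.comm_monoid (localize R S)"
  proof (rule comm_monoidI)
    fix X assume X: "X \<in> carrier (localize R S)"
    then obtain r s where rs: "r \<in> carrier R" "s \<in> S" "X = fraction R S r s" by (rule localize_cases)
    show "\<one>\<^bsub>localize R S\<^esub> \<otimes>\<^bsub>localize R S\<^esub> X = X"
      using rs by (simp add: one_localize fraction_mult)
    fix Y assume Y: "Y \<in> carrier (localize R S)"
    then obtain r' s' where rs': "r' \<in> carrier R" "s' \<in> S" "Y = fraction R S r' s'" by (rule localize_cases)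
    show "X \<otimes>\<^bsub>localize R S\<^esub> Y \<in> carrier (localize R S)"
      using rs rs' by (simp add: fraction_mult)
    show "X \<otimes>\<^bsub>localize R S\<^esub> Y = Y \<otimes>\<^bsub>localize R S\<^esub> X"
      using rs rs' by (simp add: fraction_mult m_comm)
    fix Z assume Z: "Z \<in> carrier (localize R S)"
    then obtain r'' s'' where rs'': "r'' \<in> carrier R" "s'' \<in> S" "Z = fraction R S r'' s''" by (rule localize_cases)
    show "X \<otimes>\<^bsub>localize R S\<^esub> Y \<otimes>\<^bsub>localize R S\<^esub> Z = X \<otimes>\<^bsub>localize R S\<^esub> (Y \<otimes>\<^bsub>localize R S\<^esub> Z)"
      using rs rs' rs'' by (simp add: fraction_mult m_assoc)
  qed (simp add: one_localize)
  fix X Y Z assume "X \<in> carrier (localize R S)" "Y \<in> carrier (localize R S)" "Z \<in> carrier (localize R S)"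
  then obtain r s r' s' r'' s'' where rs: "r \<in> carrier R" "s \<in> S" "X = fraction R S r s"
      "r' \<in> carrier R" "s' \<in> S" "Y = fraction R S r' s'" "r'' \<in> carrier R" "s'' \<in> S" "Z = fraction R S r'' s''"
    by (metis localize_cases)
  \<comment> \<open>Adding the two products on the right as fractions yields a denominator with a
    second factor \<open>s''\<close>, so the left side is expanded by \<open>s''\<close>.\<close>
  have "fraction R S ((s' \<otimes> r \<oplus> s \<otimes> r') \<otimes> r'') (s \<otimes> s' \<otimes> s'') =
      fraction R S (s'' \<otimes> ((s' \<otimes> r \<oplus> s \<otimes> r') \<otimes> r'')) (s'' \<otimes> (s \<otimes> s' \<otimes> s''))"
    using rs by (simp add: fraction_expand)
  also have "s'' \<otimes> ((s' \<otimes> r \<oplus> s \<otimes> r') \<otimes> r'') = s' \<otimes> s'' \<otimes> (r \<otimes> r'') \<oplus> s \<otimes> s'' \<otimes> (r' \<otimes> r'')"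
    using rs by (simp add: m_ac r_distr l_distr)
  also have "s'' \<otimes> (s \<otimes> s' \<otimes> s'') = s \<otimes> s'' \<otimes> (s' \<otimes> s'')"
    using rs by (simp add: m_ac)
  finally show "(X \<oplus>\<^bsub>localize R S\<^esub> Y) \<otimes>\<^bsub>localize R S\<^esub> Z =
      X \<otimes>\<^bsub>localize R S\<^esub> Z \<oplus>\<^bsub>localize R S\<^esub> Y \<otimes>\<^bsub>localize R S\<^esub> Z"
    using rs by (simp add: fraction_mult fraction_add)
qed

lemma fraction_one_hom: "(\<lambda>r. fraction R S r \<one>) \<in> Ring.ring_hom R (localize R S)"
  by (rule ring_hom_memI) (simp_all add: fraction_mult fraction_add_same one_localize)

lemma finsum_fraction:
  assumes "finite I" "\<And>i. i \<in> I \<Longrightarrow> f i \<in> carrier R" "s \<in> S"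
  shows "(\<Oplus>\<^bsub>localize R S\<^esub>i\<in>I. fraction R S (f i) s) = fraction R S (\<Oplus>i\<in>I. f i) s"
  using assms(1,2)
proof induction
  case empty
  show ?case using assms(3) by (simp add: fraction_zero abelian_monoid.finsum_empty
      [OF abelian_group.axioms(1)[OF ring.is_abelian_group[OF cring.axioms(1)[OF cring_localize]]]])
next
  case (insert x I)
  interpret L: cring "localize R S" by (rule cring_localize)
  have "(\<Oplus>\<^bsub>localize R S\<^esub>i\<in>I. fraction R S (f i) s) = fraction R S (\<Oplus>i\<in>I. f i) s"
    using insert by simp
  thus ?case using insert(1,2) insert(4) assms(3)
    by (subst L.finsum_insert) (auto simp: fraction_add_same)
qed

lemma common_denominator:
  assumes "finite I" "\<And>i. i \<in> I \<Longrightarrow> X i \<in> carrier (localize R S)"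
  shows "\<exists>s\<in>S. \<exists>f. (\<forall>i\<in>I. f i \<in> carrier R \<and> X i = fraction R S (f i) s)"
  using assms
proof induction
  case empty
  thus ?case by (auto intro: S_one)
next
  case (insert x I)
  obtain s f where s: "s \<in> S" and f: "\<forall>i\<in>I. f i \<in> carrier R \<and> X i = fraction R S (f i) s"
    using insert by auto
  obtain r t where rt: "r \<in> carrier R" "t \<in> S" "X x = fraction R S r t"
    using insert(4)[of x] by (auto elim: localize_cases)
  let ?f = "\<lambda>i. if i = x then s \<otimes> r else t \<otimes> f i"
  have "?f i \<in> carrier R \<and> X i = fraction R S (?f i) (t \<otimes> s)" if "i \<in> insert x I" for i
  proof (cases "i = x")
    case True
    thus ?thesis using s rt fraction_expand[of r t s] by (simp add: m_comm[of t s])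
  next
    case False
    thus ?thesis using that s f rt fraction_expand[of "f i" s t] by simp
  qed
  thus ?case using s rt by (intro bexI[of _ "t \<otimes> s"] exI[of _ ?f] ballI) simp_all
qed

lemma common_annihilator:
  assumes "finite I" "\<And>i. i \<in> I \<Longrightarrow> r i \<in> carrier R" "\<And>i. i \<in> I \<Longrightarrow> \<exists>u\<in>S. u \<otimes> r i = \<zero>"
  shows "\<exists>u\<in>S. \<forall>i\<in>I. u \<otimes> r i = \<zero>"
  using assms
proof induction
  case empty
  thus ?case by (auto intro: S_one)
next
  case (insert x I)
  obtain u v where "u \<in> S" "\<forall>i\<in>I. u \<otimes> r i = \<zero>" "v \<in> S" "v \<otimes> r x = \<zero>"
    using insert by (metis insertCI)
  moreover from this have "u \<otimes> v \<otimes> r i = \<zero>" if "i \<in> insert x I" for i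
    using that insert(4)[of i] by (metis S_carrier insertE m_assoc m_lcomm r_null)
  ultimately show ?case by (intro bexI[of _ "u \<otimes> v"]) auto
qed

end

lemma (in cring) localization_powers: "f \<in> carrier R \<Longrightarrow> localization R (powers R f)"
  by unfold_locales (auto simp: powers_def nat_pow_mult intro: range_eqI[of _ _ "0 :: nat"])

lemma (in cring) localization_primeideal: "primeideal p R \<Longrightarrow> localization R (carrier R - p)"
proof -
  assume "primeideal p R"
  then interpret p: primeideal p R .
  show ?thesis
    using p.one_imp_carrier p.I_notcarr p.I_prime by unfold_locales auto
qed

section \<open>Algebras, dual bases and local bases\<close>

locale comm_algebra = A: cring A + B: cring B
  for A :: "('a, 'm) ring_scheme" (structure) and B :: "('b, 'n) ring_scheme" +
  fixes \<phi> :: "'a \<Rightarrow> 'b"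
  assumes hom: "\<phi> \<in> Ring.ring_hom A B"
begin

sublocale \<phi>: ring_hom_cring A B \<phi>
  by unfold_locales (rule hom)

definition linear_form :: "('b \<Rightarrow> 'a) \<Rightarrow> bool" where
  "linear_form \<theta> \<longleftrightarrow> \<theta> \<in> carrier B \<rightarrow> carrier A \<and>
    (\<forall>b\<in>carrier B. \<forall>c\<in>carrier B. \<theta> (b \<oplus>\<^bsub>B\<^esub> c) = \<theta> b \<oplus> \<theta> c) \<and>
    (\<forall>a\<in>carrier A. \<forall>b\<in>carrier B. \<theta> (\<phi> a \<otimes>\<^bsub>B\<^esub> b) = a \<otimes> \<theta> b)"

lemma linear_form_closed: "linear_form \<theta> \<Longrightarrow> b \<in> carrier B \<Longrightarrow> \<theta> b \<in> carrier A"
  and linear_form_add: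
    "linear_form \<theta> \<Longrightarrow> b \<in> carrier B \<Longrightarrow> c \<in> carrier B \<Longrightarrow> \<theta> (b \<oplus>\<^bsub>B\<^esub> c) = \<theta> b \<oplus> \<theta> c"
  and linear_form_smult:
    "linear_form \<theta> \<Longrightarrow> a \<in> carrier A \<Longrightarrow> b \<in> carrier B \<Longrightarrow> \<theta> (\<phi> a \<otimes>\<^bsub>B\<^esub> b) = a \<otimes> \<theta> b"
  by (auto simp: linear_form_def)

lemma linear_form_zero: "linear_form \<theta> \<Longrightarrow> \<theta> \<zero>\<^bsub>B\<^esub> = \<zero>"
  using linear_form_smult[of \<theta> "\<zero>" "\<zero>\<^bsub>B\<^esub>"] linear_form_closed[of \<theta> "\<zero>\<^bsub>B\<^esub>"] by simp

lemma linear_form_uminus: "linear_form \<theta> \<Longrightarrow> b \<in> carrier B \<Longrightarrow> \<theta> (\<ominus>\<^bsub>B\<^esub> b) = \<ominus> \<theta> b"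
  using linear_form_add[of \<theta> "\<ominus>\<^bsub>B\<^esub> b" b] linear_form_zero[of \<theta>] linear_form_closed[of \<theta>]
  by (metis A.minus_equality B.a_inv_closed B.l_neg)

lemma linear_form_minus:
  "linear_form \<theta> \<Longrightarrow> b \<in> carrier B \<Longrightarrow> c \<in> carrier B \<Longrightarrow> \<theta> (b \<ominus>\<^bsub>B\<^esub> c) = \<theta> b \<ominus> \<theta> c"
  by (simp add: a_minus_def linear_form_add linear_form_uminus)

lemma linear_form_finsum:
  assumes "linear_form \<theta>" "finite I" "\<And>i. i \<in> I \<Longrightarrow> f i \<in> carrier B"
  shows "\<theta> (\<Oplus>\<^bsub>B\<^esub>i\<in>I. f i) = (\<Oplus>i\<in>I. \<theta> (f i))"
  using assms(2,3)
  by induction (auto simp: linear_form_zero linear_form_add linear_form_closed assms(1) Pi_def)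

text \<open>For \<open>F = \<one>\<close> this is a finite dual basis of \<open>B\<close>. A general
  \<open>F\<close> stands for a dual basis over the localization at \<open>F\<close> with its
  denominators cleared, so that it can be stated inside \<open>A\<close> and
  \<open>B\<close>.\<close>

definition frame :: "nat \<Rightarrow> 'a \<Rightarrow> (nat \<Rightarrow> 'b) \<Rightarrow> (nat \<Rightarrow> 'b \<Rightarrow> 'a) \<Rightarrow> bool" where
  "frame m F g \<theta> \<longleftrightarrow> F \<in> carrier A \<and> (\<forall>j<m. g j \<in> carrier B) \<and> (\<forall>j<m. linear_form (\<theta> j)) \<and>
    (\<forall>b\<in>carrier B. (\<Oplus>\<^bsub>B\<^esub>j\<in>{..<m}. \<phi> (\<theta> j b) \<otimes>\<^bsub>B\<^esub> g j) = \<phi> F \<otimes>\<^bsub>B\<^esub> b)"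

text \<open>If \<open>F\<close> is invertible then \<open>x\<close> is a basis with coordinate functions \<open>\<zeta> / F\<close>.\<close>

definition local_basis :: "nat \<Rightarrow> 'a \<Rightarrow> (nat \<Rightarrow> 'b) \<Rightarrow> (nat \<Rightarrow> 'b \<Rightarrow> 'a) \<Rightarrow> bool" where
  "local_basis n F x \<zeta> \<longleftrightarrow> frame n F x \<zeta> \<and> (\<forall>k<n. \<forall>l<n. \<zeta> k (x l) = (if k = l then F else \<zero>))"

definition frame_det :: "nat \<Rightarrow> (nat \<Rightarrow> 'b) \<Rightarrow> (nat \<Rightarrow> 'b \<Rightarrow> 'a) \<Rightarrow> 'b \<Rightarrow> 'a" where
  "frame_det m g \<theta> b = determinant A m
    (\<lambda>i j. ((if i = j then \<one> else \<zero>) \<ominus> \<theta> i (g j)) \<oplus> \<theta> i (b \<otimes>\<^bsub>B\<^esub> g j))"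

lemma frameD:
  assumes "frame m F g \<theta>"
  shows "F \<in> carrier A" "j < m \<Longrightarrow> g j \<in> carrier B" "j < m \<Longrightarrow> linear_form (\<theta> j)"
    "b \<in> carrier B \<Longrightarrow> (\<Oplus>\<^bsub>B\<^esub>j\<in>{..<m}. \<phi> (\<theta> j b) \<otimes>\<^bsub>B\<^esub> g j) = \<phi> F \<otimes>\<^bsub>B\<^esub> b"
    "j < m \<Longrightarrow> b \<in> carrier B \<Longrightarrow> \<theta> j b \<in> carrier A"
  using assms linear_form_closed by (auto simp: frame_def)

lemma frame_det_closed:
  assumes "frame m F g \<theta>" "b \<in> carrier B"
  shows "frame_det m g \<theta> b \<in> carrier A"
  unfolding frame_det_def using frameD[OF assms(1)] assms(2)
  by (intro A.determinant_closed) auto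

text \<open>The frame expansion of \<open>F b\<close> is multiplied by \<open>c\<close> and fed to
  \<open>\<eta>\<close>. In use it contracts a product of two matrices of linear forms to a single
  form.\<close>

lemma linear_form_frame:
  assumes fr: "frame m F g \<theta>" and \<eta>: "linear_form \<eta>" and c: "c \<in> carrier B" and b: "b \<in> carrier B"
  shows "(\<Oplus>j\<in>{..<m}. \<eta> (c \<otimes>\<^bsub>B\<^esub> g j) \<otimes> \<theta> j b) = F \<otimes> \<eta> (c \<otimes>\<^bsub>B\<^esub> b)"
proof -
  note f = frameD[OF fr]
  have "F \<otimes> \<eta> (c \<otimes>\<^bsub>B\<^esub> b) = \<eta> (\<phi> F \<otimes>\<^bsub>B\<^esub> (c \<otimes>\<^bsub>B\<^esub> b))"
    using b c f(1) by (simp add: linear_form_smult \<eta>)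
  also have "\<phi> F \<otimes>\<^bsub>B\<^esub> (c \<otimes>\<^bsub>B\<^esub> b) = c \<otimes>\<^bsub>B\<^esub> (\<phi> F \<otimes>\<^bsub>B\<^esub> b)"
    using b c f(1) by (simp add: B.m_lcomm)
  also have "\<dots> = (\<Oplus>\<^bsub>B\<^esub>j\<in>{..<m}. c \<otimes>\<^bsub>B\<^esub> (\<phi> (\<theta> j b) \<otimes>\<^bsub>B\<^esub> g j))"
    unfolding f(4)[OF b, symmetric] using f b c by (intro B.finsum_rdistr) auto
  also have "\<dots> = (\<Oplus>\<^bsub>B\<^esub>j\<in>{..<m}. \<phi> (\<theta> j b) \<otimes>\<^bsub>B\<^esub> (c \<otimes>\<^bsub>B\<^esub> g j))"
    using f b c by (intro B.finsum_cong') (auto simp: B.m_lcomm)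
  also have "\<eta> \<dots> = (\<Oplus>j\<in>{..<m}. \<eta> (\<phi> (\<theta> j b) \<otimes>\<^bsub>B\<^esub> (c \<otimes>\<^bsub>B\<^esub> g j)))"
    using f b c by (intro linear_form_finsum \<eta>) auto
  also have "\<dots> = (\<Oplus>j\<in>{..<m}. \<eta> (c \<otimes>\<^bsub>B\<^esub> g j) \<otimes> \<theta> j b)"
    using f b c by (intro A.finsum_cong') (auto simp: linear_form_smult \<eta> linear_form_closed A.m_comm)
  finally show ?thesis ..
qed

text \<open>Comparison of a dual basis \<open>(g, \<theta>)\<close> of the projective module \<open>B\<close> with a local basis, by
  Sylvester's identity.\<close>

lemma frame_det_local_basis:
  assumes g: "frame m \<one> g \<theta>" and x: "local_basis n F x \<zeta>" and b: "b \<in> carrier B"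
  shows "F [^] n \<otimes> (F [^] m \<otimes> frame_det m g \<theta> b) =
         F [^] m \<otimes> determinant A n (\<lambda>k l. \<zeta> k (b \<otimes>\<^bsub>B\<^esub> x l))"
proof -
  have fx: "frame n F x \<zeta>" and \<zeta>x: "\<And>k l. k < n \<Longrightarrow> l < n \<Longrightarrow> \<zeta> k (x l) = (if k = l then F else \<zero>)"
    using x by (auto simp: local_basis_def)
  note f = frameD[OF g] and f' = frameD[OF fx]
  \<comment> \<open>Sylvester's identity concerns perturbations of a scalar matrix, so
    \<open>b\<close> is treated as \<open>1 + ?c\<close>. For \<open>?X\<close> and
    \<open>?Y\<close> below, contraction gives \<open>X Y\<close> the entries
    \<open>F \<theta>_i(?c g_j)\<close> and \<open>Y X\<close> the entries
    \<open>\<zeta>_k(?c x_l)\<close>.\<close>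
  let ?c = "b \<ominus>\<^bsub>B\<^esub> \<one>\<^bsub>B\<^esub>"
  have c: "?c \<in> carrier B" using b by simp
  have cmult: "?c \<otimes>\<^bsub>B\<^esub> y = b \<otimes>\<^bsub>B\<^esub> y \<ominus>\<^bsub>B\<^esub> y" if "y \<in> carrier B" for y
    using that b by (simp add: a_minus_def B.l_distr B.l_minus)
  let ?X = "\<lambda>i k. \<theta> i (x k)" and ?Y = "\<lambda>k j. \<zeta> k (?c \<otimes>\<^bsub>B\<^esub> g j)"
  have syl: "F [^] n \<otimes> determinant A m (\<lambda>i j. (if i = j then F else \<zero>) \<oplus> (\<Oplus>k\<in>{..<n}. ?X i k \<otimes> ?Y k j)) =
      F [^] m \<otimes> determinant A n (\<lambda>i j. (if i = j then F else \<zero>) \<oplus> (\<Oplus>k\<in>{..<m}. ?Y i k \<otimes> ?X k j))"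
    using f f' c by (intro A.determinant_sylvester) auto
  have 1: "determinant A m (\<lambda>i j. (if i = j then F else \<zero>) \<oplus> (\<Oplus>k\<in>{..<n}. ?X i k \<otimes> ?Y k j)) =
      F [^] m \<otimes> frame_det m g \<theta> b"
  proof -
    have "determinant A m (\<lambda>i j. (if i = j then F else \<zero>) \<oplus> (\<Oplus>k\<in>{..<n}. ?X i k \<otimes> ?Y k j)) =
      determinant A m (\<lambda>i j. F \<otimes> (((if i = j then \<one> else \<zero>) \<ominus> \<theta> i (g j)) \<oplus> \<theta> i (b \<otimes>\<^bsub>B\<^esub> g j)))"
    proof (rule A.determinant_cong)
      fix i j assume ij: "i < m" "j < m"
      have cong_one: "(\<Oplus>k\<in>{..<n}. \<theta> i (\<one>\<^bsub>B\<^esub> \<otimes>\<^bsub>B\<^esub> x k) \<otimes> ?Y k j) =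
          (\<Oplus>k\<in>{..<n}. ?X i k \<otimes> ?Y k j)"
        using ij f f' c by (intro A.finsum_cong') auto
      have *: "(\<Oplus>k\<in>{..<n}. ?X i k \<otimes> ?Y k j) = F \<otimes> \<theta> i (?c \<otimes>\<^bsub>B\<^esub> g j)"
        using linear_form_frame[OF fx f(3)[OF ij(1)] B.one_closed, of "?c \<otimes>\<^bsub>B\<^esub> g j"] ij f f' c
        by (simp add: cong_one)
      have "\<theta> i (?c \<otimes>\<^bsub>B\<^esub> g j) = \<theta> i (b \<otimes>\<^bsub>B\<^esub> g j) \<ominus> \<theta> i (g j)"
        using ij f b by (simp add: cmult linear_form_minus)
      thus "(if i = j then F else \<zero>) \<oplus> (\<Oplus>k\<in>{..<n}. ?X i k \<otimes> ?Y k j) =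
        F \<otimes> (((if i = j then \<one> else \<zero>) \<ominus> \<theta> i (g j)) \<oplus> \<theta> i (b \<otimes>\<^bsub>B\<^esub> g j))"
        unfolding * using ij f f' b by (simp add: a_minus_def A.r_distr A.a_ac A.r_minus)
      show "F \<otimes> (((if i = j then \<one> else \<zero>) \<ominus> \<theta> i (g j)) \<oplus> \<theta> i (b \<otimes>\<^bsub>B\<^esub> g j)) \<in> carrier A"
        using ij f f' b by simp
    qed
    also have "\<dots> = F [^] m \<otimes> frame_det m g \<theta> b"
      unfolding frame_det_def using f f' b by (intro A.determinant_smult) auto
    finally show ?thesis .
  qed
  \<comment> \<open>The scalar \<open>F\<close> on the diagonal is cancelled by the summand
    \<open>-1\<close> of \<open>?c\<close>, because \<open>\<zeta>_k(x_l)\<close> is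
    \<open>F\<close> on the diagonal and zero elsewhere.\<close>
  have 2: "determinant A n (\<lambda>i j. (if i = j then F else \<zero>) \<oplus> (\<Oplus>k\<in>{..<m}. ?Y i k \<otimes> ?X k j)) =
      determinant A n (\<lambda>k l. \<zeta> k (b \<otimes>\<^bsub>B\<^esub> x l))"
  proof (rule A.determinant_cong)
    fix k l assume kl: "k < n" "l < n"
    have "(\<Oplus>i\<in>{..<m}. ?Y k i \<otimes> ?X i l) = \<zeta> k (?c \<otimes>\<^bsub>B\<^esub> x l)"
      using linear_form_frame[OF g f'(3)[OF kl(1)] c f'(2)[OF kl(2)]] kl c f' by simp
    also have "\<dots> = \<zeta> k (b \<otimes>\<^bsub>B\<^esub> x l) \<ominus> (if k = l then F else \<zero>)"
      using kl f' b by (simp add: cmult linear_form_minus \<zeta>x)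
    finally show "(if k = l then F else \<zero>) \<oplus> (\<Oplus>i\<in>{..<m}. ?Y k i \<otimes> ?X i l) = \<zeta> k (b \<otimes>\<^bsub>B\<^esub> x l)"
      using kl f' b by (auto simp: a_minus_def A.a_ac A.r_neg1 A.r_neg2)
    show "\<zeta> k (b \<otimes>\<^bsub>B\<^esub> x l) \<in> carrier A" using kl f' b by simp
  qed
  show ?thesis using syl unfolding 1 2 .
qed

lemma alg_module_simps [simp]:
  "carrier (alg_module B \<phi>) = carrier B" "x \<otimes>\<^bsub>alg_module B \<phi>\<^esub> y = x \<otimes>\<^bsub>B\<^esub> y"
  "a \<odot>\<^bsub>alg_module B \<phi>\<^esub> x = \<phi> a \<otimes>\<^bsub>B\<^esub> x" "finsum (alg_module B \<phi>) = finsum B"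
  by (auto simp: alg_module_def finsum_def finprod_def fun_eq_iff)

lemma coord_vector_iff:
  "coord_vector A (alg_module B \<phi>) n e x c \<longleftrightarrow>
    c \<in> {..<n} \<rightarrow>\<^sub>E carrier A \<and> x = (\<Oplus>\<^bsub>B\<^esub>i\<in>{..<n}. \<phi> (c i) \<otimes>\<^bsub>B\<^esub> e i)"
  by (simp add: coord_vector_def)

lemma coord_vector_restrict:
  assumes "\<And>i. i < n \<Longrightarrow> c i \<in> carrier A" "\<And>i. i < n \<Longrightarrow> e i \<in> carrier B"
    and "b = (\<Oplus>\<^bsub>B\<^esub>i\<in>{..<n}. \<phi> (c i) \<otimes>\<^bsub>B\<^esub> e i)"
  shows "coord_vector A (alg_module B \<phi>) n e b (\<lambda>i\<in>{..<n}. c i)"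
  unfolding coord_vector_iff assms(3)
  using assms(1,2) by (intro conjI B.finsum_cong') auto

lemma local_basis_coord:
  assumes lb: "local_basis n F x \<zeta>" and c: "\<And>i. i < n \<Longrightarrow> c i \<in> carrier A" and k: "k < n"
  shows "\<zeta> k (\<Oplus>\<^bsub>B\<^esub>i\<in>{..<n}. \<phi> (c i) \<otimes>\<^bsub>B\<^esub> x i) = c k \<otimes> F"
proof -
  have fx: "frame n F x \<zeta>" and \<zeta>x: "\<And>k l. k < n \<Longrightarrow> l < n \<Longrightarrow> \<zeta> k (x l) = (if k = l then F else \<zero>)"
    using lb by (auto simp: local_basis_def)
  note f = frameD[OF fx]
  have "\<zeta> k (\<Oplus>\<^bsub>B\<^esub>i\<in>{..<n}. \<phi> (c i) \<otimes>\<^bsub>B\<^esub> x i) = (\<Oplus>i\<in>{..<n}. \<zeta> k (\<phi> (c i) \<otimes>\<^bsub>B\<^esub> x i))"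
    using f k c by (intro linear_form_finsum) auto
  also have "\<dots> = (\<Oplus>i\<in>{..<n}. if k = i then c i \<otimes> F else \<zero>)"
    using f k c by (intro A.finsum_cong') (auto simp: linear_form_smult \<zeta>x)
  also have "\<dots> = c k \<otimes> F"
    using k c f by (intro A.finsum_singleton) auto
  finally show ?thesis .
qed

lemma is_basis_local_basis:
  assumes "local_basis n F x \<zeta>" and F: "F \<in> Units A"
  shows "is_basis A (alg_module B \<phi>) n x"
proof -
  have fx: "frame n F x \<zeta>" and \<zeta>x: "\<And>k l. k < n \<Longrightarrow> l < n \<Longrightarrow> \<zeta> k (x l) = (if k = l then F else \<zero>)"
    using assms by (auto simp: local_basis_def)
  note f = frameD[OF fx]
  let ?G = "inv F"
  have G: "?G \<in> carrier A" "F \<otimes> ?G = \<one>" "?G \<otimes> F = \<one>" using F by auto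
  show ?thesis unfolding is_basis_def
  proof (intro conjI ballI)
    show "x \<in> {..<n} \<rightarrow> carrier (alg_module B \<phi>)" using f by auto
    fix b assume "b \<in> carrier (alg_module B \<phi>)"
    hence b: "b \<in> carrier B" by simp
    let ?d = "\<lambda>i. ?G \<otimes> \<zeta> i b"
    let ?c = "restrict ?d {..<n}"
    have "(\<Oplus>\<^bsub>B\<^esub>i\<in>{..<n}. \<phi> (?d i) \<otimes>\<^bsub>B\<^esub> x i) = (\<Oplus>\<^bsub>B\<^esub>i\<in>{..<n}. \<phi> ?G \<otimes>\<^bsub>B\<^esub> (\<phi> (\<zeta> i b) \<otimes>\<^bsub>B\<^esub> x i))"
      using f b G by (intro B.finsum_cong') (auto simp: B.m_assoc)
    also have "\<dots> = \<phi> ?G \<otimes>\<^bsub>B\<^esub> (\<Oplus>\<^bsub>B\<^esub>i\<in>{..<n}. (\<phi> (\<zeta> i b) \<otimes>\<^bsub>B\<^esub> x i))"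
      using f b G by (intro B.finsum_rdistr[symmetric]) auto
    also have "\<dots> = b"
      using f b G by (simp add: B.m_assoc[symmetric] flip: \<phi>.hom_mult)
    finally have ex: "coord_vector A (alg_module B \<phi>) n x b ?c"
      using f b G by (intro coord_vector_restrict) auto
    show "\<exists>!c. coord_vector A (alg_module B \<phi>) n x b c"
    proof (rule ex1I[of _ ?c])
      show "coord_vector A (alg_module B \<phi>) n x b ?c" by (rule ex)
      fix c assume "coord_vector A (alg_module B \<phi>) n x b c"
      hence cP: "c \<in> {..<n} \<rightarrow>\<^sub>E carrier A" and bc: "b = (\<Oplus>\<^bsub>B\<^esub>i\<in>{..<n}. \<phi> (c i) \<otimes>\<^bsub>B\<^esub> x i)"
        by (auto simp: coord_vector_iff)
      have cA: "c i \<in> carrier A" if "i < n" for i using cP that by auto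
      show "c = ?c"
      proof
        fix k show "c k = ?c k"
        proof (cases "k < n")
          case True
          have "\<zeta> k b = c k \<otimes> F"
            unfolding bc using assms(1) cA True by (rule local_basis_coord)
          hence "?G \<otimes> \<zeta> k b = (?G \<otimes> F) \<otimes> c k"
            using True cA f G(1) by (auto simp: cA A.m_ac)
          thus ?thesis using True cA G by (simp add: cA)
        qed (use cP in auto)
      qed
    qed
  qed
qed

text \<open>Uniqueness of coordinates does the work: it makes the coordinate functions linear and
  dual to \<open>e\<close>.\<close>

lemma local_basis_coords:
  assumes "is_basis A (alg_module B \<phi>) n e"
  shows "local_basis n \<one> e (\<lambda>k b. coords A (alg_module B \<phi>) n e b k)"
proof -
  let ?c = "coords A (alg_module B \<phi>) n e"
  have e: "e i \<in> carrier B" if "i < n" for i using assms that by (auto simp: is_basis_def)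
  have ex1: "\<exists>!c. coord_vector A (alg_module B \<phi>) n e b c" if "b \<in> carrier B" for b
    using assms that by (auto simp: is_basis_def)
  have cv: "coord_vector A (alg_module B \<phi>) n e b (?c b)" if "b \<in> carrier B" for b
    unfolding coords_def by (rule theI'[OF ex1[OF that]])
  have eq: "?c b = c" if "coord_vector A (alg_module B \<phi>) n e b c" "b \<in> carrier B" for b c
    using ex1[OF that(2)] cv[OF that(2)] that(1) by blast
  have cl: "?c b i \<in> carrier A" if "b \<in> carrier B" "i < n" for b i
    using cv[OF that(1)] that(2) by (auto simp: coord_vector_iff)
  have sum: "b = (\<Oplus>\<^bsub>B\<^esub>i\<in>{..<n}. \<phi> (?c b i) \<otimes>\<^bsub>B\<^esub> e i)" if "b \<in> carrier B" for b
    using cv[OF that] by (auto simp: coord_vector_iff)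
  have lin: "linear_form (\<lambda>b. ?c b k)" if k: "k < n" for k
    unfolding linear_form_def
  proof (intro conjI ballI)
    show "(\<lambda>b. ?c b k) \<in> carrier B \<rightarrow> carrier A" using cl k by auto
    fix b b' assume b: "b \<in> carrier B" "b' \<in> carrier B"
    have "(\<Oplus>\<^bsub>B\<^esub>i\<in>{..<n}. \<phi> (?c b i \<oplus> ?c b' i) \<otimes>\<^bsub>B\<^esub> e i) =
        (\<Oplus>\<^bsub>B\<^esub>i\<in>{..<n}. \<phi> (?c b i) \<otimes>\<^bsub>B\<^esub> e i \<oplus>\<^bsub>B\<^esub> \<phi> (?c b' i) \<otimes>\<^bsub>B\<^esub> e i)"
      using cl b e by (intro B.finsum_cong') (auto simp: B.l_distr)
    also have "\<dots> = b \<oplus>\<^bsub>B\<^esub> b'"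
      using cl b e by (subst B.finsum_addf) (auto simp flip: sum)
    finally have "?c (b \<oplus>\<^bsub>B\<^esub> b') = (\<lambda>i\<in>{..<n}. ?c b i \<oplus> ?c b' i)"
      using b cl e by (intro eq coord_vector_restrict) auto
    thus "?c (b \<oplus>\<^bsub>B\<^esub> b') k = ?c b k \<oplus> ?c b' k" using k by simp
  next
    fix a b assume ab: "a \<in> carrier A" "b \<in> carrier B"
    have "(\<Oplus>\<^bsub>B\<^esub>i\<in>{..<n}. \<phi> (a \<otimes> ?c b i) \<otimes>\<^bsub>B\<^esub> e i) = (\<Oplus>\<^bsub>B\<^esub>i\<in>{..<n}. \<phi> a \<otimes>\<^bsub>B\<^esub> (\<phi> (?c b i) \<otimes>\<^bsub>B\<^esub> e i))"
      using cl ab e by (intro B.finsum_cong') (auto simp: B.m_assoc)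
    also have "\<dots> = \<phi> a \<otimes>\<^bsub>B\<^esub> b"
      using cl ab e by (subst B.finsum_rdistr[symmetric]) (auto simp flip: sum)
    finally have "?c (\<phi> a \<otimes>\<^bsub>B\<^esub> b) = (\<lambda>i\<in>{..<n}. a \<otimes> ?c b i)"
      using ab cl e by (intro eq coord_vector_restrict) auto
    thus "?c (\<phi> a \<otimes>\<^bsub>B\<^esub> b) k = a \<otimes> ?c b k" using k by simp
  qed
  have "?c (e l) = (\<lambda>i\<in>{..<n}. if i = l then \<one> else \<zero>)" if l: "l < n" for l
  proof (rule eq)
    have "(\<Oplus>\<^bsub>B\<^esub>i\<in>{..<n}. \<phi> (if i = l then \<one> else \<zero>) \<otimes>\<^bsub>B\<^esub> e i) =
        (\<Oplus>\<^bsub>B\<^esub>i\<in>{..<n}. if l = i then e i else \<zero>\<^bsub>B\<^esub>)"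
      using e by (intro B.finsum_cong') auto
    also have "\<dots> = e l" using l e by (intro B.finsum_singleton) auto
    finally show "coord_vector A (alg_module B \<phi>) n e (e l) (\<lambda>i\<in>{..<n}. if i = l then \<one> else \<zero>)"
      using e by (intro coord_vector_restrict) auto
  qed (rule e[OF l])
  thus ?thesis
    unfolding local_basis_def frame_def using e lin by (auto simp flip: sum)
qed

text \<open>The comparison with a local basis at \<open>F = \<one>\<close>, where the powers of
  \<open>F\<close> disappear. The right side does not mention \<open>e\<close>.\<close>

lemma determinant_mult_matrix:
  assumes "frame m \<one> g \<theta>" "is_basis A (alg_module B \<phi>) n e" "b \<in> carrier B"
  shows "determinant A n (mult_matrix A (alg_module B \<phi>) n e b) = frame_det m g \<theta> b"
proof -
  have lb: "local_basis n \<one> e (\<lambda>k b. coords A (alg_module B \<phi>) n e b k)"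
    using assms(2) by (rule local_basis_coords)
  hence "frame n \<one> e (\<lambda>k b. coords A (alg_module B \<phi>) n e b k)" by (simp add: local_basis_def)
  note f = frameD[OF this]
  have "determinant A n (\<lambda>k l. coords A (alg_module B \<phi>) n e (b \<otimes>\<^bsub>B\<^esub> e l) k) \<in> carrier A"
    using f assms(3) by (intro A.determinant_closed) auto
  thus ?thesis
    using frame_det_local_basis[OF assms(1) lb assms(3)] frame_det_closed[OF assms(1,3)]
    by (simp add: mult_matrix_def)
qed

end

section \<open>Localization of algebras and of linear forms\<close>

lemma (in comm_algebra) localization_image:
  assumes "localization A S"
  shows "localization B (\<phi> ` S)"
proof -
  interpret localization A S by fact
  show ?thesis
  proof
    show "\<one>\<^bsub>B\<^esub> \<in> \<phi> ` S" using imageI[OF S_one, of \<phi>] by simp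
    fix s t assume "s \<in> \<phi> ` S" "t \<in> \<phi> ` S"
    then obtain x y where xy: "x \<in> S" "y \<in> S" "s = \<phi> x" "t = \<phi> y" by auto
    hence "s \<otimes>\<^bsub>B\<^esub> t = \<phi> (x \<otimes> y)" by simp
    thus "s \<otimes>\<^bsub>B\<^esub> t \<in> \<phi> ` S" using imageI[OF S_mult[of x y], of \<phi>] xy by simp
  qed auto
qed

locale localized_algebra = comm_algebra A B \<phi>
  for A :: "('a, 'm) ring_scheme" (structure) and B :: "('b, 'n) ring_scheme" and \<phi> +
  fixes S assumes localization: "localization A S"
begin

sublocale LA: localization A S by (rule localization)
sublocale LB: localization B "\<phi> ` S" by (rule localization_image[OF localization])

lemma localize_map_fraction:
  assumes "a \<in> carrier A" "s \<in> S"
  shows "localize_map B \<phi> S (fraction A S a s) = fraction B (\<phi> ` S) (\<phi> a) (\<phi> s)"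
proof -
  have "fraction B (\<phi> ` S) (\<phi> a') (\<phi> s') = fraction B (\<phi> ` S) (\<phi> a) (\<phi> s)"
    if "(a', s') \<in> fraction A S a s" for a' s'
  proof -
    have c: "a' \<in> carrier A" "s' \<in> S" and "fraction A S a' s' = fraction A S a s"
      using that assms by (auto simp: LA.mem_fraction)
    then obtain u where u: "u \<in> S" "u \<otimes> (s \<otimes> a') = u \<otimes> (s' \<otimes> a)"
      using assms by (auto simp: LA.fraction_eq_iff)
    hence "\<phi> u \<otimes>\<^bsub>B\<^esub> (\<phi> s \<otimes>\<^bsub>B\<^esub> \<phi> a') = \<phi> u \<otimes>\<^bsub>B\<^esub> (\<phi> s' \<otimes>\<^bsub>B\<^esub> \<phi> a)"
      using c assms by (simp flip: \<phi>.hom_mult)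
    thus ?thesis using c assms u(1) by (subst LB.fraction_eq_iff) auto
  qed
  thus ?thesis unfolding localize_map_def using LA.fraction_self[OF assms] by fast
qed

lemma localize_B_cases:
  assumes "X \<in> carrier (localize B (\<phi> ` S))"
  obtains b s where "b \<in> carrier B" "s \<in> S" "X = fraction B (\<phi> ` S) b (\<phi> s)"
  using LB.localize_cases[OF assms] by (metis imageE)

sublocale L: comm_algebra "localize A S" "localize B (\<phi> ` S)" "localize_map B \<phi> S"
proof (intro comm_algebra.intro comm_algebra_axioms.intro LA.cring_localize LB.cring_localize ring_hom_memI)
  fix X assume "X \<in> carrier (localize A S)"
  then obtain a s where as: "a \<in> carrier A" "s \<in> S" "X = fraction A S a s" by (rule LA.localize_cases)
  show "localize_map B \<phi> S X \<in> carrier (localize B (\<phi> ` S))"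
    using as by (simp add: localize_map_fraction)
  fix Y assume "Y \<in> carrier (localize A S)"
  then obtain b t where bt: "b \<in> carrier A" "t \<in> S" "Y = fraction A S b t" by (rule LA.localize_cases)
  show "localize_map B \<phi> S (X \<otimes>\<^bsub>localize A S\<^esub> Y) =
      localize_map B \<phi> S X \<otimes>\<^bsub>localize B (\<phi> ` S)\<^esub> localize_map B \<phi> S Y"
    using as bt by (simp add: localize_map_fraction LA.fraction_mult LB.fraction_mult)
  show "localize_map B \<phi> S (X \<oplus>\<^bsub>localize A S\<^esub> Y) =
      localize_map B \<phi> S X \<oplus>\<^bsub>localize B (\<phi> ` S)\<^esub> localize_map B \<phi> S Y"
    using as bt by (simp add: localize_map_fraction LA.fraction_add LB.fraction_add)
next
  show "localize_map B \<phi> S \<one>\<^bsub>localize A S\<^esub> = \<one>\<^bsub>localize B (\<phi> ` S)\<^esub>"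
    using localize_map_fraction[of "\<one>" "\<one>"] by (simp add: LA.one_localize LB.one_localize)
qed

text \<open>The extension of \<open>\<theta>\<close> to fractions. A denominator in \<open>B\<close>
  remembers only \<open>\<phi> s\<close>, whence the choice of \<open>s\<close>; linearity over
  \<open>A\<close> makes the value independent of it, as \<open>localize_form_fraction\<close>
  shows.\<close>

definition localize_form :: "('b \<Rightarrow> 'a) \<Rightarrow> ('b \<times> 'b) set \<Rightarrow> ('a \<times> 'a) set" where
  "localize_form \<theta> X = (SOME Y. \<exists>b\<in>carrier B. \<exists>s\<in>S.
     X = fraction B (\<phi> ` S) b (\<phi> s) \<and> Y = fraction A S (\<theta> b) s)"

lemma localize_form_fraction:
  assumes \<theta>: "linear_form \<theta>" and b: "b \<in> carrier B" and s: "s \<in> S"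
  shows "localize_form \<theta> (fraction B (\<phi> ` S) b (\<phi> s)) = fraction A S (\<theta> b) s"
proof -
  have *: "Y = fraction A S (\<theta> b) s"
    if H: "c \<in> carrier B" "t \<in> S" "fraction B (\<phi> ` S) b (\<phi> s) = fraction B (\<phi> ` S) c (\<phi> t)"
       "Y = fraction A S (\<theta> c) t" for Y c t
  proof -
    obtain u where u: "u \<in> S" "\<phi> u \<otimes>\<^bsub>B\<^esub> (\<phi> t \<otimes>\<^bsub>B\<^esub> b) = \<phi> u \<otimes>\<^bsub>B\<^esub> (\<phi> s \<otimes>\<^bsub>B\<^esub> c)"
      using H b s by (auto simp: LB.fraction_eq_iff)
    hence "\<theta> (\<phi> u \<otimes>\<^bsub>B\<^esub> (\<phi> t \<otimes>\<^bsub>B\<^esub> b)) = \<theta> (\<phi> u \<otimes>\<^bsub>B\<^esub> (\<phi> s \<otimes>\<^bsub>B\<^esub> c))" by simp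
    hence "u \<otimes> (t \<otimes> \<theta> b) = u \<otimes> (s \<otimes> \<theta> c)"
      using u(1) that(1,2) b s by (simp add: linear_form_smult[OF \<theta>])
    thus ?thesis
      using u(1) H b s linear_form_closed[OF \<theta>] by (auto simp: LA.fraction_eq_iff intro!: bexI[of _ u])
  qed
  show ?thesis
    unfolding localize_form_def
  proof (rule some_equality)
    show "\<exists>c\<in>carrier B. \<exists>t\<in>S. fraction B (\<phi> ` S) b (\<phi> s) = fraction B (\<phi> ` S) c (\<phi> t) \<and>
        fraction A S (\<theta> b) s = fraction A S (\<theta> c) t"
      using b s by blast
  qed (use * in blast)
qed

lemma linear_form_localize:
  assumes \<theta>: "linear_form \<theta>"
  shows "L.linear_form (localize_form \<theta>)"
  unfolding L.linear_form_def
proof (intro conjI ballI funcsetI)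
  note cl = linear_form_closed[OF \<theta>]
  fix X assume "X \<in> carrier (localize B (\<phi> ` S))"
  then obtain b s where bs: "b \<in> carrier B" "s \<in> S" "X = fraction B (\<phi> ` S) b (\<phi> s)"
    by (rule localize_B_cases)
  show "localize_form \<theta> X \<in> carrier (localize A S)"
    using bs cl by (simp add: localize_form_fraction[OF \<theta>])
  {
    fix Y assume "Y \<in> carrier (localize B (\<phi> ` S))"
    then obtain c t where ct: "c \<in> carrier B" "t \<in> S" "Y = fraction B (\<phi> ` S) c (\<phi> t)"
      by (rule localize_B_cases)
    have "X \<oplus>\<^bsub>localize B (\<phi> ` S)\<^esub> Y =
        fraction B (\<phi> ` S) (\<phi> t \<otimes>\<^bsub>B\<^esub> b \<oplus>\<^bsub>B\<^esub> \<phi> s \<otimes>\<^bsub>B\<^esub> c) (\<phi> (s \<otimes> t))"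
      using bs ct by (simp add: LB.fraction_add)
    thus "localize_form \<theta> (X \<oplus>\<^bsub>localize B (\<phi> ` S)\<^esub> Y) =
        localize_form \<theta> X \<oplus>\<^bsub>localize A S\<^esub> localize_form \<theta> Y"
      using bs ct cl
      by (simp add: localize_form_fraction[OF \<theta>] LA.fraction_add linear_form_add[OF \<theta>] linear_form_smult[OF \<theta>] del: \<phi>.hom_mult)
  next
    fix Y assume "Y \<in> carrier (localize A S)"
    then obtain a t where at: "a \<in> carrier A" "t \<in> S" "Y = fraction A S a t"
      by (rule LA.localize_cases)
    have "localize_map B \<phi> S Y \<otimes>\<^bsub>localize B (\<phi> ` S)\<^esub> X =
        fraction B (\<phi> ` S) (\<phi> a \<otimes>\<^bsub>B\<^esub> b) (\<phi> (t \<otimes> s))"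
      using bs at by (simp add: LB.fraction_mult localize_map_fraction)
    thus "localize_form \<theta> (localize_map B \<phi> S Y \<otimes>\<^bsub>localize B (\<phi> ` S)\<^esub> X) =
        Y \<otimes>\<^bsub>localize A S\<^esub> localize_form \<theta> X"
      using bs at cl
      by (simp add: localize_form_fraction[OF \<theta>] LA.fraction_mult linear_form_smult[OF \<theta>] del: \<phi>.hom_mult)
  }
qed

abbreviation to_A :: "'a \<Rightarrow> ('a \<times> 'a) set" where "to_A a \<equiv> fraction A S a \<one>"
abbreviation to_B :: "'b \<Rightarrow> ('b \<times> 'b) set" where "to_B b \<equiv> fraction B (\<phi> ` S) b \<one>\<^bsub>B\<^esub>"

lemma localize_form_to_B:
  "linear_form \<theta> \<Longrightarrow> b \<in> carrier B \<Longrightarrow> localize_form \<theta> (to_B b) = to_A (\<theta> b)"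
  using localize_form_fraction[of \<theta> b "\<one>"] by simp

lemma localize_map_to_A: "a \<in> carrier A \<Longrightarrow> localize_map B \<phi> S (to_A a) = to_B (\<phi> a)"
  using localize_map_fraction[of a "\<one>"] by simp

lemma frame_localize:
  assumes "frame m F g \<theta>"
  shows "L.frame m (to_A F) (\<lambda>j. to_B (g j)) (\<lambda>j. localize_form (\<theta> j))"
proof -
  note f = frameD[OF assms]
  show ?thesis unfolding L.frame_def
  proof (intro conjI allI impI ballI)
    fix X assume "X \<in> carrier (localize B (\<phi> ` S))"
    then obtain b s where bs: "b \<in> carrier B" "s \<in> S" "X = fraction B (\<phi> ` S) b (\<phi> s)"
      by (rule localize_B_cases)
    have "(\<Oplus>\<^bsub>localize B (\<phi> ` S)\<^esub>j\<in>{..<m}. localize_map B \<phi> S (localize_form (\<theta> j) X) \<otimes>\<^bsub>localize B (\<phi> ` S)\<^esub> to_B (g j)) =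
        (\<Oplus>\<^bsub>localize B (\<phi> ` S)\<^esub>j\<in>{..<m}. fraction B (\<phi> ` S) (\<phi> (\<theta> j b) \<otimes>\<^bsub>B\<^esub> g j) (\<phi> s))"
      using bs f by (intro L.B.finsum_cong')
        (auto simp: localize_form_fraction localize_map_fraction LB.fraction_mult)
    also have "\<dots> = fraction B (\<phi> ` S) (\<phi> F \<otimes>\<^bsub>B\<^esub> b) (\<phi> s)"
      using bs f by (subst LB.finsum_fraction) auto
    also have "\<dots> = localize_map B \<phi> S (to_A F) \<otimes>\<^bsub>localize B (\<phi> ` S)\<^esub> X"
      using bs f by (simp add: localize_map_to_A LB.fraction_mult)
    finally show "(\<Oplus>\<^bsub>localize B (\<phi> ` S)\<^esub>j\<in>{..<m}. localize_map B \<phi> S (localize_form (\<theta> j) X) \<otimes>\<^bsub>localize B (\<phi> ` S)\<^esub> to_B (g j)) =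
        localize_map B \<phi> S (to_A F) \<otimes>\<^bsub>localize B (\<phi> ` S)\<^esub> X" .
  qed (use f in \<open>auto intro: linear_form_localize\<close>)
qed

lemma local_basis_localize:
  assumes "local_basis n F x \<zeta>"
  shows "L.local_basis n (to_A F) (\<lambda>j. to_B (x j)) (\<lambda>j. localize_form (\<zeta> j))"
proof -
  have "frame n F x \<zeta>" using assms by (simp add: local_basis_def)
  note f = frameD[OF this]
  show ?thesis
    using assms f by (auto simp: local_basis_def L.local_basis_def localize_form_to_B LA.zero_localize intro: frame_localize)
qed

lemma frame_det_localize:
  assumes "frame m F g \<theta>" "b \<in> carrier B"
  shows "L.frame_det m (\<lambda>j. to_B (g j)) (\<lambda>j. localize_form (\<theta> j)) (to_B b) = to_A (frame_det m g \<theta> b)"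
proof -
  note f = frameD[OF assms(1)]
  interpret q: ring_hom_cring A "localize A S" to_A
    by unfold_locales (rule LA.fraction_one_hom)
  show ?thesis unfolding frame_det_def L.frame_det_def
    using f assms(2)
    by (subst A.determinant_ring_hom[OF LA.cring_localize LA.fraction_one_hom, symmetric])
      (auto simp: localize_form_to_B LB.fraction_mult a_minus_def intro!: L.A.determinant_cong)
qed

end

section \<open>Extension of algebras and dual bases to polynomial rings\<close>

lemma (in UP_cring) coeff_mult_const:
  assumes "p \<in> carrier P" "c \<in> carrier R"
  shows "UnivPoly.coeff P (p \<otimes>\<^bsub>P\<^esub> UnivPoly.monom P c 0) i = UnivPoly.coeff P p i \<otimes> c"
    "UnivPoly.coeff P (UnivPoly.monom P c 0 \<otimes>\<^bsub>P\<^esub> p) i = c \<otimes> UnivPoly.coeff P p i"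
  using assms coeff_monom_mult[of c p 0 i] by (simp_all add: P.m_comm[of p] R.m_comm[of c] del: coeff_mult)

lemma UP_carrier_iff: "p \<in> carrier (UP R) \<longleftrightarrow> p \<in> up R"
  by (simp add: UP_def)

lemma UP_coeff_eq: "p \<in> carrier (UP R) \<Longrightarrow> UnivPoly.coeff (UP R) p i = p i"
  by (simp add: UP_def)

lemma UP_map_closed:
  assumes "p \<in> carrier (UP R)" "h \<in> carrier R \<rightarrow> carrier R'" "h \<zero>\<^bsub>R\<^esub> = \<zero>\<^bsub>R'\<^esub>"
  shows "UP_map h p \<in> carrier (UP R')"
proof -
  obtain n where "bound \<zero>\<^bsub>R\<^esub> n p" using assms(1) by (auto simp: UP_carrier_iff up_def)
  hence "bound \<zero>\<^bsub>R'\<^esub> n (UP_map h p)" using assms(3) by (auto simp: bound_def UP_map_def)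
  thus ?thesis using assms by (auto simp: UP_carrier_iff up_def UP_map_def)
qed

lemma coeff_UP_map:
  assumes "p \<in> carrier (UP R)" "h \<in> carrier R \<rightarrow> carrier R'" "h \<zero>\<^bsub>R\<^esub> = \<zero>\<^bsub>R'\<^esub>"
  shows "UnivPoly.coeff (UP R') (UP_map h p) i = h (UnivPoly.coeff (UP R) p i)"
  using assms UP_map_closed[OF assms] by (simp add: UP_coeff_eq UP_map_def)

context comm_algebra
begin

interpretation PA: UP_cring A "UP A" by (simp_all add: UP_cring_def A.is_cring)
interpretation PB: UP_cring B "UP B" by (simp_all add: UP_cring_def B.is_cring)

lemma UP_map_\<phi>:
  assumes "p \<in> carrier (UP A)"
  shows "UP_map \<phi> p \<in> carrier (UP B)" "UnivPoly.coeff (UP B) (UP_map \<phi> p) i = \<phi> (UnivPoly.coeff (UP A) p i)"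
  using assms by (auto intro!: UP_map_closed coeff_UP_map simp: coeff_UP_map[of p A])

lemma UP_map_const: "a \<in> carrier A \<Longrightarrow> UP_map \<phi> (UnivPoly.monom (UP A) a i) = UnivPoly.monom (UP B) (\<phi> a) i"
  by (intro PB.up_eqI) (auto simp: UP_map_\<phi>)

lemma UP_map_linear_form:
  assumes "linear_form \<theta>" "p \<in> carrier (UP B)"
  shows "UP_map \<theta> p \<in> carrier (UP A)" "UnivPoly.coeff (UP A) (UP_map \<theta> p) i = \<theta> (UnivPoly.coeff (UP B) p i)"
  using assms by (auto intro!: UP_map_closed coeff_UP_map simp: coeff_UP_map[of p B] linear_form_zero linear_form_closed)

lemma comm_algebra_UP: "comm_algebra (UP A) (UP B) (UP_map \<phi>)"
proof (intro comm_algebra.intro comm_algebra_axioms.intro ring_hom_memI PA.UP_cring PB.UP_cring)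
  fix p assume p: "p \<in> carrier (UP A)"
  thus "UP_map \<phi> p \<in> carrier (UP B)" by (rule UP_map_\<phi>)
  fix q assume q: "q \<in> carrier (UP A)"
  show "UP_map \<phi> (p \<otimes>\<^bsub>UP A\<^esub> q) = UP_map \<phi> p \<otimes>\<^bsub>UP B\<^esub> UP_map \<phi> q"
    using p q by (intro PB.up_eqI) (auto simp: UP_map_\<phi> o_def)
  show "UP_map \<phi> (p \<oplus>\<^bsub>UP A\<^esub> q) = UP_map \<phi> p \<oplus>\<^bsub>UP B\<^esub> UP_map \<phi> q"
    using p q by (intro PB.up_eqI) (auto simp: UP_map_\<phi>)
next
  show "UP_map \<phi> \<one>\<^bsub>UP A\<^esub> = \<one>\<^bsub>UP B\<^esub>"
    by (intro PB.up_eqI) (auto simp: UP_map_\<phi>)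
qed

interpretation P: comm_algebra "UP A" "UP B" "UP_map \<phi>" by (rule comm_algebra_UP)

lemma linear_form_UP:
  assumes \<theta>: "linear_form \<theta>"
  shows "P.linear_form (UP_map \<theta>)"
  unfolding P.linear_form_def
proof (intro conjI ballI funcsetI)
  fix p assume p: "p \<in> carrier (UP B)"
  show "UP_map \<theta> p \<in> carrier (UP A)" using p \<theta> by (simp add: UP_map_linear_form)
  show "UP_map \<theta> (p \<oplus>\<^bsub>UP B\<^esub> q) = UP_map \<theta> p \<oplus>\<^bsub>UP A\<^esub> UP_map \<theta> q" if q: "q \<in> carrier (UP B)" for q
    using p q by (intro PA.up_eqI) (auto simp: UP_map_linear_form[OF \<theta>] linear_form_add[OF \<theta>])
  show "UP_map \<theta> (UP_map \<phi> a \<otimes>\<^bsub>UP B\<^esub> p) = a \<otimes>\<^bsub>UP A\<^esub> UP_map \<theta> p" if a: "a \<in> carrier (UP A)" for a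
    using p a
    by (intro PA.up_eqI) (auto simp: UP_map_linear_form[OF \<theta>] UP_map_\<phi> linear_form_finsum[OF \<theta>] linear_form_smult[OF \<theta>]
        linear_form_closed[OF \<theta>] intro!: A.finsum_cong')
qed

lemma frame_UP:
  assumes "frame m F g \<theta>"
  shows "P.frame m (UnivPoly.monom (UP A) F 0) (\<lambda>j. UnivPoly.monom (UP B) (g j) 0) (\<lambda>j. UP_map (\<theta> j))"
proof -
  note f = frameD[OF assms]
  show ?thesis unfolding P.frame_def
  proof (intro conjI allI impI ballI)
    fix p assume p: "p \<in> carrier (UP B)"
    have "(\<Oplus>\<^bsub>B\<^esub>j\<in>{..<m}. UnivPoly.coeff (UP B) (UP_map \<phi> (UP_map (\<theta> j) p) \<otimes>\<^bsub>UP B\<^esub> UnivPoly.monom (UP B) (g j) 0) i) =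
       \<phi> F \<otimes>\<^bsub>B\<^esub> UnivPoly.coeff (UP B) p i" for i
    proof -
      have "(\<Oplus>\<^bsub>B\<^esub>j\<in>{..<m}. UnivPoly.coeff (UP B) (UP_map \<phi> (UP_map (\<theta> j) p) \<otimes>\<^bsub>UP B\<^esub> UnivPoly.monom (UP B) (g j) 0) i) =
          (\<Oplus>\<^bsub>B\<^esub>j\<in>{..<m}. \<phi> (\<theta> j (UnivPoly.coeff (UP B) p i)) \<otimes>\<^bsub>B\<^esub> g j)"
        using p f by (intro B.finsum_cong') (auto simp: UP_map_linear_form UP_map_\<phi> PB.coeff_mult_const simp del: PB.coeff_mult)
      thus ?thesis using p f by simp
    qed
    thus "(\<Oplus>\<^bsub>UP B\<^esub>j\<in>{..<m}. UP_map \<phi> (UP_map (\<theta> j) p) \<otimes>\<^bsub>UP B\<^esub> UnivPoly.monom (UP B) (g j) 0) =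
        UP_map \<phi> (UnivPoly.monom (UP A) F 0) \<otimes>\<^bsub>UP B\<^esub> p"
      using p f by (intro PB.up_eqI) (auto simp: PB.coeff_finsum UP_map_linear_form UP_map_\<phi> PB.coeff_mult_const UP_map_const simp del: PB.coeff_mult)
  qed (use f in \<open>auto intro: linear_form_UP\<close>)
qed

end

text \<open>An algebra with a dual basis \<open>(g, \<theta>)\<close> such that no nonzero element of \<open>A\<close> is killed by powers of
  all \<open>F\<close> for which \<open>B\<^sub>F\<close> is free of rank \<open>n\<close>; the latter says that these \<open>F\<close> generate the unit ideal,
  in a form that passes to polynomial rings.\<close>

locale ranked_algebra = comm_algebra A B \<phi>
  for A :: "('a, 'm) ring_scheme" (structure) and B :: "('b, 'n) ring_scheme" and \<phi> +
  fixes n m g \<theta>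
  assumes dual_basis: "frame m \<one> g \<theta>"
    and separated: "a \<in> carrier A \<Longrightarrow>
      (\<And>F x \<zeta>. local_basis n F x \<zeta> \<Longrightarrow> \<exists>k::nat. F [^] k \<otimes> a = \<zero>) \<Longrightarrow> a = \<zero>"
begin

lemmas db = frameD[OF dual_basis]

abbreviation nm :: "'b \<Rightarrow> 'a" where "nm \<equiv> frame_det m g \<theta>"

lemma nm_closed: "b \<in> carrier B \<Longrightarrow> nm b \<in> carrier A"
  using dual_basis by (rule frame_det_closed)

lemma separated_eq:
  assumes "a \<in> carrier A" "b \<in> carrier A"
    and "\<And>F x \<zeta>. local_basis n F x \<zeta> \<Longrightarrow> \<exists>k::nat. F [^] k \<otimes> a = F [^] k \<otimes> b"
  shows "a = b"
proof -
  have "a \<ominus> b = \<zero>"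
  proof (rule separated)
    fix F x \<zeta> assume lb: "local_basis n F x \<zeta>"
    hence F: "F \<in> carrier A" by (simp add: local_basis_def frame_def)
    obtain k :: nat where k: "F [^] k \<otimes> a = F [^] k \<otimes> b"
      using assms(3)[OF lb] by blast
    have "F [^] k \<otimes> (a \<ominus> b) = F [^] k \<otimes> a \<ominus> F [^] k \<otimes> b"
      using assms(1,2) F by (simp add: a_minus_def A.r_distr A.r_minus)
    also have "\<dots> = \<zero>" using assms(1,2) F by (simp add: k a_minus_def A.r_neg)
    finally show "\<exists>k::nat. F [^] k \<otimes> (a \<ominus> b) = \<zero>" by blast
  qed (use assms in simp)
  thus ?thesis using assms(1,2) A.minus_equality[of a "\<ominus> b"] by (simp add: a_minus_def)
qed

text \<open>A dual basis localizes to a dual basis, so its determinant specializes to the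
  determinant of multiplication wherever the localization is free of rank \<open>n\<close>.\<close>

lemma is_alg_norm_nm:
  assumes b: "b \<in> carrier B"
  shows "is_alg_norm A B \<phi> n b (nm b)"
  unfolding is_alg_norm_def
proof (intro conjI ballI allI impI)
  show "nm b \<in> carrier A" using b by (rule nm_closed)
  fix f e assume f: "f \<in> carrier A"
  interpret P: localized_algebra A B \<phi> "powers A f"
    by (intro localized_algebra.intro localized_algebra_axioms.intro comm_algebra_axioms A.localization_powers f)
  assume "is_basis (localize A (powers A f)) (localize_module B \<phi> (powers A f)) n e"
  hence e: "is_basis (localize A (powers A f)) (alg_module (localize B (\<phi> ` powers A f)) (localize_map B \<phi> (powers A f))) n e"
    by (simp add: localize_module_def)
  have "P.L.frame m \<one>\<^bsub>localize A (powers A f)\<^esub> (\<lambda>j. P.to_B (g j)) (\<lambda>j. P.localize_form (\<theta> j))"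
    using P.frame_localize[OF dual_basis] by (simp add: P.LA.one_localize)
  from P.L.determinant_mult_matrix[OF this e, of "P.to_B b"] b
  show "P.to_A (nm b) = determinant (localize A (powers A f)) n
      (mult_matrix (localize A (powers A f)) (localize_module B \<phi> (powers A f)) n e (P.to_B b))"
    by (simp add: P.frame_det_localize[OF dual_basis b] localize_module_def)
qed

text \<open>What remains is uniqueness. Two candidates agree in the localization at \<open>F\<close>
  for every local basis, hence after multiplication by a power of \<open>F\<close>, and
  \<open>separated\<close> turns this into equality.\<close>

lemma alg_norm_eq:
  assumes b: "b \<in> carrier B"
  shows "alg_norm A B \<phi> n b = nm b"
  unfolding alg_norm_def
proof (rule the_equality)
  show "is_alg_norm A B \<phi> n b (nm b)" using b by (rule is_alg_norm_nm)
  fix a assume a: "is_alg_norm A B \<phi> n b a"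
  show "a = nm b"
  proof (rule separated_eq)
    show "a \<in> carrier A" using a by (simp add: is_alg_norm_def)
    show "nm b \<in> carrier A" using b by (rule nm_closed)
    fix F x \<zeta> assume lb: "local_basis n F x \<zeta>"
    hence F: "F \<in> carrier A" by (simp add: local_basis_def frame_def)
    interpret P: localized_algebra A B \<phi> "powers A F"
      by (intro localized_algebra.intro localized_algebra_axioms.intro comm_algebra_axioms A.localization_powers F)
    have FS: "F \<in> powers A F" unfolding powers_def using F by (intro range_eqI[of _ _ "1 :: nat"]) simp
    have "P.to_A F \<in> Units (localize A (powers A F))"
    proof -
      let ?G = "fraction A (powers A F) \<one> F"
      have "P.to_A F \<otimes>\<^bsub>localize A (powers A F)\<^esub> ?G = \<one>\<^bsub>localize A (powers A F)\<^esub>"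
        "?G \<otimes>\<^bsub>localize A (powers A F)\<^esub> P.to_A F = \<one>\<^bsub>localize A (powers A F)\<^esub>"
        using F FS by (simp_all add: P.LA.fraction_mult P.LA.one_localize P.LA.fraction_eqI)
      thus ?thesis unfolding Units_def using F FS by (intro CollectI conjI bexI[of _ ?G]) auto
    qed
    from P.L.is_basis_local_basis[OF P.local_basis_localize[OF lb] this]
    have "is_basis (localize A (powers A F)) (localize_module B \<phi> (powers A F)) n (\<lambda>j. P.to_B (x j))"
      by (simp add: localize_module_def)
    hence "P.to_A a = P.to_A (nm b)"
      using a is_alg_norm_nm[OF b] F by (simp add: is_alg_norm_def)
    then obtain u where "u \<in> powers A F" "u \<otimes> a = u \<otimes> nm b"
      using \<open>a \<in> carrier A\<close> \<open>nm b \<in> carrier A\<close> by (auto simp: P.LA.fraction_eq_iff)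
    thus "\<exists>k::nat. F [^] k \<otimes> a = F [^] k \<otimes> nm b"
      by (auto simp: powers_def)
  qed
qed

lemma nm_matrix:
  assumes b: "b \<in> carrier B"
  shows "nm b = determinant A m (\<lambda>i j. (if i = j then \<one> else \<zero>) \<oplus> \<theta> i ((b \<ominus>\<^bsub>B\<^esub> \<one>\<^bsub>B\<^esub>) \<otimes>\<^bsub>B\<^esub> g j))"
  unfolding frame_det_def
proof (rule A.determinant_cong)
  fix i j assume ij: "i < m" "j < m"
  have "(b \<ominus>\<^bsub>B\<^esub> \<one>\<^bsub>B\<^esub>) \<otimes>\<^bsub>B\<^esub> g j = b \<otimes>\<^bsub>B\<^esub> g j \<ominus>\<^bsub>B\<^esub> g j"
    using b ij db by (simp add: a_minus_def B.l_distr B.l_minus)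
  thus "(if i = j then \<one> else \<zero>) \<ominus> \<theta> i (g j) \<oplus> \<theta> i (b \<otimes>\<^bsub>B\<^esub> g j) =
      (if i = j then \<one> else \<zero>) \<oplus> \<theta> i ((b \<ominus>\<^bsub>B\<^esub> \<one>\<^bsub>B\<^esub>) \<otimes>\<^bsub>B\<^esub> g j)"
    using b ij db by (simp add: linear_form_add linear_form_uminus a_minus_def A.a_ac)
  show "(if i = j then \<one> else \<zero>) \<oplus> \<theta> i ((b \<ominus>\<^bsub>B\<^esub> \<one>\<^bsub>B\<^esub>) \<otimes>\<^bsub>B\<^esub> g j) \<in> carrier A"
    using b ij db by simp
qed

text \<open>Let \<open>X(y)\<close> be the matrix of \<open>\<theta>_i(y g_j)\<close>. Then
  \<open>nm b\<close> is the determinant of \<open>1 + X(b - 1)\<close>, contraction gives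
  \<open>X(y) X(z) = X(y z)\<close>, and
  \<open>b c - 1 = (c - 1) + (b - 1) + (b - 1) (c - 1)\<close>.\<close>

lemma nm_mult:
  assumes b: "b \<in> carrier B" and c: "c \<in> carrier B"
  shows "nm (b \<otimes>\<^bsub>B\<^esub> c) = nm b \<otimes> nm c"
proof -
  let ?\<delta> = "\<lambda>i j. if i = j then \<one> else \<zero>"
  let ?M = "\<lambda>b i j. ?\<delta> i j \<oplus> \<theta> i ((b \<ominus>\<^bsub>B\<^esub> \<one>\<^bsub>B\<^esub>) \<otimes>\<^bsub>B\<^esub> g j)"
  let ?b = "b \<ominus>\<^bsub>B\<^esub> \<one>\<^bsub>B\<^esub>" and ?c = "c \<ominus>\<^bsub>B\<^esub> \<one>\<^bsub>B\<^esub>"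
  have bc: "?b \<in> carrier B" "?c \<in> carrier B" using b c by auto
  have cl: "\<theta> i (x \<otimes>\<^bsub>B\<^esub> g j) \<in> carrier A" if "i < m" "j < m" "x \<in> carrier B" for i j x
    using that db by simp
  have \<delta>l: "(\<Oplus>k\<in>{..<m}. ?\<delta> i k \<otimes> f k) = f i" if "i < m" "\<And>k. k < m \<Longrightarrow> f k \<in> carrier A" for f i
  proof -
    have "(\<Oplus>k\<in>{..<m}. ?\<delta> i k \<otimes> f k) = (\<Oplus>k\<in>{..<m}. if i = k then f k else \<zero>)"
      using that by (intro A.finsum_cong') auto
    thus ?thesis using A.finsum_singleton[of i "{..<m}" f] that by auto
  qed
  have \<delta>r: "(\<Oplus>k\<in>{..<m}. f k \<otimes> ?\<delta> k j) = f j" if "j < m" "\<And>k. k < m \<Longrightarrow> f k \<in> carrier A" for f j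
  proof -
    have "(\<Oplus>k\<in>{..<m}. f k \<otimes> ?\<delta> k j) = (\<Oplus>k\<in>{..<m}. if j = k then f k else \<zero>)"
      using that by (intro A.finsum_cong') auto
    thus ?thesis using A.finsum_singleton[of j "{..<m}" f] that by auto
  qed
  have "nm b \<otimes> nm c = determinant A m (\<lambda>i j. \<Oplus>k\<in>{..<m}. ?M b i k \<otimes> ?M c k j)"
    unfolding nm_matrix[OF b] nm_matrix[OF c] using bc cl by (intro A.determinant_mult[symmetric]) auto
  also have "\<dots> = determinant A m (\<lambda>i j. ?M (b \<otimes>\<^bsub>B\<^esub> c) i j)"
  proof (rule A.determinant_cong)
    fix i j assume ij: "i < m" "j < m"
    show "?M (b \<otimes>\<^bsub>B\<^esub> c) i j \<in> carrier A" using ij b c cl by auto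
    have "(\<Oplus>k\<in>{..<m}. ?M b i k \<otimes> ?M c k j) =
        (\<Oplus>k\<in>{..<m}. ?\<delta> i k \<otimes> ?M c k j \<oplus>
          (\<theta> i (?b \<otimes>\<^bsub>B\<^esub> g k) \<otimes> ?\<delta> k j \<oplus> \<theta> i (?b \<otimes>\<^bsub>B\<^esub> g k) \<otimes> \<theta> k (?c \<otimes>\<^bsub>B\<^esub> g j)))"
      using ij bc cl by (intro A.finsum_cong') (simp_all add: A.l_distr A.r_distr A.a_ac)
    also have "\<dots> = (\<Oplus>k\<in>{..<m}. ?\<delta> i k \<otimes> ?M c k j) \<oplus>
          ((\<Oplus>k\<in>{..<m}. \<theta> i (?b \<otimes>\<^bsub>B\<^esub> g k) \<otimes> ?\<delta> k j) \<oplus>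
           (\<Oplus>k\<in>{..<m}. \<theta> i (?b \<otimes>\<^bsub>B\<^esub> g k) \<otimes> \<theta> k (?c \<otimes>\<^bsub>B\<^esub> g j)))"
      using ij bc cl by (simp add: A.finsum_addf Pi_def)
    also have "\<dots> = ?M c i j \<oplus> (\<theta> i (?b \<otimes>\<^bsub>B\<^esub> g j) \<oplus> \<theta> i (?b \<otimes>\<^bsub>B\<^esub> (?c \<otimes>\<^bsub>B\<^esub> g j)))"
    proof -
      have "(\<Oplus>k\<in>{..<m}. ?\<delta> i k \<otimes> ?M c k j) = ?M c i j"
        using ij bc cl by (intro \<delta>l) auto
      moreover have "(\<Oplus>k\<in>{..<m}. \<theta> i (?b \<otimes>\<^bsub>B\<^esub> g k) \<otimes> ?\<delta> k j) = \<theta> i (?b \<otimes>\<^bsub>B\<^esub> g j)"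
        using ij bc cl by (intro \<delta>r) auto
      moreover have "(\<Oplus>k\<in>{..<m}. \<theta> i (?b \<otimes>\<^bsub>B\<^esub> g k) \<otimes> \<theta> k (?c \<otimes>\<^bsub>B\<^esub> g j)) = \<theta> i (?b \<otimes>\<^bsub>B\<^esub> (?c \<otimes>\<^bsub>B\<^esub> g j))"
        using linear_form_frame[OF dual_basis db(3)[OF ij(1)] bc(1), of "?c \<otimes>\<^bsub>B\<^esub> g j"] ij bc db by simp
      ultimately show ?thesis by simp
    qed
    also have "\<dots> = ?M (b \<otimes>\<^bsub>B\<^esub> c) i j"
    proof -
      have "b \<otimes>\<^bsub>B\<^esub> c \<ominus>\<^bsub>B\<^esub> \<one>\<^bsub>B\<^esub> = ?c \<oplus>\<^bsub>B\<^esub> (?b \<oplus>\<^bsub>B\<^esub> ?b \<otimes>\<^bsub>B\<^esub> ?c)"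
        using b c B.one_closed by algebra
      hence "(b \<otimes>\<^bsub>B\<^esub> c \<ominus>\<^bsub>B\<^esub> \<one>\<^bsub>B\<^esub>) \<otimes>\<^bsub>B\<^esub> g j =
          ?c \<otimes>\<^bsub>B\<^esub> g j \<oplus>\<^bsub>B\<^esub> (?b \<otimes>\<^bsub>B\<^esub> g j \<oplus>\<^bsub>B\<^esub> ?b \<otimes>\<^bsub>B\<^esub> (?c \<otimes>\<^bsub>B\<^esub> g j))"
        using bc ij db by (simp add: B.l_distr B.m_assoc)
      thus ?thesis using bc ij db cl by (simp add: linear_form_add A.a_assoc)
    qed
    finally show "(\<Oplus>k\<in>{..<m}. ?M b i k \<otimes> ?M c k j) = ?M (b \<otimes>\<^bsub>B\<^esub> c) i j" .
  qed
  also have "\<dots> = nm (b \<otimes>\<^bsub>B\<^esub> c)" using b c by (intro nm_matrix[symmetric]) simp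
  finally show ?thesis ..
qed

lemma nm_one: "nm \<one>\<^bsub>B\<^esub> = \<one>"
proof -
  interpret h: class_hom A "free_value A" by (rule A.class_hom_free_value)
  have "nm \<one>\<^bsub>B\<^esub> = determinant A m (\<lambda>i j. free_value A (if i = j then 1 else 0))"
    unfolding nm_matrix[OF B.one_closed]
    by (rule A.determinant_cong) (use db in \<open>auto simp: h.hom_simps a_minus_def B.r_neg linear_form_zero\<close>)
  thus ?thesis by (simp add: h.determinant_hom class_det_one h.one)
qed

interpretation PA: UP_cring A "UP A" by (simp_all add: UP_cring_def A.is_cring)
interpretation PB: UP_cring B "UP B" by (simp_all add: UP_cring_def B.is_cring)
interpretation P: comm_algebra "UP A" "UP B" "UP_map \<phi>" by (rule comm_algebra_UP)

lemma monom_const_pow: "a \<in> carrier A \<Longrightarrow> UnivPoly.monom (UP A) a 0 [^]\<^bsub>UP A\<^esub> (k::nat) = UnivPoly.monom (UP A) (a [^] k) 0"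
  using PA.monom_pow[of a 0 k] by simp

lemma local_basis_UP:
  assumes "local_basis n F x \<zeta>"
  shows "P.local_basis n (UnivPoly.monom (UP A) F 0) (\<lambda>j. UnivPoly.monom (UP B) (x j) 0) (\<lambda>j. UP_map (\<zeta> j))"
proof -
  have fr: "frame n F x \<zeta>" using assms by (simp add: local_basis_def)
  note f = frameD[OF fr]
  have "UP_map (\<zeta> k) (UnivPoly.monom (UP B) (x l) 0) = (if k = l then UnivPoly.monom (UP A) F 0 else \<zero>\<^bsub>UP A\<^esub>)"
    if "k < n" "l < n" for k l
    using that f assms
    by (intro PA.up_eqI) (auto simp: UP_map_linear_form local_basis_def linear_form_zero)
  thus ?thesis using frame_UP[OF fr] by (auto simp: P.local_basis_def)
qed

text \<open>Separation can be tested coefficient by coefficient, because a local basis over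
  \<open>A\<close> remains one over the polynomial ring, with a constant multiplier
  \<open>F\<close>.\<close>

lemma ranked_algebra_UP:
  "ranked_algebra (UP A) (UP B) (UP_map \<phi>) n m (\<lambda>j. UnivPoly.monom (UP B) (g j) 0) (\<lambda>j. UP_map (\<theta> j))"
proof
  show "P.frame m \<one>\<^bsub>UP A\<^esub> (\<lambda>j. UnivPoly.monom (UP B) (g j) 0) (\<lambda>j. UP_map (\<theta> j))"
    using frame_UP[OF dual_basis] by simp
  fix p assume p: "p \<in> carrier (UP A)"
    and *: "\<And>F x \<zeta>. P.local_basis n F x \<zeta> \<Longrightarrow> \<exists>k::nat. F [^]\<^bsub>UP A\<^esub> k \<otimes>\<^bsub>UP A\<^esub> p = \<zero>\<^bsub>UP A\<^esub>"
  have "UnivPoly.coeff (UP A) p i = \<zero>" for i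
  proof (rule separated)
    fix F x \<zeta> assume lb: "local_basis n F x \<zeta>"
    hence F: "F \<in> carrier A" by (simp add: local_basis_def frame_def)
    obtain k :: nat where "UnivPoly.monom (UP A) F 0 [^]\<^bsub>UP A\<^esub> k \<otimes>\<^bsub>UP A\<^esub> p = \<zero>\<^bsub>UP A\<^esub>"
      using *[OF local_basis_UP[OF lb]] by blast
    hence "UnivPoly.coeff (UP A) (UnivPoly.monom (UP A) (F [^] k) 0 \<otimes>\<^bsub>UP A\<^esub> p) i = \<zero>"
      by (simp add: monom_const_pow F)
    thus "\<exists>k::nat. F [^] k \<otimes> UnivPoly.coeff (UP A) p i = \<zero>"
      using F p by (auto simp: PA.coeff_mult_const simp del: PA.coeff_mult)
  qed (use p in simp)
  thus "p = \<zero>\<^bsub>UP A\<^esub>" using p by (intro PA.up_eqI) auto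
qed

end

section \<open>Polarized norms\<close>

text \<open>The outer exponent comes first, in accordance with \<open>polarized_norm\<close>:
  \<open>k\<close> belongs to \<lambda>_1 and \<open>l\<close> to \<lambda>_2.\<close>

definition bihomogeneous :: "nat \<Rightarrow> 'x :: comm_ring_1 poly poly \<Rightarrow> bool" where
  "bihomogeneous d p \<longleftrightarrow> (\<forall>k l. k + l \<noteq> d \<longrightarrow> Polynomial.coeff (Polynomial.coeff p k) l = 0)"

lemma bihomogeneous_mult:
  assumes "bihomogeneous d p" "bihomogeneous e q"
  shows "bihomogeneous (d + e) (p * q)"
  unfolding bihomogeneous_def
proof (intro allI impI)
  fix k l assume kl: "k + l \<noteq> d + e"
  have "Polynomial.coeff (Polynomial.coeff p i) j * Polynomial.coeff (Polynomial.coeff q (k - i)) (l - j) = 0"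
    if "i \<le> k" "j \<le> l" for i j
  proof -
    have "i + j \<noteq> d \<or> (k - i) + (l - j) \<noteq> e" using that kl by linarith
    thus ?thesis using assms by (auto simp: bihomogeneous_def)
  qed
  thus "Polynomial.coeff (Polynomial.coeff (p * q) k) l = 0"
    by (simp add: coeff_mult coeff_sum)
qed

lemma bihomogeneous_prod:
  "finite I \<Longrightarrow> (\<And>i. i \<in> I \<Longrightarrow> bihomogeneous 1 (f i)) \<Longrightarrow> bihomogeneous (card I) (\<Prod>i\<in>I. f i)"
proof (induction rule: finite_induct)
  case empty
  show ?case by (auto simp: bihomogeneous_def)
next
  case (insert x I)
  thus ?case using bihomogeneous_mult[of 1 "f x" "card I" "\<Prod>i\<in>I. f i"] by simp
qed

text \<open>The entries are linear forms \<open>b \<lambda>_1 + c \<lambda>_2\<close>, and each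
  Leibniz term is a product of \<open>n\<close> of them.\<close>

lemma bihomogeneous_class_det:
  "bihomogeneous n (class_det n (\<lambda>i j. [:[:0, c i j:], [:b i j:]:]))"
proof -
  have "bihomogeneous n (of_int (sign p) * (\<Prod>i<n. [:[:0, c i (p i):], [:b i (p i):]:]))" for p :: "nat \<Rightarrow> nat"
  proof -
    have "bihomogeneous 1 [:[:0, c i j:], [:b i j:]:]" for i j
      by (auto simp: bihomogeneous_def coeff_pCons split: nat.splits)
    hence "bihomogeneous n (\<Prod>i<n. [:[:0, c i (p i):], [:b i (p i):]:])"
      using bihomogeneous_prod[of "{..<n}" "\<lambda>i. [:[:0, c i (p i):], [:b i (p i):]:]"] by simp
    thus ?thesis by (auto simp: sign_def bihomogeneous_def)
  qed
  thus ?thesis unfolding class_det_eq by (auto simp: bihomogeneous_def coeff_sum)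
qed

context ranked_algebra
begin

text \<open>The matrix of \<open>\<theta>_i(g_j)\<close> is the idempotent projecting the free
  module onto its copy of \<open>B\<close>. This is the complementary projection, the part of the
  norm matrix that does not depend on \<open>b\<close>.\<close>

definition defect :: "nat \<Rightarrow> nat \<Rightarrow> 'a" where
  "defect i j = (if i = j then \<one> else \<zero>) \<ominus> \<theta> i (g j)"

lemma defect_closed: "i < m \<Longrightarrow> j < m \<Longrightarrow> defect i j \<in> carrier A"
  using db by (simp add: defect_def)

text \<open>\<open>M\<close> may be any matrix with the right values under \<open>h\<close>, not
  just a matrix of variables. Structured entries such as sums of variables are what later formal
  identities need.\<close>

lemma nm_class_det:
  assumes h: "class_hom A h" and b: "b \<in> carrier B"
    and M: "\<And>i j. i < m \<Longrightarrow> j < m \<Longrightarrow> h (M i j) = defect i j \<oplus> \<theta> i (b \<otimes>\<^bsub>B\<^esub> g j)"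
  shows "nm b = h (class_det m M)"
proof -
  interpret h: class_hom A h by fact
  show ?thesis unfolding h.determinant_hom[symmetric] frame_det_def
    using M b db by (intro A.determinant_cong) (auto simp: defect_def)
qed

end

context ranked_algebra
begin

interpretation PA: UP_cring A "UP A" by (simp_all add: UP_cring_def A.is_cring)
interpretation PB: UP_cring B "UP B" by (simp_all add: UP_cring_def B.is_cring)
interpretation P: ranked_algebra "UP A" "UP B" "UP_map \<phi>" n m
  "\<lambda>j. UnivPoly.monom (UP B) (g j) 0" "\<lambda>j. UP_map (\<theta> j)"
  by (rule ranked_algebra_UP)

text \<open>The same over the polynomial ring, with entries compared coefficientwise. The defect is
  a constant polynomial and so contributes only at \<open>l = 0\<close>.\<close>

lemma nm_UP_class_det:
  assumes h: "class_hom A h" and z: "z \<in> carrier (UP B)"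
    and M: "\<And>i j l. i < m \<Longrightarrow> j < m \<Longrightarrow> h (Polynomial.coeff (M i j) l) =
      (if l = 0 then defect i j else \<zero>) \<oplus> \<theta> i (UnivPoly.coeff (UP B) z l \<otimes>\<^bsub>B\<^esub> g j)"
  shows "P.nm z = UP_hom h (class_det m M)"
proof (rule P.nm_class_det)
  interpret h: class_hom A h by fact
  show "class_hom (UP A) (UP_hom h)" by (rule h.class_hom_UP)
  show "z \<in> carrier (UP B)" by (rule z)
  fix i j assume ij: "i < m" "j < m"
  have "UnivPoly.coeff (UP A) (P.defect i j \<oplus>\<^bsub>UP A\<^esub> UP_map (\<theta> i) (z \<otimes>\<^bsub>UP B\<^esub> UnivPoly.monom (UP B) (g j) 0)) l =
      (if l = 0 then defect i j else \<zero>) \<oplus> \<theta> i (UnivPoly.coeff (UP B) z l \<otimes>\<^bsub>B\<^esub> g j)" for l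
    using ij z db P.db P.defect_closed[OF ij]
    by (simp add: UP_map_linear_form PB.coeff_mult_const P.defect_def defect_def linear_form_zero
        a_minus_def if_distrib[of "\<lambda>x. UnivPoly.coeff _ x _"] del: PB.coeff_mult)
  thus "UP_hom h (M i j) = P.defect i j \<oplus>\<^bsub>UP A\<^esub> UP_map (\<theta> i) (z \<otimes>\<^bsub>UP B\<^esub> UnivPoly.monom (UP B) (g j) 0)"
    using ij z P.db(2,5) P.defect_closed[OF ij]
    by (intro PA.up_eqI) (simp_all add: h.coeff_UP_hom h.UP_hom_closed M)
qed

end

context ranked_algebra
begin

interpretation PA: UP_cring A "UP A" by (simp_all add: UP_cring_def A.is_cring)
interpretation PB: UP_cring B "UP B" by (simp_all add: UP_cring_def B.is_cring)
interpretation P: ranked_algebra "UP A" "UP B" "UP_map \<phi>" n m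
  "\<lambda>j. UnivPoly.monom (UP B) (g j) 0" "\<lambda>j. UP_map (\<theta> j)"
  by (rule ranked_algebra_UP)

interpretation PPA: UP_cring "UP A" "UP (UP A)" by (simp_all add: UP_cring_def PA.UP_cring)
interpretation PPB: UP_cring "UP B" "UP (UP B)" by (simp_all add: UP_cring_def PB.UP_cring)
interpretation PP: ranked_algebra "UP (UP A)" "UP (UP B)" "UP_map (UP_map \<phi>)" n m
  "\<lambda>j. UnivPoly.monom (UP (UP B)) (UnivPoly.monom (UP B) (g j) 0) 0" "\<lambda>j. UP_map (UP_map (\<theta> j))"
  by (rule P.ranked_algebra_UP)

definition bivariate :: "'b \<Rightarrow> 'b \<Rightarrow> nat \<Rightarrow> nat \<Rightarrow> 'b" where
  "bivariate b c = UnivPoly.monom (UP (UP B)) (UnivPoly.monom (UP B) b 0) 1 \<oplus>\<^bsub>UP (UP B)\<^esub>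
    UnivPoly.monom (UP (UP B)) (UnivPoly.monom (UP B) c 1) 0"

lemma bivariate_closed: "b \<in> carrier B \<Longrightarrow> c \<in> carrier B \<Longrightarrow> bivariate b c \<in> carrier (UP (UP B))"
  by (simp add: bivariate_def)

lemma coeff_bivariate:
  "b \<in> carrier B \<Longrightarrow> c \<in> carrier B \<Longrightarrow> UnivPoly.coeff (UP (UP B)) (bivariate b c) k =
    (if k = 0 then UnivPoly.monom (UP B) c 1 else if k = 1 then UnivPoly.monom (UP B) b 0 else \<zero>\<^bsub>UP B\<^esub>)"
  by (simp add: bivariate_def)

lemma polarized_norm_eq:
  assumes "b \<in> carrier B" "c \<in> carrier B"
  shows "polarized_norm A B \<phi> n k l b c =
    UnivPoly.coeff (UP A) (UnivPoly.coeff (UP (UP A)) (PP.nm (bivariate b c)) k) l"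
  using PP.alg_norm_eq[OF bivariate_closed[OF assms]]
  by (simp add: polarized_norm_def bivariate_def)

text \<open>The entry \<open>[:[:q, c:], [:b:]:]\<close> is
  \<open>q + c \<lambda>_2 + b \<lambda>_1\<close>, the norm matrix of the argument of the polarized
  norm.\<close>

lemma polarized_norm_class_det:
  assumes h: "class_hom A h" and b: "b \<in> carrier B" and c: "c \<in> carrier B"
    and q: "\<And>i j. i < m \<Longrightarrow> j < m \<Longrightarrow> h (q i j) = defect i j"
    and b': "\<And>i j. i < m \<Longrightarrow> j < m \<Longrightarrow> h (b' i j) = \<theta> i (b \<otimes>\<^bsub>B\<^esub> g j)"
    and c': "\<And>i j. i < m \<Longrightarrow> j < m \<Longrightarrow> h (c' i j) = \<theta> i (c \<otimes>\<^bsub>B\<^esub> g j)"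
  shows "polarized_norm A B \<phi> n k l b c =
    h (Polynomial.coeff (Polynomial.coeff (class_det m (\<lambda>i j. [:[:q i j, c' i j:], [:b' i j:]:])) k) l)"
proof -
  interpret h: class_hom A h by fact
  interpret H: class_hom "UP A" "UP_hom h" by (rule h.class_hom_UP)
  have "PP.nm (bivariate b c) = UP_hom (UP_hom h) (class_det m (\<lambda>i j. [:[:q i j, c' i j:], [:b' i j:]:]))"
  proof (rule P.nm_UP_class_det[OF h.class_hom_UP bivariate_closed[OF b c]])
    fix i j k :: nat assume ij: "i < m" "j < m"
    have cl: "P.defect i j \<in> carrier (UP A)" using P.defect_closed[OF ij] .
    have Pd: "UnivPoly.coeff (UP A) (P.defect i j) l = (if l = 0 then defect i j else \<zero>)" for l
      using ij db P.db by (simp add: UP_map_linear_form P.defect_def defect_def linear_form_zero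
        a_minus_def if_distrib[of "\<lambda>x. UnivPoly.coeff _ x _"])
    have mc: "UnivPoly.monom (UP B) x e \<otimes>\<^bsub>UP B\<^esub> UnivPoly.monom (UP B) (g j) 0 = UnivPoly.monom (UP B) (x \<otimes>\<^bsub>B\<^esub> g j) e"
      if "x \<in> carrier B" for x e
      using that ij db by (intro PB.up_eqI) (auto simp: PB.coeff_mult_const simp del: PB.coeff_mult)
    have th: "UnivPoly.coeff (UP A) (UP_map (\<theta> i) (UnivPoly.monom (UP B) x e)) l = (if e = l then \<theta> i x else \<zero>)"
        "UP_map (\<theta> i) (UnivPoly.monom (UP B) x e) \<in> carrier (UP A)"
      if "x \<in> carrier B" for x e l
      using that ij db by (simp_all add: UP_map_linear_form linear_form_zero)
    consider "k = 0" | "k = 1" | "k \<ge> 2" by linarith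
    thus "UP_hom h (Polynomial.coeff [:[:q i j, c' i j:], [:b' i j:]:] k) =
        (if k = 0 then P.defect i j else \<zero>\<^bsub>UP A\<^esub>) \<oplus>\<^bsub>UP A\<^esub>
        UP_map (\<theta> i) (UnivPoly.coeff (UP (UP B)) (bivariate b c) k \<otimes>\<^bsub>UP B\<^esub> UnivPoly.monom (UP B) (g j) 0)"
    proof cases
      case 1
      show ?thesis using 1 ij b c db cl
        by (intro PA.up_eqI) (auto simp: coeff_bivariate mc h.coeff_UP_hom h.UP_hom_closed th Pd q c' h.zero
            defect_closed coeff_pCons split: nat.splits)
    next
      case 2
      show ?thesis using 2 ij b c db cl
        by (intro PA.up_eqI) (auto simp: coeff_bivariate mc h.coeff_UP_hom h.UP_hom_closed th Pd b' h.zero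
            coeff_pCons split: nat.splits)
    next
      case 3
      hence "Polynomial.coeff [:[:q i j, c' i j:], [:b' i j:]:] k = 0"
        by (auto simp: coeff_pCons split: nat.splits)
      thus ?thesis using 3 ij b c db P.db
        by (simp add: coeff_bivariate H.zero P.linear_form_zero)
    qed
  qed
  thus ?thesis using b c by (simp add: polarized_norm_eq H.coeff_UP_hom h.coeff_UP_hom)
qed

lemma polarized_norm_closed:
  "b \<in> carrier B \<Longrightarrow> c \<in> carrier B \<Longrightarrow> polarized_norm A B \<phi> n k l b c \<in> carrier A"
  using PP.nm_closed[OF bivariate_closed] by (simp add: polarized_norm_eq)

text \<open>The constant defect in its entries keeps the global matrix from being visibly
  homogeneous. In a local basis the norm becomes, up to powers of \<open>F\<close>, an
  \<open>n\<close> by \<open>n\<close> determinant of linear forms without constant term;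
  \<open>separated\<close> removes the powers of \<open>F\<close>.\<close>

lemma polarized_norm_homogeneous:
  assumes b: "b \<in> carrier B" and c: "c \<in> carrier B" and kl: "k + l \<noteq> n"
  shows "polarized_norm A B \<phi> n k l b c = \<zero>"
proof (rule separated)
  show "polarized_norm A B \<phi> n k l b c \<in> carrier A" using b c by (rule polarized_norm_closed)
  fix F x \<zeta> assume lb: "local_basis n F x \<zeta>"
  hence fr: "frame n F x \<zeta>" by (simp add: local_basis_def)
  note f = frameD[OF fr]
  let ?h = "free_value A"
  interpret h: class_hom A ?h by (rule A.class_hom_free_value)
  interpret H: class_hom "UP A" "UP_hom ?h" by (rule h.class_hom_UP)
  interpret HH: class_hom "UP (UP A)" "UP_hom (UP_hom ?h)" by (rule H.class_hom_UP)
  let ?F = "UnivPoly.monom (UP (UP A)) (UnivPoly.monom (UP A) F 0) 0"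
  let ?G = "\<lambda>e::nat. UnivPoly.monom (UP (UP A)) (UnivPoly.monom (UP A) (F [^] e) 0) 0"
  have Fpow: "?F [^]\<^bsub>UP (UP A)\<^esub> e = ?G e" for e :: nat
    using f(1) by (simp add: P.monom_const_pow monom_const_pow)
  let ?z = "bivariate b c"
  have z: "?z \<in> carrier (UP (UP B))" using b c by (rule bivariate_closed)
  let ?D = "class_det n (\<lambda>i j. [:[:0, free_var (\<zeta> i (c \<otimes>\<^bsub>B\<^esub> x j)):], [:free_var (\<zeta> i (b \<otimes>\<^bsub>B\<^esub> x j)):]:])"
  have "determinant (UP (UP A)) n (\<lambda>i j. UP_map (UP_map (\<zeta> i)) (?z \<otimes>\<^bsub>UP (UP B)\<^esub> UnivPoly.monom (UP (UP B)) (UnivPoly.monom (UP B) (x j) 0) 0)) =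
      UP_hom (UP_hom ?h) ?D"
    unfolding HH.determinant_hom[symmetric]
  proof (rule cring.determinant_cong[OF PPA.UP_cring])
    fix i j assume ij: "i < n" "j < n"
    show "UP_hom (UP_hom ?h) [:[:0, free_var (\<zeta> i (c \<otimes>\<^bsub>B\<^esub> x j)):], [:free_var (\<zeta> i (b \<otimes>\<^bsub>B\<^esub> x j)):]:] \<in> carrier (UP (UP A))"
      by simp
    have lin: "linear_form (\<zeta> i)" "P.linear_form (UP_map (\<zeta> i))" using f ij by (auto intro: linear_form_UP)
    have cl: "UnivPoly.coeff (UP (UP B)) ?z k \<in> carrier (UP B)" for k using z by simp
    have cl': "?z \<otimes>\<^bsub>UP (UP B)\<^esub> UnivPoly.monom (UP (UP B)) (UnivPoly.monom (UP B) (x j) 0) 0 \<in> carrier (UP (UP B))"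
      using z f ij by simp
    have cc: "UnivPoly.coeff (UP B) (UnivPoly.coeff (UP (UP B)) ?z k) l =
        (if k = 0 \<and> l = 1 then c else if k = 1 \<and> l = 0 then b else \<zero>\<^bsub>B\<^esub>)" for k l
      using b c by (simp add: coeff_bivariate)
    show "UP_map (UP_map (\<zeta> i)) (?z \<otimes>\<^bsub>UP (UP B)\<^esub> UnivPoly.monom (UP (UP B)) (UnivPoly.monom (UP B) (x j) 0) 0) =
        UP_hom (UP_hom ?h) [:[:0, free_var (\<zeta> i (c \<otimes>\<^bsub>B\<^esub> x j)):], [:free_var (\<zeta> i (b \<otimes>\<^bsub>B\<^esub> x j)):]:]"
    proof (rule PPA.up_eqI; (rule PA.up_eqI)?)
      fix k l
      show "UnivPoly.coeff (UP A) (UnivPoly.coeff (UP (UP A)) (UP_map (UP_map (\<zeta> i)) (?z \<otimes>\<^bsub>UP (UP B)\<^esub> UnivPoly.monom (UP (UP B)) (UnivPoly.monom (UP B) (x j) 0) 0)) k) l =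
        UnivPoly.coeff (UP A) (UnivPoly.coeff (UP (UP A)) (UP_hom (UP_hom ?h) [:[:0, free_var (\<zeta> i (c \<otimes>\<^bsub>B\<^esub> x j)):], [:free_var (\<zeta> i (b \<otimes>\<^bsub>B\<^esub> x j)):]:]) k) l"
        using b c z f ij lin cl
        by (auto simp: P.UP_map_linear_form[OF lin(2) cl'] UP_map_linear_form[OF lin(1)] PPB.coeff_mult_const PB.coeff_mult_const cc
            H.coeff_UP_hom h.coeff_UP_hom h.zero A.free_value_var linear_form_zero coeff_pCons
            simp del: PB.coeff_mult PPB.coeff_mult split: nat.splits)
    qed (use P.UP_map_linear_form(1)[OF lin(2) cl'] in simp_all)
  qed
  with PP.frame_det_local_basis[OF PP.dual_basis P.local_basis_UP[OF local_basis_UP[OF lb]] z]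
  have eq: "?G n \<otimes>\<^bsub>UP (UP A)\<^esub> (?G m \<otimes>\<^bsub>UP (UP A)\<^esub> PP.nm ?z) = ?G m \<otimes>\<^bsub>UP (UP A)\<^esub> UP_hom (UP_hom ?h) ?D"
    by (simp add: Fpow)
  have "F [^] n \<otimes> (F [^] m \<otimes> polarized_norm A B \<phi> n k l b c) =
      F [^] m \<otimes> ?h (Polynomial.coeff (Polynomial.coeff ?D k) l)"
    using arg_cong[OF eq, of "\<lambda>p. UnivPoly.coeff (UP A) (UnivPoly.coeff (UP (UP A)) p k) l"] f(1) z PP.nm_closed[OF z]
    by (simp add: PPA.coeff_mult_const PA.coeff_mult_const polarized_norm_eq[OF b c]
        H.coeff_UP_hom h.coeff_UP_hom del: PA.coeff_mult PPA.coeff_mult)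
  also have "Polynomial.coeff (Polynomial.coeff ?D k) l = 0"
    by (rule bihomogeneous_class_det[unfolded bihomogeneous_def, rule_format, OF kl])
  finally have "F [^] (n + m) \<otimes> polarized_norm A B \<phi> n k l b c = \<zero>"
    using f(1) polarized_norm_closed[OF b c] by (simp add: h.zero A.m_assoc flip: A.nat_pow_mult)
  thus "\<exists>k'::nat. F [^] k' \<otimes> polarized_norm A B \<phi> n k l b c = \<zero>" by blast
qed

end

section \<open>Substitution into generic determinants and difference quotients\<close>

lemma poly_sum_bound: "degree p \<le> N \<Longrightarrow> poly p (x :: 'x :: comm_ring_1) = (\<Sum>i\<le>N. Polynomial.coeff p i * x ^ i)"
  unfolding poly_altdef by (rule sum.mono_neutral_left) (auto simp: coeff_eq_0)

lemma (in class_hom) sum_cong: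
  "finite I \<Longrightarrow> (\<And>i. i \<in> I \<Longrightarrow> h (f i) = h (f' i)) \<Longrightarrow> h (\<Sum>i\<in>I. f i) = h (\<Sum>i\<in>I. f' i)"
  unfolding sum by (rule finsum_cong') auto

lemma (in class_hom) poly_cong:
  assumes "\<And>i. h (Polynomial.coeff p i) = h (Polynomial.coeff p' i)"
  shows "h (poly p x) = h (poly p' x)"
  using assms
  by (auto simp: poly_sum_bound[of p "max (degree p) (degree p')"] poly_sum_bound[of p' "max (degree p) (degree p')"]
      mult intro!: sum_cong)

lemma (in class_hom) UP_hom_eq_iff: "UP_hom h p = UP_hom h p' \<longleftrightarrow> (\<forall>i. h (Polynomial.coeff p i) = h (Polynomial.coeff p' i))"
  by (auto simp: UP_hom_def fun_eq_iff)

text \<open>Because \<open>1 + v\<close> has constant coefficient \<open>1\<close>, the images of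
  the coefficients of \<open>p\<close> vanish one after another from the bottom, over any
  ring.\<close>

lemma (in class_hom) UP_hom_cancel:
  assumes "UP_hom h ([:1, 1:] * p) = UP_hom h 0"
  shows "UP_hom h p = UP_hom h 0"
proof -
  have "h (Polynomial.coeff p i) = \<zero>" for i
  proof (induction i)
    case 0
    have "Polynomial.coeff ([:1, 1:] * p) 0 = Polynomial.coeff p 0" by (simp add: coeff_mult)
    thus ?case using assms by (metis UP_hom_eq_iff coeff_0 zero)
  next
    case (Suc i)
    have "Polynomial.coeff ([:1, 1:] * p) (Suc i) = Polynomial.coeff p (Suc i) + Polynomial.coeff p i" by simp
    hence "h (Polynomial.coeff p (Suc i)) \<oplus> h (Polynomial.coeff p i) = \<zero>"
      using assms by (metis UP_hom_eq_iff add coeff_0 zero)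
    thus ?case using Suc by simp
  qed
  thus ?thesis by (simp add: UP_hom_eq_iff zero)
qed

lemma comm_ring_hom_const: "comm_ring_hom (\<lambda>x :: 'x :: comm_ring_1. [:x:])"
  by unfold_locales (auto simp: one_pCons)

lemma comm_ring_hom_poly: "comm_ring_hom (\<lambda>p. poly p (x :: 'x :: comm_ring_1))"
  by unfold_locales auto

lemma comm_ring_hom_map_poly:
  assumes "comm_ring_hom f"
  shows "comm_ring_hom (map_poly f)"
proof -
  interpret f: comm_ring_hom f by fact
  show ?thesis
    by unfold_locales
      (auto intro!: poly_eqI simp: coeff_map_poly coeff_mult f.hom_sum f.hom_mult f.hom_add one_pCons coeff_pCons split: nat.splits)
qed

lemma comm_ring_hom_comp:
  assumes "comm_ring_hom f" "comm_ring_hom f'"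
  shows "comm_ring_hom (\<lambda>x. f (f' x))"
proof -
  interpret f: comm_ring_hom f by fact
  interpret f': comm_ring_hom f' by fact
  show ?thesis by unfold_locales (auto simp: hom_distribs)
qed

text \<open>Determinants commute with the substitution of \<open>e\<close> for the inner and
  \<open>p\<close> for the outer variable. Later \<open>\<psi>\<close> is the identity or the
  embedding as constant polynomials.\<close>

lemma class_det_eval:
  assumes \<psi>: "comm_ring_hom \<psi>"
  shows "class_det m (\<lambda>i j. \<psi> (q i j) + e * \<psi> (c i j) + p * \<psi> (b i j)) =
    poly (map_poly (\<lambda>r. poly (map_poly \<psi> r) e) (class_det m (\<lambda>i j. [:[:q i j, c i j:], [:b i j:]:]))) p"
proof -
  interpret \<psi>: comm_ring_hom \<psi> by fact
  let ?f = "\<lambda>r. poly (map_poly \<psi> r) e"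
  have f: "comm_ring_hom ?f"
    by (rule comm_ring_hom_comp[OF comm_ring_hom_poly comm_ring_hom_map_poly[OF \<psi>]])
  interpret f: comm_ring_hom ?f by (rule f)
  interpret E: comm_ring_hom "\<lambda>D. poly (map_poly ?f D) p"
    by (rule comm_ring_hom_comp[OF comm_ring_hom_poly comm_ring_hom_map_poly[OF f]])
  show ?thesis unfolding E.hom_class_det
    by (simp add: Polynomial.map_poly_pCons)
qed

text \<open>The formal quotient \<open>(p(x) - p(0)) / x\<close>: the constant coefficient is
  dropped and the rest shifted, which makes sense even if \<open>x\<close> is a zero
  divisor.\<close>

definition divided_difference :: "'x :: comm_ring_1 poly \<Rightarrow> 'x \<Rightarrow> 'x" where
  "divided_difference p x = poly (poly_shift 1 p) x"

lemma divided_difference_pCons: "divided_difference (pCons a p) x = poly p x"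
proof -
  have "poly_shift 1 (pCons a p) = p" by (intro poly_eqI) (simp add: coeff_poly_shift)
  thus ?thesis by (simp add: divided_difference_def)
qed

lemma divided_difference_add: "divided_difference (p + q) x = divided_difference p x + divided_difference q x"
proof -
  have "poly_shift 1 (p + q) = poly_shift 1 p + poly_shift 1 q" by (intro poly_eqI) (simp add: coeff_poly_shift)
  thus ?thesis by (simp add: divided_difference_def)
qed

text \<open>The factor \<open>c + x\<close> vanishes at \<open>x = -c\<close>, so formally the
  quotient is \<open>(0 - c p(0)) / (-c)\<close>. Working with coefficients avoids the
  division.\<close>

lemma divided_difference_mult_linear:
  "divided_difference ([:c, 1:] * p) (- c) = poly p (0 :: 'x :: comm_ring_1)"
proof -
  obtain a r where p: "p = pCons a r" by (cases p)
  have "[:c, 1:] * p = pCons (c * a) (smult c r + p)"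
    by (simp add: p)
  thus ?thesis by (simp add: divided_difference_pCons p algebra_simps)
qed

text \<open>Write \<open>D(x, y)\<close> with \<open>x\<close> outer and \<open>y\<close> inner. The
  left side is the quotient along the line \<open>x = c + y\<close> at \<open>y = -c\<close>,
  formally \<open>(D(0, -c) - D(c, 0)) / (-c)\<close>. Inserting \<open>D(0, 0)\<close> splits it
  into the quotients along the two axes.\<close>

lemma divided_difference_bivariate:
  fixes c :: "'x :: comm_ring_1"
  shows "divided_difference (poly D [:c, 1:]) (- c) =
    divided_difference (poly D 0) (- c) + divided_difference (map_poly (\<lambda>p. poly p 0) D) c"
proof -
  obtain D0 R where D: "D = pCons D0 R" by (cases D)
  have "poly (poly R [:c, 1:]) 0 = poly (map_poly (\<lambda>p. poly p 0) R) c"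
    by (induction R) (auto simp: Polynomial.map_poly_pCons)
  thus ?thesis
    by (simp add: D divided_difference_add divided_difference_mult_linear divided_difference_pCons
        Polynomial.map_poly_pCons del: mult_pCons_left)
qed

context ranked_algebra
begin

text \<open>By homogeneity only the bidegrees \<open>(k, n - k)\<close> survive. This is true in
  \<open>A\<close> but not in the free ring, so the equation is claimed only after \<open>K\<close>,
  and \<open>K\<psi>\<close> says that \<open>K\<close> composed with \<open>\<psi>\<close> depends
  only on values under \<open>h\<close>. The instances are \<open>\<psi>\<close> the identity with
  \<open>K = h\<close>, and \<open>\<psi>\<close> the constants with \<open>K\<close> the extension
  of \<open>h\<close> to polynomials.\<close>

lemma nm_eval:
  assumes h: "class_hom A h" and b: "b \<in> carrier B" and c: "c \<in> carrier B"
    and q: "\<And>i j. i < m \<Longrightarrow> j < m \<Longrightarrow> h (q i j) = defect i j"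
    and b': "\<And>i j. i < m \<Longrightarrow> j < m \<Longrightarrow> h (b' i j) = \<theta> i (b \<otimes>\<^bsub>B\<^esub> g j)"
    and c': "\<And>i j. i < m \<Longrightarrow> j < m \<Longrightarrow> h (c' i j) = \<theta> i (c \<otimes>\<^bsub>B\<^esub> g j)"
    and s: "\<And>k. k \<le> n \<Longrightarrow> h (s k) = polarized_norm A B \<phi> n k (n - k) b c"
    and \<psi>: "comm_ring_hom \<psi>" and K: "class_hom R K" and K\<psi>: "\<And>x y. h x = h y \<Longrightarrow> K (\<psi> x) = K (\<psi> y)"
  shows "K (class_det m (\<lambda>i j. \<psi> (q i j) + e * \<psi> (c' i j) + p * \<psi> (b' i j))) =
    K (\<Sum>k\<le>n. \<psi> (s k) * p ^ k * e ^ (n - k))"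
proof -
  interpret h: class_hom A h by fact
  interpret \<psi>: comm_ring_hom \<psi> by fact
  interpret K: class_hom R K by fact
  let ?D = "class_det m (\<lambda>i j. [:[:q i j, c' i j:], [:b' i j:]:])"
  let ?c = "\<lambda>k l. Polynomial.coeff (Polynomial.coeff ?D k) l"
  let ?f = "\<lambda>r. poly (map_poly \<psi> r) e"
  have hc: "h (?c k l) = h (if k + l = n then s k else 0)" for k l
  proof (cases "k + l = n")
    case True
    thus ?thesis using polarized_norm_class_det[OF h b c q b' c', of k l] s[of k] by auto
  next
    case False
    thus ?thesis
      using polarized_norm_class_det[OF h b c q b' c', of k l] polarized_norm_homogeneous[OF b c False] h.zero by simp
  qed
  \<comment> \<open>\<open>N\<close> bounds \<open>n\<close> and the degrees in both variables, so
    that all sums run over one square and differ only by zero terms.\<close>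
  define N where "N = n + degree ?D + (\<Sum>k\<le>degree ?D. degree (Polynomial.coeff ?D k))"
  have N: "n \<le> N" "degree ?D \<le> N" "degree (Polynomial.coeff ?D k) \<le> N" for k
  proof -
    show "n \<le> N" "degree ?D \<le> N" unfolding N_def by auto
    show "degree (Polynomial.coeff ?D k) \<le> N"
    proof (cases "k \<le> degree ?D")
      case True
      thus ?thesis using member_le_sum[of k "{..degree ?D}" "\<lambda>k. degree (Polynomial.coeff ?D k)"]
        by (simp add: N_def)
    qed (simp add: coeff_eq_0)
  qed
  have f0: "?f 0 = 0" by simp
  have "poly (map_poly ?f ?D) p = (\<Sum>k\<le>N. ?f (Polynomial.coeff ?D k) * p ^ k)"
    using N(2) map_poly_degree_leq[of ?f ?D] by (subst poly_sum_bound[of _ N]) (simp_all add: coeff_map_poly f0)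
  also have "\<dots> = (\<Sum>k\<le>N. \<Sum>l\<le>N. \<psi> (?c k l) * e ^ l * p ^ k)"
  proof (rule sum.cong)
    fix k
    have "?f (Polynomial.coeff ?D k) = (\<Sum>l\<le>N. \<psi> (?c k l) * e ^ l)"
      using N(3)[of k] map_poly_degree_leq[of \<psi> "Polynomial.coeff ?D k"]
      by (subst poly_sum_bound[of _ N]) (simp_all add: coeff_map_poly)
    thus "?f (Polynomial.coeff ?D k) * p ^ k = (\<Sum>l\<le>N. \<psi> (?c k l) * e ^ l * p ^ k)"
      by (simp add: sum_distrib_right)
  qed simp
  finally have "K (class_det m (\<lambda>i j. \<psi> (q i j) + e * \<psi> (c' i j) + p * \<psi> (b' i j))) =
      K (\<Sum>k\<le>N. \<Sum>l\<le>N. \<psi> (?c k l) * e ^ l * p ^ k)"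
    by (simp add: class_det_eval[OF \<psi>])
  also have "\<dots> = K (\<Sum>k\<le>N. \<Sum>l\<le>N. \<psi> (if k + l = n then s k else 0) * e ^ l * p ^ k)"
    using K\<psi>[OF hc] by (intro K.sum_cong) (simp_all add: K.mult)
  also have "(\<Sum>k\<le>N. \<Sum>l\<le>N. \<psi> (if k + l = n then s k else 0) * e ^ l * p ^ k) =
      (\<Sum>k\<le>N. if k \<le> n then \<psi> (s k) * p ^ k * e ^ (n - k) else 0)"
  proof (rule sum.cong)
    fix k
    show "(\<Sum>l\<le>N. \<psi> (if k + l = n then s k else 0) * e ^ l * p ^ k) =
        (if k \<le> n then \<psi> (s k) * p ^ k * e ^ (n - k) else 0)"
    proof (cases "k \<le> n")
      case True
      have "(\<Sum>l\<le>N. \<psi> (if k + l = n then s k else 0) * e ^ l * p ^ k) =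
          (\<Sum>l\<le>N. if l = n - k then \<psi> (s k) * p ^ k * e ^ (n - k) else 0)"
        using True by (intro sum.cong) (auto simp: mult_ac)
      thus ?thesis using True N(1) by simp
    next
      case False
      thus ?thesis by (auto intro!: sum.neutral)
    qed
  qed simp
  also have "\<dots> = (\<Sum>k\<le>n. \<psi> (s k) * p ^ k * e ^ (n - k))"
    using N(1) by (intro sum.mono_neutral_cong_right) auto
  finally show ?thesis .
qed

end

lemma (in class_hom) add_left_cancel: "h x \<oplus> h y = h x \<oplus> h y' \<Longrightarrow> h y = h y'"
  by (metis add diff add_diff_cancel_left')

lemma (in class_hom) diff_eq: "h x = h y \<Longrightarrow> h (x - y) = h 0"
  by (metis diff diff_self)

section \<open>Difference quotients of the norm\<close>

context ranked_algebra
begin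

text \<open>The formal quotient \<open>(s\<^sub>n(c + \<kappa> b) - s\<^sub>n(c)) / \<kappa>\<close>.\<close>

definition nm_diff :: "int \<Rightarrow> 'b \<Rightarrow> 'b \<Rightarrow> 'a" where
  "nm_diff \<kappa> b c = (\<Oplus>k\<in>{1..n}. [(\<kappa> ^ (k - 1))] \<cdot> polarized_norm A B \<phi> n k (n - k) b c)"

lemma nm_diff_closed: "b \<in> carrier B \<Longrightarrow> c \<in> carrier B \<Longrightarrow> nm_diff \<kappa> b c \<in> carrier A"
  unfolding nm_diff_def by (auto simp: polarized_norm_closed intro!: A.finsum_closed A.add.int_pow_closed)

definition pn :: "'b \<Rightarrow> 'b \<Rightarrow> nat \<Rightarrow> 'a free_ring" where
  "pn b c k = free_var (polarized_norm A B \<phi> n k (n - k) b c)"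

definition defect_var :: "nat \<Rightarrow> nat \<Rightarrow> 'a free_ring" where
  "defect_var i j = free_var (defect i j)"

definition entry_var :: "'b \<Rightarrow> nat \<Rightarrow> nat \<Rightarrow> 'a free_ring" where
  "entry_var b i j = free_var (\<theta> i (b \<otimes>\<^bsub>B\<^esub> g j))"

interpretation h: class_hom A "free_value A" by (rule A.class_hom_free_value)
interpretation H: class_hom "UP A" "UP_hom (free_value A)" by (rule h.class_hom_UP)
interpretation hB: class_hom B "free_value B" by (rule B.class_hom_free_value)
interpretation HB: class_hom "UP B" "UP_hom (free_value B)" by (rule hB.class_hom_UP)
interpretation PA: UP_cring A "UP A" by (simp_all add: UP_cring_def A.is_cring)
interpretation PB: UP_cring B "UP B" by (simp_all add: UP_cring_def B.is_cring)
interpretation P: ranked_algebra "UP A" "UP B" "UP_map \<phi>" n m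
  "\<lambda>j. UnivPoly.monom (UP B) (g j) 0" "\<lambda>j. UP_map (\<theta> j)"
  by (rule ranked_algebra_UP)

abbreviation h where "h \<equiv> free_value A"
abbreviation H where "H \<equiv> UP_hom (free_value A)"

lemma h_pn: "b \<in> carrier B \<Longrightarrow> c \<in> carrier B \<Longrightarrow> h (pn b c k) = polarized_norm A B \<phi> n k (n - k) b c"
  by (simp add: pn_def A.free_value_var polarized_norm_closed)

lemma h_defect_var: "i < m \<Longrightarrow> j < m \<Longrightarrow> h (defect_var i j) = defect i j"
  by (simp add: defect_var_def A.free_value_var defect_closed)

lemma entry_closed: "i < m \<Longrightarrow> j < m \<Longrightarrow> b \<in> carrier B \<Longrightarrow> \<theta> i (b \<otimes>\<^bsub>B\<^esub> g j) \<in> carrier A"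
  using db by simp

lemma h_entry_var: "i < m \<Longrightarrow> j < m \<Longrightarrow> b \<in> carrier B \<Longrightarrow> h (entry_var b i j) = \<theta> i (b \<otimes>\<^bsub>B\<^esub> g j)"
  by (simp add: entry_var_def A.free_value_var entry_closed)

lemma entry_add:
  "i < m \<Longrightarrow> j < m \<Longrightarrow> b \<in> carrier B \<Longrightarrow> c \<in> carrier B \<Longrightarrow>
    \<theta> i ((b \<oplus>\<^bsub>B\<^esub> c) \<otimes>\<^bsub>B\<^esub> g j) = \<theta> i (b \<otimes>\<^bsub>B\<^esub> g j) \<oplus> \<theta> i (c \<otimes>\<^bsub>B\<^esub> g j)"
  using db by (simp add: B.l_distr linear_form_add)

lemma nm_diff_h: "b \<in> carrier B \<Longrightarrow> c \<in> carrier B \<Longrightarrow>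
  nm_diff \<kappa> b c = h (\<Sum>k = 1..n. of_int (\<kappa> ^ (k - 1)) * pn b c k)"
  unfolding nm_diff_def by (simp only: h.sum h.of_int h_pn finite_atLeastAtMost)

lemma h_eval:
  assumes b: "b \<in> carrier B" and c: "c \<in> carrier B"
  shows "h (class_det m (\<lambda>i j. defect_var i j + e * entry_var c i j + p * entry_var b i j)) =
    h (\<Sum>k\<le>n. pn b c k * p ^ k * e ^ (n - k))"
proof -
  have id: "comm_ring_hom (\<lambda>x :: 'a free_ring. x)" by unfold_locales auto
  show ?thesis
    by (rule nm_eval[OF A.class_hom_free_value b c h_defect_var h_entry_var h_entry_var h_pn[OF b c] id A.class_hom_free_value])
      (use b c in auto)
qed

lemma H_eval:
  assumes b: "b \<in> carrier B" and c: "c \<in> carrier B"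
    and b': "\<And>i j. i < m \<Longrightarrow> j < m \<Longrightarrow> h (b' i j) = \<theta> i (b \<otimes>\<^bsub>B\<^esub> g j)"
    and c': "\<And>i j. i < m \<Longrightarrow> j < m \<Longrightarrow> h (c' i j) = \<theta> i (c \<otimes>\<^bsub>B\<^esub> g j)"
  shows "H (class_det m (\<lambda>i j. [:defect_var i j:] + e * [:c' i j:] + p * [:b' i j:])) =
    H (\<Sum>k\<le>n. [:pn b c k:] * p ^ k * e ^ (n - k))"
  by (rule nm_eval[OF A.class_hom_free_value b c h_defect_var b' c' h_pn[OF b c] comm_ring_hom_const h.class_hom_UP])
    (auto simp: h.UP_hom_eq_iff coeff_pCons split: nat.splits)

text \<open>The substitution \<lambda>_1 = 0, \<lambda>_2 = 1, in which only \<open>k = 0\<close>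
  survives, with \<open>0 ^ 0 = 1\<close>.\<close>

lemma nm_eq_polarized: "b \<in> carrier B \<Longrightarrow> c \<in> carrier B \<Longrightarrow> nm c = h (pn b c 0)"
proof -
  assume b: "b \<in> carrier B" and c: "c \<in> carrier B"
  have "nm c = h (class_det m (\<lambda>i j. defect_var i j + 1 * entry_var c i j + 0 * entry_var b i j))"
    by (rule nm_class_det[OF A.class_hom_free_value c]) (simp add: h.add h_defect_var h_entry_var c)
  also have "\<dots> = h (\<Sum>k\<le>n. pn b c k * 0 ^ k * 1 ^ (n - k))"
    by (rule h_eval[OF b c])
  also have "(\<Sum>k\<le>n. pn b c k * 0 ^ k * 1 ^ (n - k)) = pn b c 0"
  proof -
    have "(\<Sum>k\<le>n. pn b c k * 0 ^ k * 1 ^ (n - k)) = (\<Sum>k\<le>n. if k = 0 then pn b c 0 else 0)"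
      by (intro sum.cong) (auto simp: power_0_left)
    thus ?thesis by simp
  qed
  finally show ?thesis .
qed

text \<open>The substitution \<lambda>_1 = 2, \<lambda>_2 = 1. One factor \<open>2\<close> is split
  off every term with \<open>k \<ge> 1\<close>, which leaves the weights \<open>2 ^ (k - 1)\<close>
  of \<open>nm_diff 2\<close>.\<close>

lemma nm_add_double:
  assumes W: "W \<in> carrier B" and C: "C \<in> carrier B"
  shows "nm (W \<oplus>\<^bsub>B\<^esub> (C \<oplus>\<^bsub>B\<^esub> C)) = nm W \<oplus> (nm_diff 2 C W \<oplus> nm_diff 2 C W)"
proof -
  have "nm (W \<oplus>\<^bsub>B\<^esub> (C \<oplus>\<^bsub>B\<^esub> C)) = h (class_det m (\<lambda>i j. defect_var i j + 1 * entry_var W i j + 2 * entry_var C i j))"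
  proof (rule nm_class_det[OF A.class_hom_free_value])
    fix i j assume ij: "i < m" "j < m"
    have "defect_var i j + 1 * entry_var W i j + 2 * entry_var C i j =
        defect_var i j + (entry_var W i j + (entry_var C i j + entry_var C i j))" by simp
    thus "h (defect_var i j + 1 * entry_var W i j + 2 * entry_var C i j) =
        defect i j \<oplus> \<theta> i ((W \<oplus>\<^bsub>B\<^esub> (C \<oplus>\<^bsub>B\<^esub> C)) \<otimes>\<^bsub>B\<^esub> g j)"
      using ij W C by (simp only: h.add h_defect_var h_entry_var entry_add B.add.m_closed)
  qed (use W C in simp)
  also have "\<dots> = h (\<Sum>k\<le>n. pn C W k * 2 ^ k * 1 ^ (n - k))"
    by (rule h_eval[OF C W])
  also have "(\<Sum>k\<le>n. pn C W k * 2 ^ k * 1 ^ (n - k)) =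
      pn C W 0 + ((\<Sum>k = 1..n. of_int (2 ^ (k - 1)) * pn C W k) + (\<Sum>k = 1..n. of_int (2 ^ (k - 1)) * pn C W k))"
  proof -
    have "(\<Sum>k\<le>n. pn C W k * 2 ^ k * 1 ^ (n - k)) = pn C W 0 + (\<Sum>k = 1..n. pn C W k * 2 ^ k)"
      by (simp add: sum.atMost_shift sum.atLeast1_atMost_eq lessThan_Suc_atMost flip: sum.atLeast0_atMost_Suc_shift)
    also have "(\<Sum>k = 1..n. pn C W k * 2 ^ k) =
      (\<Sum>k = 1..n. of_int (2 ^ (k - 1)) * pn C W k + of_int (2 ^ (k - 1)) * pn C W k)"
    proof (rule sum.cong)
      fix k assume "k \<in> {1..n}"
      then obtain l where "k = Suc l" by (cases k) auto
      thus "pn C W k * 2 ^ k = of_int (2 ^ (k - 1)) * pn C W k + of_int (2 ^ (k - 1)) * pn C W k"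
        by (simp add: algebra_simps)
    qed simp
    finally show ?thesis by (simp only: sum.distrib)
  qed
  finally show ?thesis
    using nm_diff_h[OF C W, of 2] nm_eq_polarized[OF C W] by (simp only: h.add)
qed

text \<open>The determinant is \<open>s_n(c + \<kappa> b)\<close> as a polynomial in
  \<open>\<kappa>\<close>, with the polarized norms as coefficients. The entries \<open>b'\<close>
  and \<open>c'\<close> are left open so that sums of variables may represent \<open>b\<close> and
  \<open>c\<close>.\<close>

lemma nm_diff_divided_difference:
  assumes b: "b \<in> carrier B" and c: "c \<in> carrier B"
    and b': "\<And>i j. i < m \<Longrightarrow> j < m \<Longrightarrow> h (b' i j) = \<theta> i (b \<otimes>\<^bsub>B\<^esub> g j)"
    and c': "\<And>i j. i < m \<Longrightarrow> j < m \<Longrightarrow> h (c' i j) = \<theta> i (c \<otimes>\<^bsub>B\<^esub> g j)"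
  shows "h (divided_difference (class_det m (\<lambda>i j. [:defect_var i j + c' i j, b' i j:])) (of_int \<kappa>)) = nm_diff \<kappa> b c"
proof -
  let ?E = "class_det m (\<lambda>i j. [:defect_var i j + c' i j, b' i j:])"
  have "H (class_det m (\<lambda>i j. [:defect_var i j:] + 1 * [:c' i j:] + [:0, 1:] * [:b' i j:])) =
      H (\<Sum>k\<le>n. [:pn b c k:] * [:0, 1:] ^ k * 1 ^ (n - k))"
    by (rule H_eval[OF b c b' c'])
  hence "H ?E = H (\<Sum>k\<le>n. Polynomial.monom (pn b c k) k)"
    by (simp add: monom_altdef)
  hence *: "h (Polynomial.coeff ?E i) = h (if i \<le> n then pn b c i else 0)" for i
    by (simp add: h.UP_hom_eq_iff coeff_sum)
  have "h (poly (poly_shift 1 ?E) (of_int \<kappa>)) = h (poly (\<Sum>k = 1..n. Polynomial.monom (pn b c k) (k - 1)) (of_int \<kappa>))"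
  proof (rule h.poly_cong)
    fix i
    have "Polynomial.coeff (\<Sum>k = 1..n. Polynomial.monom (pn b c k) (k - 1)) i = (\<Sum>k = 1..n. if k = Suc i then pn b c k else 0)"
      unfolding coeff_sum by (intro sum.cong) auto
    thus "h (Polynomial.coeff (poly_shift 1 ?E) i) = h (Polynomial.coeff (\<Sum>k = 1..n. Polynomial.monom (pn b c k) (k - 1)) i)"
      by (simp add: coeff_poly_shift *)
  qed
  also have "poly (\<Sum>k = 1..n. Polynomial.monom (pn b c k) (k - 1)) (of_int \<kappa>) = (\<Sum>k = 1..n. of_int (\<kappa> ^ (k - 1)) * pn b c k)"
    by (simp add: poly_sum poly_monom mult.commute)
  finally show ?thesis using nm_diff_h[OF b c] by (simp add: divided_difference_def)
qed

text \<open>\<open>?D\<close> represents \<open>s_n(X + \<kappa> Y + x M)\<close> with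
  \<open>x\<close> outer. On the line \<open>x = 4 + \<kappa>\<close> it becomes
  \<open>s_n((X + 4 M) + \<kappa> (Y + M))\<close>, the polynomial behind the left side; the axes
  \<open>x = 0\<close> and \<open>\<kappa> = 0\<close> give the two summands on the right.\<close>

lemma nm_diff_split:
  assumes X: "X \<in> carrier B" and Y: "Y \<in> carrier B" and M: "M \<in> carrier B"
  shows "nm_diff (-4) (Y \<oplus>\<^bsub>B\<^esub> M) (X \<oplus>\<^bsub>B\<^esub> (M \<oplus>\<^bsub>B\<^esub> M \<oplus>\<^bsub>B\<^esub> (M \<oplus>\<^bsub>B\<^esub> M))) = nm_diff (-4) Y X \<oplus> nm_diff 4 M X"
proof -
  let ?D = "class_det m (\<lambda>i j. [:[:defect_var i j + entry_var X i j, entry_var Y i j:], [:entry_var M i j:]:])"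
  let ?N = "\<lambda>i j. entry_var Y i j + entry_var M i j"
  let ?T = "\<lambda>i j. entry_var X i j + (entry_var M i j + entry_var M i j + (entry_var M i j + entry_var M i j))"
  interpret p4: comm_ring_hom "\<lambda>p. poly p [:4 :: 'a free_ring, 1:]" by (rule comm_ring_hom_poly)
  interpret p0: comm_ring_hom "\<lambda>p. poly p (0 :: 'a free_ring poly)" by (rule comm_ring_hom_poly)
  interpret mp: comm_ring_hom "map_poly (\<lambda>p. poly p (0 :: 'a free_ring))"
    by (rule comm_ring_hom_map_poly[OF comm_ring_hom_poly])
  have 1: "poly ?D [:4, 1:] = class_det m (\<lambda>i j. [:defect_var i j + ?T i j, ?N i j:])"
    unfolding p4.hom_class_det by (rule class_det_cong) (simp add: algebra_simps)
  have 2: "poly ?D 0 = class_det m (\<lambda>i j. [:defect_var i j + entry_var X i j, entry_var Y i j:])"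
    unfolding p0.hom_class_det by (rule class_det_cong) simp
  have 3: "map_poly (\<lambda>p. poly p 0) ?D = class_det m (\<lambda>i j. [:defect_var i j + entry_var X i j, entry_var M i j:])"
    unfolding mp.hom_class_det by (rule class_det_cong) (simp add: Polynomial.map_poly_pCons)
  have "h (divided_difference (poly ?D [:4, 1:]) (of_int (-4))) = nm_diff (-4) (Y \<oplus>\<^bsub>B\<^esub> M) (X \<oplus>\<^bsub>B\<^esub> (M \<oplus>\<^bsub>B\<^esub> M \<oplus>\<^bsub>B\<^esub> (M \<oplus>\<^bsub>B\<^esub> M)))"
    unfolding 1 using X Y M by (intro nm_diff_divided_difference) (simp_all only: h.add h_entry_var entry_add B.add.m_closed)
  moreover have "h (divided_difference (poly ?D 0) (of_int (-4))) = nm_diff (-4) Y X"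
    unfolding 2 using X Y by (intro nm_diff_divided_difference) (simp_all add: h_entry_var)
  moreover have "h (divided_difference (map_poly (\<lambda>p. poly p 0) ?D) (of_int 4)) = nm_diff 4 M X"
    unfolding 3 using X M by (intro nm_diff_divided_difference) (simp_all add: h_entry_var)
  ultimately show ?thesis
    using divided_difference_bivariate[of ?D 4] by (simp add: h.add)
qed

lemma nm_UP_const:
  assumes a: "a \<in> carrier B"
  shows "P.nm (UnivPoly.monom (UP B) a 0) = UnivPoly.monom (UP A) (nm a) 0"
proof -
  interpret c: comm_ring_hom "\<lambda>x :: 'a free_ring. [:x:]" by (rule comm_ring_hom_const)
  have "P.nm (UnivPoly.monom (UP B) a 0) = H (class_det m (\<lambda>i j. [:defect_var i j + entry_var a i j:]))"
    using a db
    by (intro nm_UP_class_det A.class_hom_free_value)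
      (auto simp: h.add h.zero h_defect_var h_entry_var coeff_pCons linear_form_zero split: nat.splits)
  also have "\<dots> = H [:class_det m (\<lambda>i j. defect_var i j + entry_var a i j):]"
    by (simp only: c.hom_class_det)
  also have "nm a = h (class_det m (\<lambda>i j. defect_var i j + entry_var a i j))"
    by (rule nm_class_det[OF A.class_hom_free_value a]) (simp add: h.add h_defect_var h_entry_var a)
  hence "H [:class_det m (\<lambda>i j. defect_var i j + entry_var a i j):] = UnivPoly.monom (UP A) (nm a) 0"
    by (simp add: h.UP_hom_const)
  finally show ?thesis .
qed

lemma nm_UP_free_value:
  assumes "\<And>i j l. i < m \<Longrightarrow> j < m \<Longrightarrow> h (Polynomial.coeff (M i j) l) =
      (if l = 0 then defect i j else \<zero>) \<oplus> \<theta> i (free_value B (Polynomial.coeff z l) \<otimes>\<^bsub>B\<^esub> g j)"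
  shows "P.nm (UP_hom (free_value B) z) = H (class_det m M)"
  using assms
  by (intro nm_UP_class_det A.class_hom_free_value) (simp_all add: hB.UP_hom_closed hB.coeff_UP_hom)

text \<open>When norms of the product are compared, the terms without a factor \<open>1 + v\<close>
  agree because \<open>s_n(W^2) = s_n(W)^2\<close>. The rest has to be exhibited as a multiple of
  \<open>(1 + v)^2\<close>; the delicate part is the cross term, where only one factor
  \<open>1 + v\<close> is apparent.\<close>

lemma nm_diff_product:
  assumes W: "W \<in> carrier B" and C: "C \<in> carrier B"
  shows "nm_diff 4 (W \<otimes>\<^bsub>B\<^esub> C \<oplus>\<^bsub>B\<^esub> C \<otimes>\<^bsub>B\<^esub> C) (W \<otimes>\<^bsub>B\<^esub> W) =
    nm W \<otimes> nm_diff 2 C W \<oplus> nm_diff 2 C W \<otimes> nm_diff 2 C W"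
proof -
  let ?Z = "W \<otimes>\<^bsub>B\<^esub> C \<oplus>\<^bsub>B\<^esub> C \<otimes>\<^bsub>B\<^esub> C" and ?W2 = "W \<otimes>\<^bsub>B\<^esub> W"
  have Z: "?Z \<in> carrier B" and W2: "?W2 \<in> carrier B" using W C by auto
  let ?w = "free_var W" and ?c = "free_var C"
  have wc: "free_value B ?w = W" "free_value B ?c = C" using W C by (auto simp: B.free_value_var)
  let ?z = "?w * ?c + ?c * ?c"
  let ?v = "[:0, 1:] :: 'a free_ring poly" and ?r = "[:1, 1:] :: 'a free_ring poly"
  let ?W = "entry_var W" and ?C = "entry_var C" and ?Q = "entry_var ?W2" and ?Y = "entry_var ?Z"
  \<comment> \<open>These are \<open>W + (1 + v) C\<close> and \<open>v W + (1 + v) C\<close>,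
    sorted by powers of \<open>v\<close>.\<close>
  let ?z1 = "[:?w + ?c, ?c:]" and ?z2 = "[:?c, ?w + ?c:]"
  note ev = h.add h.zero h_defect_var h_entry_var hB.add hB.mult hB.zero wc
  have \<theta>0: "\<theta> i (\<zero>\<^bsub>B\<^esub> \<otimes>\<^bsub>B\<^esub> g j) = \<zero>" if "i < m" "j < m" for i j
    using db that by (simp add: linear_form_zero)
  have e1: "P.nm (UP_hom (free_value B) ?z1) = H (\<Sum>k\<le>n. [:pn C W k:] * ?r ^ k * 1 ^ (n - k))"
  proof -
    have "P.nm (UP_hom (free_value B) ?z1) = H (class_det m (\<lambda>i j. [:defect_var i j + (?W i j + ?C i j), ?C i j:]))"
      using W C by (intro nm_UP_free_value)
        (auto simp: ev entry_add entry_closed \<theta>0 coeff_pCons split: nat.splits)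
    also have "class_det m (\<lambda>i j. [:defect_var i j + (?W i j + ?C i j), ?C i j:]) =
        class_det m (\<lambda>i j. [:defect_var i j:] + 1 * [:?W i j:] + ?r * [:?C i j:])"
      by (rule class_det_cong) (simp add: algebra_simps)
    also have "H \<dots> = H (\<Sum>k\<le>n. [:pn C W k:] * ?r ^ k * 1 ^ (n - k))"
      using W C by (intro H_eval h_entry_var)
    finally show ?thesis .
  qed
  have e2: "P.nm (UP_hom (free_value B) ?z2) = H (\<Sum>k\<le>n. [:pn C W k:] * ?r ^ k * ?v ^ (n - k))"
  proof -
    have "P.nm (UP_hom (free_value B) ?z2) = H (class_det m (\<lambda>i j. [:defect_var i j + ?C i j, ?W i j + ?C i j:]))"
      using W C by (intro nm_UP_free_value)
        (auto simp: ev entry_add entry_closed \<theta>0 coeff_pCons split: nat.splits)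
    also have "class_det m (\<lambda>i j. [:defect_var i j + ?C i j, ?W i j + ?C i j:]) =
        class_det m (\<lambda>i j. [:defect_var i j:] + ?v * [:?W i j:] + ?r * [:?C i j:])"
      by (rule class_det_cong) (simp add: algebra_simps)
    also have "H \<dots> = H (\<Sum>k\<le>n. [:pn C W k:] * ?r ^ k * ?v ^ (n - k))"
      using W C by (intro H_eval h_entry_var)
    finally show ?thesis .
  qed
  have e3: "P.nm (UP_hom (free_value B) (?z1 * ?z2)) = H (\<Sum>k\<le>n. [:pn ?Z ?W2 k:] * (?r * ?r) ^ k * ?v ^ (n - k))"
  proof -
    define z w where "z = ?z" and "w = ?w * ?w + (z + z)"
    define y where "y = (\<lambda>i j. ?Q i j + (?Y i j + ?Y i j))"
    \<comment> \<open>With \<open>w = W^2 + 2 z\<close> the right side is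
      \<open>v W^2 + (1 + v)^2 z\<close>, the form needed for the substitution \<lambda>_1 = (1 +
      v)^2, \<lambda>_2 = v.\<close>
    have z: "?z1 * ?z2 = [:z, w, z:]" by (simp add: z_def w_def algebra_simps)
    have zv: "free_value B z = ?Z" by (simp only: z_def ev)
    have wv: "free_value B w = ?W2 \<oplus>\<^bsub>B\<^esub> (?Z \<oplus>\<^bsub>B\<^esub> ?Z)" by (simp only: w_def zv ev)
    have y: "h (y i j) = \<theta> i ((?W2 \<oplus>\<^bsub>B\<^esub> (?Z \<oplus>\<^bsub>B\<^esub> ?Z)) \<otimes>\<^bsub>B\<^esub> g j)" if "i < m" "j < m" for i j
      using that Z W2 by (simp only: y_def h.add h_entry_var entry_add B.add.m_closed)
    have "P.nm (UP_hom (free_value B) (?z1 * ?z2)) = H (class_det m (\<lambda>i j. [:defect_var i j + ?Y i j, y i j, ?Y i j:]))"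
      unfolding z using Z W2
      by (intro nm_UP_free_value)
        (auto simp: coeff_pCons zv wv y h.add h.zero h_defect_var h_entry_var entry_closed hB.zero \<theta>0 split: nat.splits)
    also have "class_det m (\<lambda>i j. [:defect_var i j + ?Y i j, y i j, ?Y i j:]) =
        class_det m (\<lambda>i j. [:defect_var i j:] + ?v * [:?Q i j:] + (?r * ?r) * [:?Y i j:])"
      by (rule class_det_cong) (simp add: y_def algebra_simps)
    also have "H \<dots> = H (\<Sum>k\<le>n. [:pn ?Z ?W2 k:] * (?r * ?r) ^ k * ?v ^ (n - k))"
      using Z W2 by (intro H_eval h_entry_var)
    finally show ?thesis .
  qed
  have prod: "P.nm (UP_hom (free_value B) (?z1 * ?z2)) =
      P.nm (UP_hom (free_value B) ?z1) \<otimes>\<^bsub>UP A\<^esub> P.nm (UP_hom (free_value B) ?z2)"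
    by (simp only: HB.mult P.nm_mult[OF hB.UP_hom_closed hB.UP_hom_closed])
  \<comment> \<open>All of these are quotients by powers of \<open>r = 1 + v\<close>: the terms with
    \<open>k \<ge> 1\<close> of the two factor norms are \<open>r C1\<close> and
    \<open>r C2\<close>, those of the product norm are \<open>r^2 L\<close>, and \<open>r E\<close>
    will be the sum in the cross term.\<close>
  define c0 where "c0 = pn C W 0"
  define C1 where "C1 = (\<Sum>k = 1..n. [:pn C W k:] * ?r ^ (k - 1))"
  define C2 where "C2 = (\<Sum>k = 1..n. [:pn C W k:] * ?r ^ (k - 1) * ?v ^ (n - k))"
  define E where "E = (\<Sum>k = 1..n. [:pn C W k:] * (if k = 1 then ?v ^ (n - 1) else ?r ^ (k - 2) * (?v ^ n + ?v ^ (n - k))))"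
  define L where "L = (\<Sum>k = 1..n. [:pn ?Z ?W2 k:] * (?r * ?r) ^ (k - 1) * ?v ^ (n - k))"
  have split0: "(\<Sum>k\<le>n. f k) = f 0 + (\<Sum>k = 1..n. f k)" for f :: "nat \<Rightarrow> 'a free_ring poly"
    by (simp add: sum.atLeast1_atMost_eq sum.atMost_shift)
  have s1: "(\<Sum>k\<le>n. [:pn C W k:] * ?r ^ k * 1 ^ (n - k)) = [:c0:] + ?r * C1"
  proof -
    have "(\<Sum>k = 1..n. [:pn C W k:] * ?r ^ k * 1 ^ (n - k)) = ?r * C1"
      unfolding C1_def sum_distrib_left
    proof (rule sum.cong)
      fix k assume "k \<in> {1..n}"
      then obtain l where "k = Suc l" by (cases k) auto
      thus "[:pn C W k:] * ?r ^ k * 1 ^ (n - k) = ?r * ([:pn C W k:] * ?r ^ (k - 1))" by (simp add: mult_ac)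
    qed simp
    thus ?thesis by (simp only: split0) (simp add: c0_def)
  qed
  have s2: "(\<Sum>k\<le>n. [:pn C W k:] * ?r ^ k * ?v ^ (n - k)) = [:c0:] * ?v ^ n + ?r * C2"
  proof -
    have "(\<Sum>k = 1..n. [:pn C W k:] * ?r ^ k * ?v ^ (n - k)) = ?r * C2"
      unfolding C2_def sum_distrib_left
    proof (rule sum.cong)
      fix k assume "k \<in> {1..n}"
      then obtain l where "k = Suc l" by (cases k) auto
      thus "[:pn C W k:] * ?r ^ k * ?v ^ (n - k) = ?r * ([:pn C W k:] * ?r ^ (k - 1) * ?v ^ (n - k))"
        by (simp only: power_Suc diff_Suc_1) (simp only: mult_ac)
    qed simp
    thus ?thesis by (simp only: split0) (simp add: c0_def)
  qed
  have s3: "(\<Sum>k\<le>n. [:pn ?Z ?W2 k:] * (?r * ?r) ^ k * ?v ^ (n - k)) = [:pn ?Z ?W2 0:] * ?v ^ n + ?r * (?r * L)"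
  proof -
    have "(\<Sum>k = 1..n. [:pn ?Z ?W2 k:] * (?r * ?r) ^ k * ?v ^ (n - k)) = ?r * (?r * L)"
      unfolding L_def sum_distrib_left
    proof (rule sum.cong)
      fix k assume "k \<in> {1..n}"
      then obtain l where "k = Suc l" by (cases k) auto
      thus "[:pn ?Z ?W2 k:] * (?r * ?r) ^ k * ?v ^ (n - k) = ?r * (?r * ([:pn ?Z ?W2 k:] * (?r * ?r) ^ (k - 1) * ?v ^ (n - k)))"
        by (simp only: power_Suc diff_Suc_1) (simp only: mult_ac)
    qed simp
    thus ?thesis by (simp only: split0) simp
  qed
  \<comment> \<open>For \<open>k = 1\<close> the sum \<open>v^n + v^(n-1)\<close> equals
    \<open>(1 + v) v^(n-1)\<close>; for \<open>k \<ge> 2\<close> the power \<open>r^(k-1)\<close>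
    already supplies a factor \<open>1 + v\<close>.\<close>
  have sE: "?v ^ n * C1 + C2 = ?r * E"
    unfolding C1_def C2_def E_def sum_distrib_left sum.distrib[symmetric]
  proof (rule sum.cong)
    fix k assume k: "k \<in> {1..n}"
    show "?v ^ n * ([:pn C W k:] * ?r ^ (k - 1)) + [:pn C W k:] * ?r ^ (k - 1) * ?v ^ (n - k) =
      ?r * ([:pn C W k:] * (if k = 1 then ?v ^ (n - 1) else ?r ^ (k - 2) * (?v ^ n + ?v ^ (n - k))))"
    proof (cases "k = 1")
      case True
      then obtain l where "n = Suc l" using k by (cases n) auto
      moreover have "?r = 1 + ?v" by (simp add: one_pCons)
      ultimately show ?thesis using True
        by (simp only: power_Suc diff_Suc_1 diff_self_eq_0 power_0 if_True simp_thms) (simp only: ring_distribs mult_ac mult_1 mult_1_right add_ac)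
    next
      case False
      then obtain l where "k = Suc (Suc l)" using k by (metis One_nat_def Suc_le_D atLeastAtMost_iff not0_implies_Suc)
      thus ?thesis by (simp only: power_Suc diff_Suc_Suc diff_zero diff_Suc_1 numeral_2_eq_2 nat.simps if_False One_nat_def)
          (simp only: ring_distribs mult_ac)
    qed
  qed simp
  have c0: "h c0 = nm W" unfolding c0_def using nm_eq_polarized[OF C W] by simp
  have z0: "H [:pn ?Z ?W2 0:] = H [:c0 * c0:]"
    using nm_eq_polarized[OF Z W2] c0 nm_mult[OF W W]
    by (simp add: h.UP_hom_const h.mult)
  have "H ([:pn ?Z ?W2 0:] * ?v ^ n + ?r * (?r * L)) = H (([:c0:] + ?r * C1) * ([:c0:] * ?v ^ n + ?r * C2))"
    using prod unfolding e1 e2 e3 s1 s2 s3 by (simp only: H.mult)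
  also have "([:c0:] + ?r * C1) * ([:c0:] * ?v ^ n + ?r * C2) =
      [:c0 * c0:] * ?v ^ n + ([:c0:] * (?r * (?v ^ n * C1 + C2)) + ?r * (?r * (C1 * C2)))"
  proof -
    have "[:c0 * c0:] = [:c0:] * [:c0:]" by simp
    thus ?thesis by (simp only: ring_distribs mult_ac add_ac)
  qed
  also have "\<dots> = [:c0 * c0:] * ?v ^ n + ?r * (?r * ([:c0:] * E + C1 * C2))"
    unfolding sE by (simp only: ring_distribs mult_ac)
  finally have eq: "H ([:pn ?Z ?W2 0:] * ?v ^ n) \<oplus>\<^bsub>UP A\<^esub> H (?r * (?r * L)) =
      H ([:pn ?Z ?W2 0:] * ?v ^ n) \<oplus>\<^bsub>UP A\<^esub> H (?r * (?r * ([:c0:] * E + C1 * C2)))"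
    by (simp only: H.add H.mult z0)
  hence "H (?r * (?r * L)) = H (?r * (?r * ([:c0:] * E + C1 * C2)))"
    by (rule H.add_left_cancel)
  hence "H (?r * (?r * (L - ([:c0:] * E + C1 * C2)))) = H 0"
    unfolding right_diff_distrib by (rule H.diff_eq)
  \<comment> \<open>The two factors \<open>1 + v\<close> are cancelled one at a time.\<close>
  hence "H (L - ([:c0:] * E + C1 * C2)) = H 0" by (rule h.UP_hom_cancel[OF h.UP_hom_cancel])
  hence "h (poly (L - ([:c0:] * E + C1 * C2)) 1) = h (poly 0 1)"
    by (intro h.poly_cong) (simp add: h.UP_hom_eq_iff)
  hence fin: "h (poly L 1) = h (c0 * poly E 1 + poly C1 1 * poly C2 1)"
  proof -
    assume a: "h (poly (L - ([:c0:] * E + C1 * C2)) 1) = h (poly 0 1)"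
    have "poly L 1 = poly (L - ([:c0:] * E + C1 * C2)) 1 + (c0 * poly E 1 + poly C1 1 * poly C2 1)" by simp
    hence "h (poly L 1) = h (poly (L - ([:c0:] * E + C1 * C2)) 1) \<oplus> h (c0 * poly E 1 + poly C1 1 * poly C2 1)"
      by (simp only: h.add)
    thus ?thesis unfolding a by (simp add: h.zero)
  qed
  have "poly L 1 = (\<Sum>k = 1..n. of_int (4 ^ (k - 1)) * pn ?Z ?W2 k)"
    by (simp add: L_def poly_sum mult.commute)
  moreover have "poly C1 1 = (\<Sum>k = 1..n. of_int (2 ^ (k - 1)) * pn C W k)" "poly C2 1 = (\<Sum>k = 1..n. of_int (2 ^ (k - 1)) * pn C W k)"
    by (simp_all add: C1_def C2_def poly_sum mult.commute)
  \<comment> \<open>At \<open>v = 1\<close> the case distinction disappears: \<open>1 = 2^0\<close>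
    for \<open>k = 1\<close>, and \<open>2^(k-2) (1 + 1) = 2^(k-1)\<close> otherwise. So
    \<open>E\<close>, \<open>C1\<close> and \<open>C2\<close> all take the value representing
    \<open>nm_diff 2 C W\<close>.\<close>
  moreover have "poly E 1 = (\<Sum>k = 1..n. of_int (2 ^ (k - 1)) * pn C W k)"
    unfolding E_def poly_sum
  proof (rule sum.cong)
    fix k assume "k \<in> {1..n}"
    then consider "k = 1" | l where "k = Suc (Suc l)" by (metis One_nat_def Suc_le_D atLeastAtMost_iff not0_implies_Suc)
    thus "poly ([:pn C W k:] * (if k = 1 then ?v ^ (n - 1) else ?r ^ (k - 2) * (?v ^ n + ?v ^ (n - k)))) 1 = of_int (2 ^ (k - 1)) * pn C W k"
      by cases (simp_all add: algebra_simps)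
  qed simp
  ultimately show ?thesis
    using fin nm_diff_h[OF Z W2, of 4] nm_diff_h[OF C W, of 2] c0 by (simp only: h.add h.mult)
qed

end

section \<open>Descent of the trace and norm relations to \<open>A\<close>\<close>

context ranked_algebra
begin

interpretation PA: UP_cring A "UP A" by (simp_all add: UP_cring_def A.is_cring)
interpretation PB: UP_cring B "UP B" by (simp_all add: UP_cring_def B.is_cring)
interpretation P: ranked_algebra "UP A" "UP B" "UP_map \<phi>" n m
  "\<lambda>j. UnivPoly.monom (UP B) (g j) 0" "\<lambda>j. UP_map (\<theta> j)"
  by (rule ranked_algebra_UP)
interpretation PPA: UP_cring "UP A" "UP (UP A)" by (simp_all add: UP_cring_def PA.UP_cring)
interpretation PPB: UP_cring "UP B" "UP (UP B)" by (simp_all add: UP_cring_def PB.UP_cring)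
interpretation PP: ranked_algebra "UP (UP A)" "UP (UP B)" "UP_map (UP_map \<phi>)" n m
  "\<lambda>j. UnivPoly.monom (UP (UP B)) (UnivPoly.monom (UP B) (g j) 0) 0" "\<lambda>j. UP_map (UP_map (\<theta> j))"
  by (rule P.ranked_algebra_UP)

text \<open>Over \<open>A[\<lambda>_1, \<lambda>_2]\<close> the argument is multiplied by the
  constant \<open>a\<close>, whose norm is the constant \<open>nm a\<close>; multiplicativity of the
  norm over that ring does the rest.\<close>

lemma polarized_norm_scale:
  assumes a: "a \<in> carrier B" and b: "b \<in> carrier B" and c: "c \<in> carrier B"
  shows "polarized_norm A B \<phi> n k l (a \<otimes>\<^bsub>B\<^esub> b) (a \<otimes>\<^bsub>B\<^esub> c) = nm a \<otimes> polarized_norm A B \<phi> n k l b c"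
proof -
  let ?a = "UnivPoly.monom (UP (UP B)) (UnivPoly.monom (UP B) a 0) 0"
  have bi: "bivariate (a \<otimes>\<^bsub>B\<^esub> b) (a \<otimes>\<^bsub>B\<^esub> c) = ?a \<otimes>\<^bsub>UP (UP B)\<^esub> bivariate b c"
  proof (rule PPB.up_eqI)
    fix i
    have "UnivPoly.coeff (UP (UP B)) (bivariate (a \<otimes>\<^bsub>B\<^esub> b) (a \<otimes>\<^bsub>B\<^esub> c)) i =
        UnivPoly.monom (UP B) a 0 \<otimes>\<^bsub>UP B\<^esub> UnivPoly.coeff (UP (UP B)) (bivariate b c) i"
      using a b c
      by (intro PB.up_eqI) (auto simp: coeff_bivariate PB.coeff_mult_const simp del: PB.coeff_mult)
    thus "UnivPoly.coeff (UP (UP B)) (bivariate (a \<otimes>\<^bsub>B\<^esub> b) (a \<otimes>\<^bsub>B\<^esub> c)) i =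
        UnivPoly.coeff (UP (UP B)) (?a \<otimes>\<^bsub>UP (UP B)\<^esub> bivariate b c) i"
      using a bivariate_closed[OF b c] by (simp add: PPB.coeff_mult_const del: PPB.coeff_mult)
  qed (use a b c bivariate_closed in simp_all)
  have "PP.nm (bivariate (a \<otimes>\<^bsub>B\<^esub> b) (a \<otimes>\<^bsub>B\<^esub> c)) =
      UnivPoly.monom (UP (UP A)) (UnivPoly.monom (UP A) (nm a) 0) 0 \<otimes>\<^bsub>UP (UP A)\<^esub> PP.nm (bivariate b c)"
    unfolding bi using a bivariate_closed[OF b c]
    by (simp add: PP.nm_mult P.nm_UP_const nm_UP_const)
  thus ?thesis
    using a b c nm_closed[OF a] PP.nm_closed[OF bivariate_closed[OF b c]]
    by (simp add: polarized_norm_eq PPA.coeff_mult_const PA.coeff_mult_const del: PPA.coeff_mult PA.coeff_mult)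
qed

lemma nm_diff_scale:
  assumes a: "a \<in> carrier B" and b: "b \<in> carrier B" and c: "c \<in> carrier B"
  shows "nm_diff \<kappa> (a \<otimes>\<^bsub>B\<^esub> b) (a \<otimes>\<^bsub>B\<^esub> c) = nm a \<otimes> nm_diff \<kappa> b c"
proof -
  interpret h: class_hom A "free_value A" by (rule A.class_hom_free_value)
  let ?u = "free_var (nm a)"
  have u: "free_value A ?u = nm a" using nm_closed[OF a] by (simp add: A.free_value_var)
  have ab: "a \<otimes>\<^bsub>B\<^esub> b \<in> carrier B" "a \<otimes>\<^bsub>B\<^esub> c \<in> carrier B" using a b c by auto
  have "nm_diff \<kappa> (a \<otimes>\<^bsub>B\<^esub> b) (a \<otimes>\<^bsub>B\<^esub> c) =
      free_value A (\<Sum>k = 1..n. of_int (\<kappa> ^ (k - 1)) * pn (a \<otimes>\<^bsub>B\<^esub> b) (a \<otimes>\<^bsub>B\<^esub> c) k)"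
    using ab by (rule nm_diff_h)
  also have "\<dots> = free_value A (\<Sum>k = 1..n. ?u * (of_int (\<kappa> ^ (k - 1)) * pn b c k))"
  proof (rule h.sum_cong)
    fix k
    have "free_value A (pn (a \<otimes>\<^bsub>B\<^esub> b) (a \<otimes>\<^bsub>B\<^esub> c) k) = free_value A (?u * pn b c k)"
      using ab b c by (simp add: h.mult u h_pn polarized_norm_scale a)
    thus "free_value A (of_int (\<kappa> ^ (k - 1)) * pn (a \<otimes>\<^bsub>B\<^esub> b) (a \<otimes>\<^bsub>B\<^esub> c) k) =
        free_value A (?u * (of_int (\<kappa> ^ (k - 1)) * pn b c k))"
      by (simp add: h.mult A.m_lcomm)
  qed simp
  also have "\<dots> = nm a \<otimes> nm_diff \<kappa> b c"
    by (simp only: sum_distrib_left[symmetric] h.mult u nm_diff_h[OF b c])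
  finally show ?thesis .
qed

lemma nm_trace:
  assumes "U \<in> carrier B" "T \<in> carrier B" "C \<in> carrier B"
  shows "nm (U \<otimes>\<^bsub>B\<^esub> T \<oplus>\<^bsub>B\<^esub> (C \<oplus>\<^bsub>B\<^esub> C)) =
    nm U \<otimes> nm T \<oplus> (nm_diff 2 C (U \<otimes>\<^bsub>B\<^esub> T) \<oplus> nm_diff 2 C (U \<otimes>\<^bsub>B\<^esub> T))"
  using assms nm_add_double[of "U \<otimes>\<^bsub>B\<^esub> T" C] by (simp add: nm_mult)

lemma nm_norm:
  assumes U: "U \<in> carrier B" and T: "T \<in> carrier B" and N: "N \<in> carrier B" and C: "C \<in> carrier B"
    and T': "T' = U \<otimes>\<^bsub>B\<^esub> T \<oplus>\<^bsub>B\<^esub> (C \<oplus>\<^bsub>B\<^esub> C)"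
    and N': "N' = U \<otimes>\<^bsub>B\<^esub> U \<otimes>\<^bsub>B\<^esub> N \<oplus>\<^bsub>B\<^esub> (U \<otimes>\<^bsub>B\<^esub> T \<otimes>\<^bsub>B\<^esub> C \<oplus>\<^bsub>B\<^esub> C \<otimes>\<^bsub>B\<^esub> C)"
  defines "c \<equiv> nm_diff 2 C (U \<otimes>\<^bsub>B\<^esub> T)"
  shows "nm_diff (-4) N' (T' \<otimes>\<^bsub>B\<^esub> T') =
    nm U \<otimes> nm U \<otimes> nm_diff (-4) N (T \<otimes>\<^bsub>B\<^esub> T) \<oplus> (nm U \<otimes> nm T \<otimes> c \<oplus> c \<otimes> c)"
proof -
  let ?W = "U \<otimes>\<^bsub>B\<^esub> T"
  let ?Z = "?W \<otimes>\<^bsub>B\<^esub> C \<oplus>\<^bsub>B\<^esub> C \<otimes>\<^bsub>B\<^esub> C"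
  have W: "?W \<in> carrier B" and Z: "?Z \<in> carrier B" using U T C by auto
  have sq: "T' \<otimes>\<^bsub>B\<^esub> T' = ?W \<otimes>\<^bsub>B\<^esub> ?W \<oplus>\<^bsub>B\<^esub> (?Z \<oplus>\<^bsub>B\<^esub> ?Z \<oplus>\<^bsub>B\<^esub> (?Z \<oplus>\<^bsub>B\<^esub> ?Z))"
    unfolding T' using W C by algebra
  \<comment> \<open>Both arguments of the first summand below are thus multiples of
    \<open>U^2\<close>, so that \<open>nm U\<close> comes out twice.\<close>
  have WW: "?W \<otimes>\<^bsub>B\<^esub> ?W = (U \<otimes>\<^bsub>B\<^esub> U) \<otimes>\<^bsub>B\<^esub> (T \<otimes>\<^bsub>B\<^esub> T)"
    using U T by (simp add: B.m_ac)
  have "nm_diff (-4) N' (T' \<otimes>\<^bsub>B\<^esub> T') = nm_diff (-4) (U \<otimes>\<^bsub>B\<^esub> U \<otimes>\<^bsub>B\<^esub> N) (?W \<otimes>\<^bsub>B\<^esub> ?W) \<oplus> nm_diff 4 ?Z (?W \<otimes>\<^bsub>B\<^esub> ?W)"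
    unfolding N' sq using U N W Z by (intro nm_diff_split) auto
  also have "nm_diff (-4) (U \<otimes>\<^bsub>B\<^esub> U \<otimes>\<^bsub>B\<^esub> N) (?W \<otimes>\<^bsub>B\<^esub> ?W) = nm U \<otimes> nm U \<otimes> nm_diff (-4) N (T \<otimes>\<^bsub>B\<^esub> T)"
    unfolding WW using U N T by (subst nm_diff_scale) (auto simp: nm_mult)
  also have "nm_diff 4 ?Z (?W \<otimes>\<^bsub>B\<^esub> ?W) = nm U \<otimes> nm T \<otimes> c \<oplus> c \<otimes> c"
    using nm_diff_product[OF W C] U T by (simp add: nm_mult c_def)
  finally show ?thesis .
qed

end

section \<open>Algebras of constant rank\<close>

text \<open>Zorn's lemma for the ideals that contain \<open>J\<close> but not \<open>\<one>\<close>;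
  a maximal such ideal is a maximal ideal, hence prime.\<close>

lemma (in cring) exists_primeideal:
  assumes J: "ideal J R" and "\<one> \<notin> J"
  shows "\<exists>p. primeideal p R \<and> J \<subseteq> p"
proof -
  let ?I = "{I. ideal I R \<and> J \<subseteq> I \<and> \<one> \<notin> I}"
  have "\<exists>M\<in>?I. \<forall>X\<in>?I. M \<subseteq> X \<longrightarrow> X = M"
  proof (rule subset_Zorn_nonempty)
    show "?I \<noteq> {}" using assms by auto
    fix C assume C: "C \<noteq> {}" "subset.chain ?I C"
    have id: "\<And>I. I \<in> C \<Longrightarrow> ideal I R \<and> J \<subseteq> I \<and> \<one> \<notin> I"
      and ch: "\<And>I K. I \<in> C \<Longrightarrow> K \<in> C \<Longrightarrow> I \<subseteq> K \<or> K \<subseteq> I"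
      using C(2) by (auto simp: subset.chain_def subset_iff_psubset_eq)
    have "ideal (\<Union>C) R"
    proof (rule idealI[OF ring_axioms add.subgroupI])
      show "\<Union>C \<subseteq> carrier R" using id ideal.Icarr by fastforce
      show "\<Union>C \<noteq> {}" using C(1) id additive_subgroup.zero_closed[OF ideal.axioms(1)] by blast
      fix a assume "a \<in> \<Union>C"
      then obtain I where I: "I \<in> C" "a \<in> I" by auto
      then interpret I: ideal I R using id by blast
      show "\<ominus> a \<in> \<Union>C" using I I.a_inv_closed by blast
      show "x \<otimes> a \<in> \<Union>C" "a \<otimes> x \<in> \<Union>C" if "x \<in> carrier R" for x
        using I I.I_l_closed I.I_r_closed that by blast+
      fix b assume "b \<in> \<Union>C"
      then obtain K where K: "K \<in> C" "b \<in> K" by auto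
      then interpret K: ideal K R using id by blast
      show "a \<oplus> b \<in> \<Union>C" using ch[OF I(1) K(1)] I K I.a_closed K.a_closed by blast
    qed
    thus "\<Union>C \<in> ?I" using C(1) id by auto
  qed
  then obtain M where "M \<in> ?I" and "\<forall>X\<in>?I. M \<subseteq> X \<longrightarrow> X = M" by (rule bexE)
  hence M: "ideal M R" "J \<subseteq> M" "\<one> \<notin> M"
    and max: "ideal X R \<Longrightarrow> J \<subseteq> X \<Longrightarrow> \<one> \<notin> X \<Longrightarrow> M \<subseteq> X \<Longrightarrow> X = M" for X by simp_all
  have "maximalideal M R"
  proof (rule maximalidealI[OF M(1)])
    show "carrier R \<noteq> M" using M(3) by auto
    fix X assume X: "ideal X R" "M \<subseteq> X" "X \<subseteq> carrier R"
    show "X = M \<or> X = carrier R"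
      using max[of X] X M(2) ideal.one_imp_carrier[OF X(1)] by blast
  qed
  thus ?thesis using maximalideal_prime M(2) by blast
qed

text \<open>The generators \<open>g j\<close> are the images under \<open>\<pi>\<close> of the unit
  vectors and \<open>\<theta> j\<close> is the \<open>j\<close>-th coordinate of
  \<open>\<iota>\<close>; the frame identity is \<open>\<pi> (\<iota> b) = b\<close>.\<close>

lemma fg_projective_frame:
  assumes "comm_algebra A B \<phi>" "fg_projective A (alg_module B \<phi>)"
  shows "\<exists>m g \<theta>. comm_algebra.frame A B \<phi> m \<one>\<^bsub>A\<^esub> g \<theta>"
proof -
  interpret comm_algebra A B \<phi> by fact
  obtain m \<iota> \<pi> where \<iota>: "\<iota> \<in> linear_maps A (alg_module B \<phi>) (free_module A m)"
    and \<pi>: "\<pi> \<in> linear_maps A (free_module A m) (alg_module B \<phi>)"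
    and \<pi>\<iota>: "\<And>b. b \<in> carrier B \<Longrightarrow> \<pi> (\<iota> b) = b"
    using assms(2) by (auto simp: fg_projective_def)
  have F: "carrier (free_module A m) = {..<m} \<rightarrow>\<^sub>E carrier A"
    "\<And>v w. v \<oplus>\<^bsub>free_module A m\<^esub> w = (\<lambda>i\<in>{..<m}. v i \<oplus>\<^bsub>A\<^esub> w i)"
    "\<And>a v. a \<odot>\<^bsub>free_module A m\<^esub> v = (\<lambda>i\<in>{..<m}. a \<otimes>\<^bsub>A\<^esub> v i)"
    by (auto simp: free_module_def)
  have Badd: "x \<oplus>\<^bsub>alg_module B \<phi>\<^esub> y = x \<oplus>\<^bsub>B\<^esub> y" for x y by (simp add: alg_module_def)
  have \<iota>c: "\<iota> b \<in> {..<m} \<rightarrow>\<^sub>E carrier A" if "b \<in> carrier B" for b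
    using \<iota> that by (auto simp: linear_maps_def F)
  have \<iota>add: "\<iota> (b \<oplus>\<^bsub>B\<^esub> c) = (\<lambda>i\<in>{..<m}. \<iota> b i \<oplus>\<^bsub>A\<^esub> \<iota> c i)" if "b \<in> carrier B" "c \<in> carrier B" for b c
    using \<iota> that by (simp add: linear_maps_def F Badd)
  have \<iota>smult: "\<iota> (\<phi> a \<otimes>\<^bsub>B\<^esub> b) = (\<lambda>i\<in>{..<m}. a \<otimes>\<^bsub>A\<^esub> \<iota> b i)" if "a \<in> carrier A" "b \<in> carrier B" for a b
    using \<iota> that by (simp add: linear_maps_def F)
  have \<pi>c: "\<pi> v \<in> carrier B" if "v \<in> {..<m} \<rightarrow>\<^sub>E carrier A" for v
    using \<pi> that by (auto simp: linear_maps_def F)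
  have \<pi>add: "\<pi> (\<lambda>i\<in>{..<m}. v i \<oplus>\<^bsub>A\<^esub> w i) = \<pi> v \<oplus>\<^bsub>B\<^esub> \<pi> w"
    if "v \<in> {..<m} \<rightarrow>\<^sub>E carrier A" "w \<in> {..<m} \<rightarrow>\<^sub>E carrier A" for v w
    using \<pi> that by (simp add: linear_maps_def F Badd)
  have \<pi>smult: "\<pi> (\<lambda>i\<in>{..<m}. a \<otimes>\<^bsub>A\<^esub> v i) = \<phi> a \<otimes>\<^bsub>B\<^esub> \<pi> v" if "a \<in> carrier A" "v \<in> {..<m} \<rightarrow>\<^sub>E carrier A" for a v
    using \<pi> that by (simp add: linear_maps_def F)
  define e where "e = (\<lambda>j. \<lambda>i\<in>{..<m}. if i = j then \<one>\<^bsub>A\<^esub> else \<zero>\<^bsub>A\<^esub>)"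
  have e: "e j \<in> {..<m} \<rightarrow>\<^sub>E carrier A" for j by (auto simp: e_def)
  define g where "g = (\<lambda>j. \<pi> (e j))"
  define \<theta> where "\<theta> = (\<lambda>j b. \<iota> b j)"
  \<comment> \<open>The expansion of \<open>\<pi> v\<close> in unit vectors is obtained by
    truncating \<open>v\<close> after \<open>k\<close> coordinates, with induction on
    \<open>k\<close>.\<close>
  have part: "\<pi> (\<lambda>i\<in>{..<m}. if i < k then v i else \<zero>\<^bsub>A\<^esub>) = (\<Oplus>\<^bsub>B\<^esub>j\<in>{..<k}. \<phi> (v j) \<otimes>\<^bsub>B\<^esub> g j)"
    if v: "v \<in> {..<m} \<rightarrow>\<^sub>E carrier A" and "k \<le> m" for v k
    using \<open>k \<le> m\<close>
  proof (induction k)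
    case 0
    \<comment> \<open>The zero vector is written as a multiple of \<open>v\<close>, so that
      compatibility of \<open>\<pi>\<close> with scalars applies.\<close>
    have "\<pi> (\<lambda>i\<in>{..<m}. \<zero>\<^bsub>A\<^esub> \<otimes>\<^bsub>A\<^esub> v i) = \<zero>\<^bsub>B\<^esub>"
      using v \<pi>c[OF v] by (subst \<pi>smult) auto
    moreover have "(\<lambda>i\<in>{..<m}. \<zero>\<^bsub>A\<^esub> \<otimes>\<^bsub>A\<^esub> v i) = (\<lambda>i\<in>{..<m}. \<zero>\<^bsub>A\<^esub>)"
      using PiE_mem[OF v] by (intro restrict_ext) simp
    ultimately show ?case by (simp add: restrict_def)
  next
    case (Suc k)
    let ?p = "\<lambda>i\<in>{..<m}. if i < k then v i else \<zero>\<^bsub>A\<^esub>"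
    have vA: "v i \<in> carrier A" if "i < m" for i using v that by auto
    have p: "?p \<in> {..<m} \<rightarrow>\<^sub>E carrier A" using vA by auto
    have q: "(\<lambda>i\<in>{..<m}. v k \<otimes>\<^bsub>A\<^esub> e k i) \<in> {..<m} \<rightarrow>\<^sub>E carrier A" using vA[of k] Suc(2) by (auto simp: e_def)
    have "(\<lambda>i\<in>{..<m}. if i < Suc k then v i else \<zero>\<^bsub>A\<^esub>) =
        (\<lambda>i\<in>{..<m}. ?p i \<oplus>\<^bsub>A\<^esub> (\<lambda>i\<in>{..<m}. v k \<otimes>\<^bsub>A\<^esub> e k i) i)"
      using vA Suc(2) by (intro restrict_ext) (auto simp: e_def less_Suc_eq)
    hence "\<pi> (\<lambda>i\<in>{..<m}. if i < Suc k then v i else \<zero>\<^bsub>A\<^esub>) = \<pi> ?p \<oplus>\<^bsub>B\<^esub> \<phi> (v k) \<otimes>\<^bsub>B\<^esub> g k"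
      using \<pi>add[OF p q] \<pi>smult[OF _ e] vA Suc(2) by (simp add: g_def)
    also have "\<pi> ?p = (\<Oplus>\<^bsub>B\<^esub>j\<in>{..<k}. \<phi> (v j) \<otimes>\<^bsub>B\<^esub> g j)" by (rule Suc(1)) (use Suc(2) in simp)
    also have "(\<Oplus>\<^bsub>B\<^esub>j\<in>{..<k}. \<phi> (v j) \<otimes>\<^bsub>B\<^esub> g j) \<oplus>\<^bsub>B\<^esub> \<phi> (v k) \<otimes>\<^bsub>B\<^esub> g k = (\<Oplus>\<^bsub>B\<^esub>j\<in>{..<Suc k}. \<phi> (v j) \<otimes>\<^bsub>B\<^esub> g j)"
      using vA Suc(2) \<pi>c[OF e]
      by (subst lessThan_Suc, subst B.finsum_insert) (auto simp: g_def B.a_comm intro!: B.a_comm B.finsum_closed)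
    finally show ?case .
  qed
  have "linear_form (\<theta> j)" if "j < m" for j
    using that \<iota>c \<iota>add \<iota>smult by (fastforce simp: linear_form_def \<theta>_def)
  moreover have "(\<Oplus>\<^bsub>B\<^esub>j\<in>{..<m}. \<phi> (\<theta> j b) \<otimes>\<^bsub>B\<^esub> g j) = b" if b: "b \<in> carrier B" for b
  proof -
    have "(\<lambda>i\<in>{..<m}. if i < m then \<iota> b i else \<zero>\<^bsub>A\<^esub>) = \<iota> b"
      using \<iota>c[OF b] by (auto simp: fun_eq_iff PiE_iff extensional_def)
    thus ?thesis using part[OF \<iota>c[OF b], of m] \<pi>\<iota>[OF b] by (simp add: \<theta>_def)
  qed
  ultimately have "frame m \<one>\<^bsub>A\<^esub> g \<theta>"
    using \<pi>c[OF e] by (simp add: frame_def g_def)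
  thus ?thesis by blast
qed

text \<open>A basis over the localization involves finitely many denominators, and finitely many
  relations that hold only up to annihilation by \<open>S\<close>. Clearing them successively
  produces \<open>s\<close>, \<open>t\<close>, \<open>u\<close>, \<open>v\<close> in
  \<open>S\<close> and \<open>F = v u t s\<close>. Finiteness is due to the dual basis, which
  reduces statements about all \<open>b\<close> to the generators \<open>g j\<close>.\<close>

lemma (in comm_algebra) exists_local_basis:
  assumes db: "frame m \<one> g \<theta>" and S: "localization A S"
    and e: "is_basis (localize A S) (localize_module B \<phi> S) n e"
  shows "\<exists>F\<in>S. \<exists>x \<zeta>. local_basis n F x \<zeta>"
proof -
  interpret P: localized_algebra A B \<phi> S
    by (intro localized_algebra.intro localized_algebra_axioms.intro comm_algebra_axioms S)
  let ?A = "localize A S" and ?B = "localize B (\<phi> ` S)" and ?\<phi> = "localize_map B \<phi> S"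
  define c where "c = (\<lambda>k X. coords ?A (alg_module ?B ?\<phi>) n e X k)"
  have lb: "P.L.local_basis n \<one>\<^bsub>?A\<^esub> e c"
    unfolding c_def using e by (intro P.L.local_basis_coords) (simp add: localize_module_def)
  hence fr: "P.L.frame n \<one>\<^bsub>?A\<^esub> e c" by (simp add: P.L.local_basis_def)
  note f = frameD[OF db] and f' = P.L.frameD[OF fr]
  obtain d x where "d \<in> \<phi> ` S" and x: "\<forall>k\<in>{..<n}. x k \<in> carrier B \<and> e k = fraction B (\<phi> ` S) (x k) d"
    using P.LB.common_denominator[of "{..<n}" e] f'(2) by auto
  then obtain s where s: "s \<in> S" "d = \<phi> s" by auto
  have xB: "x k \<in> carrier B" and ex: "e k = fraction B (\<phi> ` S) (x k) (\<phi> s)" if "k < n" for k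
    using x s that by auto
  have "\<exists>t\<in>S. \<exists>a. \<forall>kj\<in>{..<n} \<times> {..<m}. a kj \<in> carrier A \<and> c (fst kj) (P.to_B (g (snd kj))) = fraction A S (a kj) t"
    using f(2) f'(5) by (intro P.LA.common_denominator) auto
  then obtain t a where t: "t \<in> S"
    and a: "\<forall>kj\<in>{..<n} \<times> {..<m}. a kj \<in> carrier A \<and> c (fst kj) (P.to_B (g (snd kj))) = fraction A S (a kj) t"
    by blast
  have aA: "a (k, j) \<in> carrier A" and ca: "c k (P.to_B (g j)) = fraction A S (a (k, j)) t" if "k < n" "j < m" for k j
    using a that by auto
  let ?G = "\<lambda>j. \<Oplus>\<^bsub>B\<^esub>k\<in>{..<n}. \<phi> (a (k, j)) \<otimes>\<^bsub>B\<^esub> x k"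
  have G: "?G j \<in> carrier B" if "j < m" for j using that aA xB by (auto intro!: B.finsum_closed)
  \<comment> \<open>In the localization \<open>g_j\<close> equals \<open>G_j / (t s)\<close>, so
    clearing denominators leaves a difference that some \<open>u\<close> kills; there are finitely
    many \<open>j\<close>, so one \<open>u\<close> suffices.\<close>
  have "\<exists>u\<in>\<phi> ` S. u \<otimes>\<^bsub>B\<^esub> (\<phi> (t \<otimes> s) \<otimes>\<^bsub>B\<^esub> g j \<ominus>\<^bsub>B\<^esub> ?G j) = \<zero>\<^bsub>B\<^esub>" if j: "j < m" for j
  proof -
    have "P.to_B (g j) = (\<Oplus>\<^bsub>?B\<^esub>k\<in>{..<n}. ?\<phi> (c k (P.to_B (g j))) \<otimes>\<^bsub>?B\<^esub> e k)"
      using f'(4)[of "P.to_B (g j)"] f(2) j by simp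
    also have "\<dots> = (\<Oplus>\<^bsub>?B\<^esub>k\<in>{..<n}. fraction B (\<phi> ` S) (\<phi> (a (k, j)) \<otimes>\<^bsub>B\<^esub> x k) (\<phi> (t \<otimes> s)))"
      using j t s(1) aA xB
      by (intro P.L.B.finsum_cong') (auto simp: ca ex P.localize_map_fraction P.LB.fraction_mult)
    also have "\<dots> = fraction B (\<phi> ` S) (?G j) (\<phi> (t \<otimes> s))"
      using j t s(1) aA xB by (intro P.LB.finsum_fraction) auto
    finally obtain u where u: "u \<in> S" "\<phi> u \<otimes>\<^bsub>B\<^esub> (\<phi> (t \<otimes> s) \<otimes>\<^bsub>B\<^esub> g j) = \<phi> u \<otimes>\<^bsub>B\<^esub> ?G j"
      using f(2)[OF j] G[OF j] t s(1) by (subst (asm) P.LB.fraction_eq_iff) auto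
    have "\<phi> u \<otimes>\<^bsub>B\<^esub> (\<phi> (t \<otimes> s) \<otimes>\<^bsub>B\<^esub> g j \<ominus>\<^bsub>B\<^esub> ?G j) = \<zero>\<^bsub>B\<^esub>"
      using u(1) f(2)[OF j] G[OF j] t s(1)
      by (simp add: a_minus_def B.r_distr B.r_minus u(2) B.r_neg del: \<phi>.hom_mult)
    thus ?thesis using u(1) by blast
  qed
  hence "\<exists>u\<in>\<phi> ` S. \<forall>j\<in>{..<m}. u \<otimes>\<^bsub>B\<^esub> (\<phi> (t \<otimes> s) \<otimes>\<^bsub>B\<^esub> g j \<ominus>\<^bsub>B\<^esub> ?G j) = \<zero>\<^bsub>B\<^esub>"
    using f(2) G t s(1) by (intro P.LB.common_annihilator) auto
  then obtain u where u: "u \<in> S" and u0: "\<And>j. j < m \<Longrightarrow> \<phi> u \<otimes>\<^bsub>B\<^esub> (\<phi> (t \<otimes> s) \<otimes>\<^bsub>B\<^esub> g j \<ominus>\<^bsub>B\<^esub> ?G j) = \<zero>\<^bsub>B\<^esub>"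
    by auto
  define r where "r = u \<otimes> (t \<otimes> s)"
  have r: "r \<in> S" using u t s by (simp add: r_def)
  have uG: "\<phi> u \<otimes>\<^bsub>B\<^esub> ?G j = \<phi> r \<otimes>\<^bsub>B\<^esub> g j" if j: "j < m" for j
  proof -
    have "\<phi> u \<otimes>\<^bsub>B\<^esub> (\<phi> (t \<otimes> s) \<otimes>\<^bsub>B\<^esub> g j) \<oplus>\<^bsub>B\<^esub> \<ominus>\<^bsub>B\<^esub> (\<phi> u \<otimes>\<^bsub>B\<^esub> ?G j) = \<zero>\<^bsub>B\<^esub>"
      using u0[OF j] u f(2)[OF j] G[OF j] t s(1) by (simp add: a_minus_def B.r_distr B.r_minus del: \<phi>.hom_mult)
    hence "\<phi> u \<otimes>\<^bsub>B\<^esub> (\<phi> (t \<otimes> s) \<otimes>\<^bsub>B\<^esub> g j) = \<phi> u \<otimes>\<^bsub>B\<^esub> ?G j"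
      using B.minus_equality[of "\<phi> u \<otimes>\<^bsub>B\<^esub> (\<phi> (t \<otimes> s) \<otimes>\<^bsub>B\<^esub> g j)" "\<ominus>\<^bsub>B\<^esub> (\<phi> u \<otimes>\<^bsub>B\<^esub> ?G j)"] u f(2)[OF j] G[OF j] t s(1)
      by (simp del: \<phi>.hom_mult)
    thus ?thesis using u f(2)[OF j] t s(1) by (simp add: r_def B.m_assoc)
  qed
  \<comment> \<open>Up to the factor \<open>r\<close>, this is the \<open>k\<close>-th coordinate of
    \<open>b\<close> expanded in the \<open>g_j\<close>, as \<open>a (k, j)\<close> is the numerator
    of the \<open>k\<close>-th coordinate of \<open>g_j\<close>.\<close>
  define \<zeta> where "\<zeta> = (\<lambda>k b. u \<otimes> (\<Oplus>j\<in>{..<m}. \<theta> j b \<otimes> a (k, j)))"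
  have \<zeta>A: "\<zeta> k b \<in> carrier A" if "k < n" "b \<in> carrier B" for k b
    using that u f aA by (auto simp: \<zeta>_def intro!: A.m_closed A.finsum_closed)
  have lin: "linear_form (\<zeta> k)" if k: "k < n" for k
    unfolding linear_form_def
  proof (intro conjI ballI)
    show "\<zeta> k \<in> carrier B \<rightarrow> carrier A" using \<zeta>A k by auto
    fix b b' assume b: "b \<in> carrier B" "b' \<in> carrier B"
    have "(\<Oplus>j\<in>{..<m}. \<theta> j (b \<oplus>\<^bsub>B\<^esub> b') \<otimes> a (k, j)) =
        (\<Oplus>j\<in>{..<m}. \<theta> j b \<otimes> a (k, j) \<oplus> \<theta> j b' \<otimes> a (k, j))"
      using b k f aA by (intro A.finsum_cong') (auto simp: linear_form_add A.l_distr)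
    also have "\<dots> = (\<Oplus>j\<in>{..<m}. \<theta> j b \<otimes> a (k, j)) \<oplus> (\<Oplus>j\<in>{..<m}. \<theta> j b' \<otimes> a (k, j))"
      using b k f aA by (intro A.finsum_addf) auto
    finally show "\<zeta> k (b \<oplus>\<^bsub>B\<^esub> b') = \<zeta> k b \<oplus> \<zeta> k b'"
      unfolding \<zeta>_def using b k f aA u
      by (simp add: A.r_distr A.finsum_closed Pi_def)
  next
    fix y b assume y: "y \<in> carrier A" and b: "b \<in> carrier B"
    have "(\<Oplus>j\<in>{..<m}. \<theta> j (\<phi> y \<otimes>\<^bsub>B\<^esub> b) \<otimes> a (k, j)) =
        (\<Oplus>j\<in>{..<m}. y \<otimes> (\<theta> j b \<otimes> a (k, j)))"
      using b y k f aA by (intro A.finsum_cong') (auto simp: linear_form_smult A.m_assoc)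
    also have "\<dots> = y \<otimes> (\<Oplus>j\<in>{..<m}. \<theta> j b \<otimes> a (k, j))"
      using b y k f aA by (intro A.finsum_rdistr[symmetric]) auto
    finally show "\<zeta> k (\<phi> y \<otimes>\<^bsub>B\<^esub> b) = y \<otimes> \<zeta> k b"
      unfolding \<zeta>_def using b y k f aA u
      by (simp add: A.m_lcomm A.finsum_closed Pi_def)
  qed
  have \<zeta>x: "(\<Oplus>\<^bsub>B\<^esub>k\<in>{..<n}. \<phi> (\<zeta> k b) \<otimes>\<^bsub>B\<^esub> x k) = \<phi> r \<otimes>\<^bsub>B\<^esub> b" if b: "b \<in> carrier B" for b
  proof -
    interpret h: class_hom B "free_value B" by (rule B.class_hom_free_value)
    let ?T = "\<lambda>j. free_var (\<phi> (\<theta> j b))" and ?a = "\<lambda>k j. free_var (\<phi> (a (k, j)))"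
      and ?x = "\<lambda>k. free_var (x k)" and ?u = "free_var (\<phi> u)"
    have "(\<Oplus>\<^bsub>B\<^esub>k\<in>{..<n}. \<phi> (\<zeta> k b) \<otimes>\<^bsub>B\<^esub> x k) =
        (\<Oplus>\<^bsub>B\<^esub>k\<in>{..<n}. free_value B ((?u * (\<Sum>j<m. ?T j * ?a k j)) * ?x k))"
    proof (rule B.finsum_cong')
      fix k assume "k \<in> {..<n}"
      hence k: "k < n" by simp
      have "\<phi> (\<Oplus>j\<in>{..<m}. \<theta> j b \<otimes> a (k, j)) = (\<Oplus>\<^bsub>B\<^esub>j\<in>{..<m}. \<phi> (\<theta> j b \<otimes> a (k, j)))"
        using k b f aA by (subst \<phi>.hom_finsum) (auto simp: o_def)
      also have "\<dots> = (\<Oplus>\<^bsub>B\<^esub>j\<in>{..<m}. free_value B (?T j * ?a k j))"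
        using k b f aA by (intro B.finsum_cong') (auto simp: h.mult B.free_value_var)
      finally show "\<phi> (\<zeta> k b) \<otimes>\<^bsub>B\<^esub> x k = free_value B ((?u * (\<Sum>j<m. ?T j * ?a k j)) * ?x k)"
        using k b f aA u xB by (simp add: \<zeta>_def h.mult h.sum B.free_value_var A.finsum_closed Pi_def del: \<phi>.hom_finsum)
    qed auto
    also have "\<dots> = free_value B (\<Sum>k<n. (?u * (\<Sum>j<m. ?T j * ?a k j)) * ?x k)"
      by (simp add: h.sum)
    also have "(\<Sum>k<n. (?u * (\<Sum>j<m. ?T j * ?a k j)) * ?x k) = (\<Sum>j<m. ?T j * (?u * (\<Sum>k<n. ?a k j * ?x k)))"
      by (simp add: sum_distrib_left sum_distrib_right sum.swap[of _ "{..<m}"] mult_ac)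
    also have "free_value B \<dots> = (\<Oplus>\<^bsub>B\<^esub>j\<in>{..<m}. free_value B (?T j * (?u * (\<Sum>k<n. ?a k j * ?x k))))"
      by (simp add: h.sum)
    also have "\<dots> = (\<Oplus>\<^bsub>B\<^esub>j\<in>{..<m}. \<phi> r \<otimes>\<^bsub>B\<^esub> (\<phi> (\<theta> j b) \<otimes>\<^bsub>B\<^esub> g j))"
    proof (rule B.finsum_cong')
      fix j assume "j \<in> {..<m}"
      hence j: "j < m" by simp
      have "free_value B (\<Sum>k<n. ?a k j * ?x k) = ?G j"
        unfolding h.sum[OF finite_lessThan] using j aA xB by (intro B.finsum_cong') (auto simp: h.mult B.free_value_var)
      thus "free_value B (?T j * (?u * (\<Sum>k<n. ?a k j * ?x k))) = \<phi> r \<otimes>\<^bsub>B\<^esub> (\<phi> (\<theta> j b) \<otimes>\<^bsub>B\<^esub> g j)"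
        using j b f u r uG[OF j] by (simp add: h.mult B.free_value_var B.m_lcomm)
    qed (use b f r in auto)
    also have "\<dots> = \<phi> r \<otimes>\<^bsub>B\<^esub> b"
      using b f r by (subst B.finsum_rdistr[symmetric]) auto
    finally show ?thesis .
  qed
  let ?\<delta> = "\<lambda>k l. if k = l then r else \<zero>"
  \<comment> \<open>Duality of \<open>\<zeta>\<close> and \<open>x\<close> is inherited from the
    basis \<open>e\<close>, hence holds at first only in the localization. The annihilators of the
    finitely many errors are then merged into one \<open>v\<close>.\<close>
  have ann: "\<exists>v\<in>S. v \<otimes> (\<zeta> k (x l) \<ominus> ?\<delta> k l) = \<zero>" if kl: "k < n" "l < n" for k l
  proof -
    have xl: "x l \<in> carrier B" using xB kl by simp
    have "(\<Oplus>\<^bsub>?B\<^esub>i\<in>{..<n}. ?\<phi> (P.to_A (\<zeta> i (x l))) \<otimes>\<^bsub>?B\<^esub> e i) =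
        (\<Oplus>\<^bsub>?B\<^esub>i\<in>{..<n}. fraction B (\<phi> ` S) (\<phi> (\<zeta> i (x l)) \<otimes>\<^bsub>B\<^esub> x i) (\<phi> s))"
      using \<zeta>A xl xB s by (intro P.L.B.finsum_cong') (auto simp: ex P.localize_map_to_A P.LB.fraction_mult)
    also have "\<dots> = fraction B (\<phi> ` S) (\<phi> r \<otimes>\<^bsub>B\<^esub> x l) (\<phi> s)"
      using \<zeta>A xl xB s by (subst P.LB.finsum_fraction) (auto simp: \<zeta>x)
    also have "\<dots> = ?\<phi> (P.to_A r) \<otimes>\<^bsub>?B\<^esub> e l"
      using xl s r kl by (simp add: ex P.localize_map_to_A P.LB.fraction_mult)
    finally have "c k (\<Oplus>\<^bsub>?B\<^esub>i\<in>{..<n}. ?\<phi> (P.to_A (\<zeta> i (x l))) \<otimes>\<^bsub>?B\<^esub> e i) = P.to_A r \<otimes>\<^bsub>?A\<^esub> c k (e l)"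
      using f' kl r by (simp add: P.L.linear_form_smult)
    moreover have "c k (\<Oplus>\<^bsub>?B\<^esub>i\<in>{..<n}. ?\<phi> (P.to_A (\<zeta> i (x l))) \<otimes>\<^bsub>?B\<^esub> e i) = P.to_A (\<zeta> k (x l))"
      using P.L.local_basis_coord[OF lb, of "\<lambda>i. P.to_A (\<zeta> i (x l))"] \<zeta>A xl kl by simp
    moreover have "P.to_A r \<otimes>\<^bsub>?A\<^esub> c k (e l) = P.to_A (?\<delta> k l)"
      using lb kl r by (simp add: P.L.local_basis_def P.LA.fraction_zero)
    ultimately have "P.to_A (\<zeta> k (x l)) = P.to_A (?\<delta> k l)" by simp
    then obtain v where v: "v \<in> S" "v \<otimes> \<zeta> k (x l) = v \<otimes> ?\<delta> k l"
      using \<zeta>A[OF kl(1) xl] r by (subst (asm) P.LA.fraction_eq_iff) auto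
    have "v \<otimes> (\<zeta> k (x l) \<ominus> ?\<delta> k l) = \<zero>"
    proof -
      have "?\<delta> k l \<in> carrier A" using r by simp
      thus ?thesis using v \<zeta>A[OF kl(1) xl] by (simp only: a_minus_def A.r_distr A.r_minus A.a_inv_closed P.LA.S_carrier A.r_neg A.m_closed)
    qed
    thus ?thesis using v(1) by blast
  qed
  have "\<exists>v\<in>S. \<forall>kl\<in>{..<n} \<times> {..<n}. v \<otimes> (\<zeta> (fst kl) (x (snd kl)) \<ominus> ?\<delta> (fst kl) (snd kl)) = \<zero>"
  proof (rule P.LA.common_annihilator)
    fix kl assume "kl \<in> {..<n} \<times> {..<n}"
    hence kl: "fst kl < n" "snd kl < n" by (auto simp: mem_Times_iff)
    show "\<exists>v\<in>S. v \<otimes> (\<zeta> (fst kl) (x (snd kl)) \<ominus> ?\<delta> (fst kl) (snd kl)) = \<zero>"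
      by (rule ann[OF kl])
    show "\<zeta> (fst kl) (x (snd kl)) \<ominus> ?\<delta> (fst kl) (snd kl) \<in> carrier A"
      using \<zeta>A[OF kl(1) xB[OF kl(2)]] r by simp
  qed simp
  then obtain v where v: "v \<in> S"
    and v0: "\<And>k l. k < n \<Longrightarrow> l < n \<Longrightarrow> v \<otimes> (\<zeta> k (x l) \<ominus> ?\<delta> k l) = \<zero>"
    by force
  have "local_basis n (v \<otimes> r) x (\<lambda>k b. v \<otimes> \<zeta> k b)"
    unfolding local_basis_def frame_def
  proof (intro conjI allI impI ballI)
    show "v \<otimes> r \<in> carrier A" using v r by simp
    show "x k \<in> carrier B" if "k < n" for k using xB that .
    show "linear_form (\<lambda>b. v \<otimes> \<zeta> k b)" if "k < n" for k
      unfolding linear_form_def using lin[OF that] v \<zeta>A[OF that]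
      by (auto simp: linear_form_add linear_form_smult A.r_distr A.m_lcomm)
    show "(\<Oplus>\<^bsub>B\<^esub>k\<in>{..<n}. \<phi> (v \<otimes> \<zeta> k b) \<otimes>\<^bsub>B\<^esub> x k) = \<phi> (v \<otimes> r) \<otimes>\<^bsub>B\<^esub> b" if b: "b \<in> carrier B" for b
    proof -
      have "(\<Oplus>\<^bsub>B\<^esub>k\<in>{..<n}. \<phi> (v \<otimes> \<zeta> k b) \<otimes>\<^bsub>B\<^esub> x k) = (\<Oplus>\<^bsub>B\<^esub>k\<in>{..<n}. \<phi> v \<otimes>\<^bsub>B\<^esub> (\<phi> (\<zeta> k b) \<otimes>\<^bsub>B\<^esub> x k))"
        using b v \<zeta>A xB by (intro B.finsum_cong') (auto simp: B.m_assoc)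
      also have "\<dots> = \<phi> v \<otimes>\<^bsub>B\<^esub> (\<phi> r \<otimes>\<^bsub>B\<^esub> b)"
        using b v \<zeta>A xB by (subst B.finsum_rdistr[symmetric]) (auto simp: \<zeta>x)
      finally show ?thesis using b v r by (simp add: B.m_assoc)
    qed
    show "v \<otimes> \<zeta> k (x l) = (if k = l then v \<otimes> r else \<zero>)" if kl: "k < n" "l < n" for k l
    proof -
      have z: "\<zeta> k (x l) \<in> carrier A" "?\<delta> k l \<in> carrier A" "v \<in> carrier A" using kl \<zeta>A xB r v by auto
      have "v \<otimes> \<zeta> k (x l) \<oplus> \<ominus> (v \<otimes> ?\<delta> k l) = \<zero>"
        using v0[OF kl] z by (simp only: a_minus_def A.r_distr A.r_minus A.a_inv_closed)
      hence "v \<otimes> \<zeta> k (x l) = v \<otimes> ?\<delta> k l"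
        using A.minus_equality[of "v \<otimes> \<zeta> k (x l)" "\<ominus> (v \<otimes> ?\<delta> k l)"] z
        by (simp only: A.minus_minus A.a_inv_closed A.m_closed)
      thus ?thesis using z by simp
    qed
  qed
  thus ?thesis using v r by (intro bexI[of _ "v \<otimes> r"]) auto
qed

text \<open>If \<open>a\<close> is nonzero, its annihilator lies in a prime \<open>p\<close>. The
  local basis obtained at \<open>p\<close> has a multiplier \<open>F\<close> outside
  \<open>p\<close>, so no power of \<open>F\<close> lies in \<open>p\<close>, although some power of
  \<open>F\<close> kills \<open>a\<close>.\<close>

lemma rank_algebra_ranked_algebra:
  assumes "rank_algebra A B \<phi> n"
  shows "\<exists>m g \<theta>. ranked_algebra A B \<phi> n m g \<theta>"
proof -
  interpret comm_algebra A B \<phi>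
    using assms by (auto simp: rank_algebra_def comm_algebra_def comm_algebra_axioms_def)
  obtain m g \<theta> where db: "frame m \<one>\<^bsub>A\<^esub> g \<theta>"
    using fg_projective_frame[OF comm_algebra_axioms] assms by (auto simp: rank_algebra_def)
  have "a = \<zero>\<^bsub>A\<^esub>"
    if a: "a \<in> carrier A" and kill: "\<And>F x \<zeta>. local_basis n F x \<zeta> \<Longrightarrow> \<exists>k::nat. F [^]\<^bsub>A\<^esub> k \<otimes>\<^bsub>A\<^esub> a = \<zero>\<^bsub>A\<^esub>" for a
  proof (rule ccontr)
    assume nz: "a \<noteq> \<zero>\<^bsub>A\<^esub>"
    let ?J = "{r \<in> carrier A. r \<otimes>\<^bsub>A\<^esub> a = \<zero>\<^bsub>A\<^esub>}"
    have "ideal ?J A"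
    proof (rule idealI[OF A.ring_axioms A.add.subgroupI])
      show "?J \<noteq> {}" using a by (auto intro: exI[of _ "\<zero>\<^bsub>A\<^esub>"])
      fix r assume "r \<in> ?J"
      hence r: "r \<in> carrier A" "r \<otimes>\<^bsub>A\<^esub> a = \<zero>\<^bsub>A\<^esub>" by auto
      show "\<ominus>\<^bsub>A\<^esub> r \<in> ?J" using r a by (simp add: A.l_minus)
      show "r \<oplus>\<^bsub>A\<^esub> r' \<in> ?J" if "r' \<in> ?J" for r' using r a that by (simp add: A.l_distr)
      fix y assume y: "y \<in> carrier A"
      show "y \<otimes>\<^bsub>A\<^esub> r \<in> ?J" using r a y by (simp add: A.m_assoc)
      thus "r \<otimes>\<^bsub>A\<^esub> y \<in> ?J" using r(1) y by (simp add: A.m_comm[of r y])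
    qed auto
    moreover have "\<one>\<^bsub>A\<^esub> \<notin> ?J" using a nz by simp
    ultimately obtain p where p: "primeideal p A" "?J \<subseteq> p" using A.exists_primeideal by blast
    have S: "localization A (carrier A - p)" by (rule A.localization_primeideal[OF p(1)])
    then interpret S: localization A "carrier A - p" .
    obtain e where "is_basis (localize A (carrier A - p)) (localize_module B \<phi> (carrier A - p)) n e"
      using assms p(1) by (auto simp: rank_algebra_def)
    from exists_local_basis[OF db S this] obtain F x \<zeta> where F: "F \<in> carrier A - p" and lb: "local_basis n F x \<zeta>"
      by blast
    obtain k :: nat where k: "F [^]\<^bsub>A\<^esub> k \<otimes>\<^bsub>A\<^esub> a = \<zero>\<^bsub>A\<^esub>" using kill[OF lb] by blast
    have "F [^]\<^bsub>A\<^esub> k \<in> carrier A - p" by (induction k) (use F S.S_one S.S_mult in \<open>simp_all only: A.nat_pow_0 A.nat_pow_Suc\<close>)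
    moreover have "F [^]\<^bsub>A\<^esub> k \<in> ?J" using k F by simp
    ultimately show False using p(2) by blast
  qed
  thus ?thesis using db comm_algebra_axioms
    by (intro exI[of _ m] exI[of _ g] exI[of _ \<theta>] ranked_algebra.intro ranked_algebra_axioms.intro) auto
qed

section \<open>Based quadratic algebras\<close>

lemma zero_FactRing: "\<zero>\<^bsub>R Quot I\<^esub> = I"
  by (simp add: FactRing_def)

lemma carrier_FactRing: "carrier (R Quot I) = (\<lambda>x. I +>\<^bsub>R\<^esub> x) ` carrier R"
  by (auto simp: FactRing_simps)

locale quadratic = cring R for R :: "('a, 'm) ring_scheme" (structure) +
  fixes t m :: 'a
  assumes t_closed [simp]: "t \<in> carrier R" and m_closed' [simp]: "m \<in> carrier R"
begin

sublocale P: UP_cring R "UP R" by (simp_all add: UP_cring_def is_cring)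

abbreviation Q where "Q \<equiv> quad R t m"
abbreviation con where "con \<equiv> quad_const R t m"
abbreviation gen where "gen \<equiv> quad_gen R t m"
abbreviation el where "el \<equiv> quad_elem R t m"
abbreviation p0 where "p0 \<equiv> UnivPoly.monom (UP R) \<one> 2 \<ominus>\<^bsub>UP R\<^esub> UnivPoly.monom (UP R) t 1 \<oplus>\<^bsub>UP R\<^esub> UnivPoly.monom (UP R) m 0"

lemma p0_closed: "p0 \<in> carrier (UP R)" by simp

sublocale I: ideal "quad_ideal R t m" "UP R"
  unfolding quad_ideal_def by (rule P.P.cgenideal_ideal[OF p0_closed])

lemma cring_Q: "cring Q"
  unfolding quad_def by (rule I.quotient_is_cring[OF P.UP_cring])

sublocale Q: cring Q by (rule cring_Q)

abbreviation proj where "proj \<equiv> (+>\<^bsub>UP R\<^esub>) (quad_ideal R t m)"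

lemma proj_hom: "proj \<in> Ring.ring_hom (UP R) Q"
  unfolding quad_def by (rule I.rcos_ring_hom)

sublocale proj: ring_hom_cring "UP R" Q proj
  by (intro ring_hom_cring.intro ring_hom_cring_axioms.intro P.UP_cring cring_Q proj_hom)

lemma con_eq: "con r = proj (UnivPoly.monom (UP R) r 0)" and gen_eq: "gen = proj (UnivPoly.monom (UP R) \<one> 1)"
  by (simp_all add: quad_const_def quad_gen_def)

lemma monom_mult_const:
  "a \<in> carrier R \<Longrightarrow> b \<in> carrier R \<Longrightarrow>
    UnivPoly.monom (UP R) a 0 \<otimes>\<^bsub>UP R\<^esub> UnivPoly.monom (UP R) b k = UnivPoly.monom (UP R) (a \<otimes> b) k"
  using P.monom_mult[of a b 0 k] by simp

lemma con_hom: "con \<in> Ring.ring_hom R Q"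
  by (rule ring_hom_memI) (simp_all add: con_eq monom_mult_const[symmetric])

sublocale con: comm_algebra R Q con
  by (intro comm_algebra.intro comm_algebra_axioms.intro is_cring cring_Q con_hom)

lemma gen_closed [simp]: "gen \<in> carrier Q" by (simp add: gen_eq)

lemma el_eq: "el u c = con u \<otimes>\<^bsub>Q\<^esub> gen \<oplus>\<^bsub>Q\<^esub> con c" by (simp add: quad_elem_def)

lemma el_closed [simp]: "u \<in> carrier R \<Longrightarrow> c \<in> carrier R \<Longrightarrow> el u c \<in> carrier Q"
  by (simp add: el_eq)

lemma el_proj: "u \<in> carrier R \<Longrightarrow> c \<in> carrier R \<Longrightarrow> el u c = proj (UnivPoly.monom (UP R) u 1 \<oplus>\<^bsub>UP R\<^esub> UnivPoly.monom (UP R) c 0)"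
  using monom_mult_const[of u \<one> 1] by (simp add: el_eq con_eq gen_eq flip: proj.hom_mult)

lemma con_el: "c \<in> carrier R \<Longrightarrow> con c = el \<zero> c" and gen_el: "gen = el \<one> \<zero>"
  by (simp_all add: el_eq)

lemma proj_p0: "proj p0 = \<zero>\<^bsub>Q\<^esub>"
proof -
  have "p0 \<in> quad_ideal R t m" unfolding quad_ideal_def by (rule P.P.cgenideal_self[OF p0_closed])
  hence "proj p0 = quad_ideal R t m" by (rule I.a_rcos_const)
  also have "quad_ideal R t m = \<zero>\<^bsub>Q\<^esub>" unfolding quad_def zero_FactRing ..
  finally show ?thesis .
qed

lemma gen_gen: "gen \<otimes>\<^bsub>Q\<^esub> gen = con t \<otimes>\<^bsub>Q\<^esub> gen \<ominus>\<^bsub>Q\<^esub> con m"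
proof -
  have "proj p0 = gen \<otimes>\<^bsub>Q\<^esub> gen \<ominus>\<^bsub>Q\<^esub> con t \<otimes>\<^bsub>Q\<^esub> gen \<oplus>\<^bsub>Q\<^esub> con m"
  proof -
    have "UnivPoly.monom (UP R) \<one> 2 = UnivPoly.monom (UP R) \<one> 1 \<otimes>\<^bsub>UP R\<^esub> UnivPoly.monom (UP R) \<one> 1"
      "UnivPoly.monom (UP R) t 1 = UnivPoly.monom (UP R) t 0 \<otimes>\<^bsub>UP R\<^esub> UnivPoly.monom (UP R) \<one> 1"
      by (simp_all flip: P.monom_mult add: numeral_2_eq_2)
    thus ?thesis by (simp add: con_eq gen_eq a_minus_def)
  qed
  hence z: "gen \<otimes>\<^bsub>Q\<^esub> gen \<ominus>\<^bsub>Q\<^esub> con t \<otimes>\<^bsub>Q\<^esub> gen \<oplus>\<^bsub>Q\<^esub> con m = \<zero>\<^bsub>Q\<^esub>"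
    unfolding proj_p0 by (rule HOL.sym)
  have c: "gen \<in> carrier Q" "con t \<in> carrier Q" "con m \<in> carrier Q" by auto
  have "gen \<otimes>\<^bsub>Q\<^esub> gen = (gen \<otimes>\<^bsub>Q\<^esub> gen \<ominus>\<^bsub>Q\<^esub> con t \<otimes>\<^bsub>Q\<^esub> gen \<oplus>\<^bsub>Q\<^esub> con m) \<oplus>\<^bsub>Q\<^esub> (con t \<otimes>\<^bsub>Q\<^esub> gen \<ominus>\<^bsub>Q\<^esub> con m)"
    using c by algebra
  thus ?thesis unfolding z using c by simp
qed

lemma el_add:
  assumes "u \<in> carrier R" "c \<in> carrier R" "u' \<in> carrier R" "c' \<in> carrier R"
  shows "el u c \<oplus>\<^bsub>Q\<^esub> el u' c' = el (u \<oplus> u') (c \<oplus> c')"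
  using assms by (simp add: el_eq Q.l_distr Q.a_ac)

lemma el_mult:
  assumes "u \<in> carrier R" "c \<in> carrier R" "u' \<in> carrier R" "c' \<in> carrier R"
  shows "el u c \<otimes>\<^bsub>Q\<^esub> el u' c' = el (u \<otimes> u' \<otimes> t \<oplus> (u \<otimes> c' \<oplus> c \<otimes> u')) (c \<otimes> c' \<ominus> u \<otimes> u' \<otimes> m)"
proof -
  have c: "gen \<in> carrier Q" "con u \<in> carrier Q" "con c \<in> carrier Q" "con u' \<in> carrier Q" "con c' \<in> carrier Q"
    "con t \<in> carrier Q" "con m \<in> carrier Q" using assms by auto
  have "el u c \<otimes>\<^bsub>Q\<^esub> el u' c' = con u \<otimes>\<^bsub>Q\<^esub> con u' \<otimes>\<^bsub>Q\<^esub> (gen \<otimes>\<^bsub>Q\<^esub> gen) \<oplus>\<^bsub>Q\<^esub>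
      ((con u \<otimes>\<^bsub>Q\<^esub> con c' \<oplus>\<^bsub>Q\<^esub> con c \<otimes>\<^bsub>Q\<^esub> con u') \<otimes>\<^bsub>Q\<^esub> gen \<oplus>\<^bsub>Q\<^esub> con c \<otimes>\<^bsub>Q\<^esub> con c')"
    unfolding el_eq using c by algebra
  also have "\<dots> = (con u \<otimes>\<^bsub>Q\<^esub> con u' \<otimes>\<^bsub>Q\<^esub> con t \<oplus>\<^bsub>Q\<^esub> (con u \<otimes>\<^bsub>Q\<^esub> con c' \<oplus>\<^bsub>Q\<^esub> con c \<otimes>\<^bsub>Q\<^esub> con u')) \<otimes>\<^bsub>Q\<^esub> gen \<oplus>\<^bsub>Q\<^esub>
      (con c \<otimes>\<^bsub>Q\<^esub> con c' \<ominus>\<^bsub>Q\<^esub> con u \<otimes>\<^bsub>Q\<^esub> con u' \<otimes>\<^bsub>Q\<^esub> con m)"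
    unfolding gen_gen using c by algebra
  finally show ?thesis using assms by (simp add: el_eq a_minus_def)
qed

text \<open>Multiplication by \<open>x\<close> sends \<open>u x + c\<close> to
  \<open>(u t + c) x - u m\<close>. So every monomial, and then every polynomial, reduces to a
  linear one.\<close>

lemma el_cases:
  assumes "X \<in> carrier Q"
  obtains u c where "u \<in> carrier R" "c \<in> carrier R" "X = el u c"
proof -
  let ?E = "{X. \<exists>u\<in>carrier R. \<exists>c\<in>carrier R. X = el u c}"
  have E: "el u c \<in> ?E" if "u \<in> carrier R" "c \<in> carrier R" for u c using that by blast
  have mon: "proj (UnivPoly.monom (UP R) a k) \<in> ?E" if a: "a \<in> carrier R" for a k
  proof (induction k)
    case 0
    have "proj (UnivPoly.monom (UP R) a 0) = el \<zero> a" using a by (simp add: con_el flip: con_eq)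
    thus ?case using a by blast
  next
    case (Suc k)
    then obtain u c where uc: "u \<in> carrier R" "c \<in> carrier R" "proj (UnivPoly.monom (UP R) a k) = el u c" by auto
    have "UnivPoly.monom (UP R) a (Suc k) = UnivPoly.monom (UP R) a k \<otimes>\<^bsub>UP R\<^esub> UnivPoly.monom (UP R) \<one> 1"
      using a by (simp flip: P.monom_mult)
    hence "proj (UnivPoly.monom (UP R) a (Suc k)) = el u c \<otimes>\<^bsub>Q\<^esub> el \<one> \<zero>"
      using a uc by (simp flip: gen_el add: gen_eq)
    also have "\<dots> = el (u \<otimes> t \<oplus> c) (\<ominus> (u \<otimes> m))"
      using uc by (simp add: el_mult a_minus_def)
    finally have eq: "proj (UnivPoly.monom (UP R) a (Suc k)) = el (u \<otimes> t \<oplus> c) (\<ominus> (u \<otimes> m))" .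
    show ?case unfolding eq using uc by (intro E) auto
  qed
  have sum: "(\<Oplus>\<^bsub>Q\<^esub>i\<in>{..k}. proj (UnivPoly.monom (UP R) (f i) i)) \<in> ?E" if f: "\<And>i. f i \<in> carrier R" for f and k :: nat
  proof (induction k)
    case 0
    have "(\<Oplus>\<^bsub>Q\<^esub>i\<in>{..0}. proj (UnivPoly.monom (UP R) (f i) i)) = proj (UnivPoly.monom (UP R) (f 0) 0)"
      using f by simp
    thus ?case using mon[OF f] by simp
  next
    case (Suc k)
    obtain u c where uc: "u \<in> carrier R" "c \<in> carrier R" "(\<Oplus>\<^bsub>Q\<^esub>i\<in>{..k}. proj (UnivPoly.monom (UP R) (f i) i)) = el u c"
      using Suc by auto
    obtain u' c' where uc': "u' \<in> carrier R" "c' \<in> carrier R" "proj (UnivPoly.monom (UP R) (f (Suc k)) (Suc k)) = el u' c'"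
      using mon[OF f] by blast
    have "(\<Oplus>\<^bsub>Q\<^esub>i\<in>{..Suc k}. proj (UnivPoly.monom (UP R) (f i) i)) = el u' c' \<oplus>\<^bsub>Q\<^esub> el u c"
      using f uc uc' by (subst Q.finsum_Suc) auto
    also have "\<dots> = el (u' \<oplus> u) (c' \<oplus> c)" using uc uc' by (simp add: el_add)
    finally have eq: "(\<Oplus>\<^bsub>Q\<^esub>i\<in>{..Suc k}. proj (UnivPoly.monom (UP R) (f i) i)) = el (u' \<oplus> u) (c' \<oplus> c)" .
    show ?case unfolding eq using uc uc' by (intro E) auto
  qed
  obtain p where p: "p \<in> carrier (UP R)" "X = proj p"
    using assms unfolding quad_def carrier_FactRing by blast
  have "X = proj (\<Oplus>\<^bsub>UP R\<^esub>i\<in>{..deg R p}. UnivPoly.monom (UP R) (UnivPoly.coeff (UP R) p i) i)"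
    using P.up_repr[OF p(1)] p(2) by simp
  also have "\<dots> = (\<Oplus>\<^bsub>Q\<^esub>i\<in>{..deg R p}. proj (UnivPoly.monom (UP R) (UnivPoly.coeff (UP R) p i) i))"
    using p(1) by (subst proj.hom_finsum) (auto simp: o_def)
  finally have "X \<in> ?E" using sum[of "UnivPoly.coeff (UP R) p" "deg R p"] p(1) by simp
  thus ?thesis using that by blast
qed

text \<open>If \<open>u x + c = q (x^2 - t x + m)\<close>, the coefficients of index at least two
  give \<open>q_i = t q_(i+1) - m q_(i+2)\<close>. Since \<open>q_i\<close> vanishes for large
  \<open>i\<close>, the recursion runs downwards to \<open>q = 0\<close>.\<close>

lemma el_eq_zero:
  assumes u: "u \<in> carrier R" and c: "c \<in> carrier R" and z: "el u c = \<zero>\<^bsub>Q\<^esub>"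
  shows "u = \<zero>" "c = \<zero>"
proof -
  let ?p = "UnivPoly.monom (UP R) u 1 \<oplus>\<^bsub>UP R\<^esub> UnivPoly.monom (UP R) c 0"
  have "proj ?p = quad_ideal R t m"
    using z el_proj[OF u c] unfolding quad_def zero_FactRing by simp
  hence "?p \<in> quad_ideal R t m" using I.a_rcos_self[of ?p] u c by simp
  then obtain q where q: "q \<in> carrier (UP R)" "?p = q \<otimes>\<^bsub>UP R\<^esub> p0"
    unfolding quad_ideal_def cgenideal_def by blast
  let ?q = "UnivPoly.coeff (UP R) q"
  have p: "?p = UnivPoly.monom (UP R) \<one> 2 \<otimes>\<^bsub>UP R\<^esub> q \<ominus>\<^bsub>UP R\<^esub> UnivPoly.monom (UP R) t 1 \<otimes>\<^bsub>UP R\<^esub> q \<oplus>\<^bsub>UP R\<^esub> UnivPoly.monom (UP R) m 0 \<otimes>\<^bsub>UP R\<^esub> q"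
    using q by (simp add: a_minus_def P.P.r_distr P.P.r_minus P.P.m_comm[of q])
  have qi: "?q i = t \<otimes> ?q (Suc i) \<ominus> m \<otimes> ?q (Suc (Suc i))" for i
  proof -
    have "\<zero> = UnivPoly.coeff (UP R) ?p (i + 2)" using u c by simp
    also have "\<dots> = ?q i \<ominus> t \<otimes> ?q (Suc i) \<oplus> m \<otimes> ?q (Suc (Suc i))"
      unfolding p using q P.coeff_monom_mult[of \<one> q 2 i] P.coeff_monom_mult[of t q 1 "Suc i"] P.coeff_monom_mult[of m q 0 "Suc (Suc i)"]
      by (simp del: P.coeff_mult)
    finally have z: "?q i \<ominus> t \<otimes> ?q (Suc i) \<oplus> m \<otimes> ?q (Suc (Suc i)) = \<zero>" ..
    have c: "?q i \<in> carrier R" "?q (Suc i) \<in> carrier R" "?q (Suc (Suc i)) \<in> carrier R" using q by auto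
    have "?q i = (?q i \<ominus> t \<otimes> ?q (Suc i) \<oplus> m \<otimes> ?q (Suc (Suc i))) \<oplus> (t \<otimes> ?q (Suc i) \<ominus> m \<otimes> ?q (Suc (Suc i)))"
      using c t_closed m_closed' by algebra
    thus ?thesis unfolding z using c by simp
  qed
  have "?q i = \<zero> \<and> ?q (Suc i) = \<zero>" for i
  \<comment> \<open>The truncated difference is zero exactly when \<open>i\<close> exceeds the
    degree, and then both coefficients vanish.\<close>
  proof (induction "deg R q + 1 - i" arbitrary: i)
    case 0
    thus ?case using q P.deg_aboveD by auto
  next
    case (Suc k)
    hence "k = deg R q + 1 - Suc i" by simp
    from Suc(1)[OF this] show ?case using qi[of i] by (simp add: a_minus_def)
  qed
  hence "q = \<zero>\<^bsub>UP R\<^esub>" using q by (intro P.up_eqI) auto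
  hence pz: "?p = \<zero>\<^bsub>UP R\<^esub>" using q by simp
  show "u = \<zero>" using arg_cong[OF pz, of "\<lambda>p. UnivPoly.coeff (UP R) p 1"] u c by simp
  show "c = \<zero>" using arg_cong[OF pz, of "\<lambda>p. UnivPoly.coeff (UP R) p 0"] u c by simp
qed

lemma el_inj:
  assumes "u \<in> carrier R" "c \<in> carrier R" "u' \<in> carrier R" "c' \<in> carrier R" and eq: "el u c = el u' c'"
  shows "u = u' \<and> c = c'"
proof -
  have "el (u \<oplus> \<ominus> u') (c \<oplus> \<ominus> c') = el u c \<oplus>\<^bsub>Q\<^esub> el (\<ominus> u') (\<ominus> c')"
    using assms(1-4) by (simp add: el_add)
  also have "\<dots> = el (u' \<oplus> \<ominus> u') (c' \<oplus> \<ominus> c')" unfolding eq using assms(1-4) by (simp add: el_add)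
  also have "\<dots> = \<zero>\<^bsub>Q\<^esub>" using assms(1-4) by (simp add: r_neg el_eq)
  finally have "u \<oplus> \<ominus> u' = \<zero>" "c \<oplus> \<ominus> c' = \<zero>"
    using el_eq_zero[of "u \<oplus> \<ominus> u'" "c \<oplus> \<ominus> c'"] assms(1-4) by auto
  thus ?thesis using assms(1-4) minus_equality[of u "\<ominus> u'"] minus_equality[of c "\<ominus> c'"] by simp
qed

text \<open>The indices follow the basis \<open>(1, x)\<close>, the reverse of the order of
  arguments of \<open>el\<close>.\<close>

definition coord :: "nat \<Rightarrow> (nat \<Rightarrow> 'a) set \<Rightarrow> 'a" where
  "coord i X = (SOME y. \<exists>u\<in>carrier R. \<exists>c\<in>carrier R. X = el u c \<and> y = (if i = 0 then c else u))"

lemma coord_el: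
  assumes "u \<in> carrier R" "c \<in> carrier R"
  shows "coord i (el u c) = (if i = 0 then c else u)"
  unfolding coord_def
proof (rule some_equality)
  show "\<exists>u'\<in>carrier R. \<exists>c'\<in>carrier R. el u c = el u' c' \<and> (if i = 0 then c else u) = (if i = 0 then c' else u')"
    using assms by blast
qed (use el_inj[OF assms] in blast)

definition quad_basis :: "nat \<Rightarrow> (nat \<Rightarrow> 'a) set" where
  "quad_basis i = (if i = 0 then el \<zero> \<one> else el \<one> \<zero>)"

lemma local_basis_quad: "con.local_basis 2 \<one> quad_basis coord"
proof -
  have two: "{..<2} = {0, 1 :: nat}" by auto
  have lin: "con.linear_form (coord i)" for i
    unfolding con.linear_form_def
  proof (intro conjI ballI funcsetI)
    fix X assume "X \<in> carrier Q"
    then obtain u c where uc: "u \<in> carrier R" "c \<in> carrier R" "X = el u c" by (rule el_cases)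
    show "coord i X \<in> carrier R" using uc by (simp add: coord_el)
    show "coord i (X \<oplus>\<^bsub>Q\<^esub> Y) = coord i X \<oplus> coord i Y" if "Y \<in> carrier Q" for Y
    proof -
      obtain u' c' where uc': "u' \<in> carrier R" "c' \<in> carrier R" "Y = el u' c'" using \<open>Y \<in> carrier Q\<close> by (rule el_cases)
      show ?thesis using uc uc' by (simp add: coord_el el_add)
    qed
    show "coord i (con a \<otimes>\<^bsub>Q\<^esub> X) = a \<otimes> coord i X" if a: "a \<in> carrier R" for a
    proof -
      have "con a \<otimes>\<^bsub>Q\<^esub> X = el (a \<otimes> u) (a \<otimes> c)" using a uc by (simp add: el_eq Q.r_distr Q.m_assoc)
      thus ?thesis using a uc by (simp add: coord_el)
    qed
  qed
  show ?thesis
    unfolding con.local_basis_def con.frame_def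
  proof (intro conjI allI impI ballI)
    show "quad_basis j \<in> carrier Q" for j by (simp add: quad_basis_def)
    fix X assume "X \<in> carrier Q"
    then obtain u c where uc: "u \<in> carrier R" "c \<in> carrier R" "X = el u c" by (rule el_cases)
    have "(\<Oplus>\<^bsub>Q\<^esub>j\<in>{..<2}. con (coord j X) \<otimes>\<^bsub>Q\<^esub> quad_basis j) = con c \<otimes>\<^bsub>Q\<^esub> el \<zero> \<one> \<oplus>\<^bsub>Q\<^esub> con u \<otimes>\<^bsub>Q\<^esub> el \<one> \<zero>"
      unfolding two using uc by (simp add: quad_basis_def coord_el)
    also have "\<dots> = X" using uc by (simp add: el_eq Q.a_comm)
    finally show "(\<Oplus>\<^bsub>Q\<^esub>j\<in>{..<2}. con (coord j X) \<otimes>\<^bsub>Q\<^esub> quad_basis j) = con \<one> \<otimes>\<^bsub>Q\<^esub> X"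
      using uc by simp
  next
    fix k l :: nat assume "k < 2" "l < 2"
    thus "coord k (quad_basis l) = (if k = l then \<one> else \<zero>)"
      by (auto simp: quad_basis_def coord_el less_2_cases_iff)
  qed (auto intro: lin)
qed

text \<open>The basis \<open>(1, x)\<close> is global, so \<open>F = \<one>\<close> serves for the
  dual basis as well as for separation. The norm of a based quadratic algebra thereby falls under
  the same theory as \<open>s_n\<close>.\<close>

lemma ranked_algebra_quad: "ranked_algebra R Q con 2 2 quad_basis coord"
proof
  show "con.frame 2 \<one> quad_basis coord" using local_basis_quad by (simp add: con.local_basis_def)
  fix a assume a: "a \<in> carrier R"
    and "\<And>F x \<zeta>. con.local_basis 2 F x \<zeta> \<Longrightarrow> \<exists>k::nat. F [^] k \<otimes> a = \<zero>"
  from this(2)[OF local_basis_quad] a show "a = \<zero>" by simp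
qed

lemma alg_norm_el:
  assumes u: "u \<in> carrier R" and c: "c \<in> carrier R"
  shows "alg_norm R Q con 2 (el u c) = u \<otimes> u \<otimes> m \<oplus> (u \<otimes> t \<otimes> c \<oplus> c \<otimes> c)"
proof -
  interpret r: ranked_algebra R Q con 2 2 quad_basis coord by (rule ranked_algebra_quad)
  interpret h: class_hom R "free_value R" by (rule class_hom_free_value)
  let ?U = "free_var u" and ?C = "free_var c" and ?T = "free_var t" and ?N = "free_var m"
  have e: "free_value R ?U = u" "free_value R ?C = c" "free_value R ?T = t" "free_value R ?N = m"
    using u c by (simp_all add: free_value_var)
  \<comment> \<open>The matrix of multiplication by \<open>u x + c\<close> in the basis
    \<open>(1, x)\<close>. The defect is zero because the dual basis comes from an actual
    basis.\<close>
  let ?M = "\<lambda>i j. if i = (0::nat) then (if j = (0::nat) then ?C else - (?U * ?N)) else (if j = 0 then ?U else ?U * ?T + ?C)"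
  have "alg_norm R Q con 2 (el u c) = r.nm (el u c)" using u c by (intro r.alg_norm_eq) simp
  also have "\<dots> = free_value R (class_det 2 ?M)"
  proof (rule r.nm_class_det[OF class_hom_free_value])
    fix i j :: nat assume ij: "i < 2" "j < 2"
    have d: "r.defect i j = \<zero>"
      using ij by (auto simp: r.defect_def quad_basis_def coord_el less_2_cases_iff a_minus_def r_neg)
    have "el u c \<otimes>\<^bsub>Q\<^esub> el \<zero> \<one> = el u c" "el u c \<otimes>\<^bsub>Q\<^esub> el \<one> \<zero> = el (u \<otimes> t \<oplus> c) (\<ominus> (u \<otimes> m))"
      using u c by (simp_all add: el_mult a_minus_def)
    thus "free_value R (?M i j) = r.defect i j \<oplus> coord i (el u c \<otimes>\<^bsub>Q\<^esub> quad_basis j)"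
      unfolding d using ij u c
      by (auto simp: quad_basis_def coord_el less_2_cases_iff h.hom_simps e)
  qed (use u c in simp)
  also have "class_det 2 ?M = ?U * ?U * ?N + (?U * ?T * ?C + ?C * ?C)"
    by (simp add: class_det_two algebra_simps)
  finally show ?thesis by (simp add: e h.hom_simps)
qed

end

section \<open>Homomorphisms of based quadratic algebras\<close>

text \<open>The relations say that \<open>t'\<close> and \<open>m'\<close> are the trace and norm of
  \<open>u x + c\<close>, which is therefore a root of the polynomial defining the source.
  Membership in \<open>extensional\<close> fixes the map off the carrier, so
  \<open>\<exists>!\<close> expresses uniqueness on the carrier.\<close>

lemma (in cring) quad_hom_exists:
  assumes t: "t \<in> carrier R" and m: "m \<in> carrier R" and u: "u \<in> carrier R" and c: "c \<in> carrier R"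
    and t': "t' = u \<otimes> t \<oplus> (c \<oplus> c)" and m': "m' = u \<otimes> u \<otimes> m \<oplus> (u \<otimes> t \<otimes> c \<oplus> c \<otimes> c)"
  shows quad_norm_preserving_exists:
      "\<exists>!g. g \<in> extensional (carrier (quad R t' m')) \<and> quad_norm_preserving R (t', m') (t, m) g \<and>
        g (quad_gen R t' m') = quad_elem R t m u c"
    and quad_iso_exists: "u \<in> Units R \<Longrightarrow>
      \<exists>!g. g \<in> extensional (carrier (quad R t' m')) \<and> quad_iso R (t', m') (t, m) g \<and>
        g (quad_gen R t' m') = quad_elem R t m u c"
proof -
  interpret S: quadratic R t m using t m by unfold_locales
  interpret T: quadratic R t' m' using t m u c by unfold_locales (simp_all add: t' m')
  \<comment> \<open>The only candidate: \<open>a x + b\<close> goes to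
    \<open>a (u x + c) + b\<close>.\<close>
  define g where "g = (\<lambda>X\<in>carrier T.Q. S.el (T.coord 1 X \<otimes> u) (T.coord 1 X \<otimes> c \<oplus> T.coord 0 X))"
  have g_el: "g (T.el a b) = S.el (a \<otimes> u) (a \<otimes> c \<oplus> b)" if "a \<in> carrier R" "b \<in> carrier R" for a b
    using that by (simp add: g_def T.coord_el)
  have ext: "g \<in> extensional (carrier T.Q)" by (simp add: g_def)
  have g_gen: "g T.gen = S.el u c" using u c by (simp add: T.gen_el g_el)
  have g_hom: "g \<in> Ring.ring_hom T.Q S.Q"
  proof (rule ring_hom_memI)
    fix X assume "X \<in> carrier T.Q"
    then obtain a b where ab: "a \<in> carrier R" "b \<in> carrier R" "X = T.el a b" by (rule T.el_cases)
    show "g X \<in> carrier S.Q" using ab u c by (simp add: g_el)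
    fix Y assume "Y \<in> carrier T.Q"
    then obtain a' b' where ab': "a' \<in> carrier R" "b' \<in> carrier R" "Y = T.el a' b'" by (rule T.el_cases)
    show "g (X \<oplus>\<^bsub>T.Q\<^esub> Y) = g X \<oplus>\<^bsub>S.Q\<^esub> g Y"
      using ab ab' u c by (simp add: g_el T.el_add S.el_add l_distr a_ac)
    have "g (X \<otimes>\<^bsub>T.Q\<^esub> Y) = S.el ((a \<otimes> a' \<otimes> t' \<oplus> (a \<otimes> b' \<oplus> b \<otimes> a')) \<otimes> u)
        ((a \<otimes> a' \<otimes> t' \<oplus> (a \<otimes> b' \<oplus> b \<otimes> a')) \<otimes> c \<oplus> (b \<otimes> b' \<ominus> a \<otimes> a' \<otimes> m'))"
      using ab ab' by (simp add: T.el_mult g_el)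
    also have "(a \<otimes> a' \<otimes> t' \<oplus> (a \<otimes> b' \<oplus> b \<otimes> a')) \<otimes> u =
        (a \<otimes> u) \<otimes> (a' \<otimes> u) \<otimes> t \<oplus> ((a \<otimes> u) \<otimes> (a' \<otimes> c \<oplus> b') \<oplus> (a \<otimes> c \<oplus> b) \<otimes> (a' \<otimes> u))"
      unfolding t' using ab ab' t u c by algebra
    also have "(a \<otimes> a' \<otimes> t' \<oplus> (a \<otimes> b' \<oplus> b \<otimes> a')) \<otimes> c \<oplus> (b \<otimes> b' \<ominus> a \<otimes> a' \<otimes> m') =
        (a \<otimes> c \<oplus> b) \<otimes> (a' \<otimes> c \<oplus> b') \<ominus> (a \<otimes> u) \<otimes> (a' \<otimes> u) \<otimes> m"
      unfolding t' m' using ab ab' t m u c by algebra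
    also have "S.el ((a \<otimes> u) \<otimes> (a' \<otimes> u) \<otimes> t \<oplus> ((a \<otimes> u) \<otimes> (a' \<otimes> c \<oplus> b') \<oplus> (a \<otimes> c \<oplus> b) \<otimes> (a' \<otimes> u)))
        ((a \<otimes> c \<oplus> b) \<otimes> (a' \<otimes> c \<oplus> b') \<ominus> (a \<otimes> u) \<otimes> (a' \<otimes> u) \<otimes> m) = g X \<otimes>\<^bsub>S.Q\<^esub> g Y"
      using ab ab' u c by (simp add: g_el S.el_mult)
    finally show "g (X \<otimes>\<^bsub>T.Q\<^esub> Y) = g X \<otimes>\<^bsub>S.Q\<^esub> g Y" .
  next
    have "\<one>\<^bsub>T.Q\<^esub> = T.el \<zero> \<one>" "\<one>\<^bsub>S.Q\<^esub> = S.el \<zero> \<one>" by (simp_all add: T.el_eq S.el_eq)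
    thus "g \<one>\<^bsub>T.Q\<^esub> = \<one>\<^bsub>S.Q\<^esub>" using u c by (simp add: g_el)
  qed
  have g_alg: "alg_hom R T.Q T.con S.Q S.con g"
    unfolding alg_hom_def using g_hom u c by (simp add: T.con_el S.con_el g_el)
  have unique: "k = g" if "k \<in> extensional (carrier T.Q)" "alg_hom R T.Q T.con S.Q S.con k" "k T.gen = S.el u c" for k
  proof (rule extensionalityI[OF that(1) ext])
    have hom: "k \<in> Ring.ring_hom T.Q S.Q" and con: "\<And>r. r \<in> carrier R \<Longrightarrow> k (T.con r) = S.con r"
      using that(2) by (auto simp: alg_hom_def)
    interpret k: ring_hom_cring T.Q S.Q k
      by (intro ring_hom_cring.intro ring_hom_cring_axioms.intro T.cring_Q S.cring_Q hom)
    fix X assume "X \<in> carrier T.Q"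
    then obtain a b where ab: "a \<in> carrier R" "b \<in> carrier R" "X = T.el a b" by (rule T.el_cases)
    have "k X = S.con a \<otimes>\<^bsub>S.Q\<^esub> S.el u c \<oplus>\<^bsub>S.Q\<^esub> S.con b"
      using ab by (simp add: T.el_eq con that(3))
    also have "\<dots> = g X"
      using ab u c by (simp add: g_el) (simp add: S.el_eq S.Q.r_distr S.Q.m_assoc S.Q.a_assoc)
    finally show "k X = g X" .
  qed
  have pres: "norm_preserving_hom R T.Q T.con S.Q S.con g"
    unfolding norm_preserving_hom_def
  proof (intro conjI g_alg ballI)
    fix X assume "X \<in> carrier T.Q"
    then obtain a b where ab: "a \<in> carrier R" "b \<in> carrier R" "X = T.el a b" by (rule T.el_cases)
    have "alg_norm R S.Q S.con 2 (g X) = (a \<otimes> u) \<otimes> (a \<otimes> u) \<otimes> m \<oplus> ((a \<otimes> u) \<otimes> t \<otimes> (a \<otimes> c \<oplus> b) \<oplus> (a \<otimes> c \<oplus> b) \<otimes> (a \<otimes> c \<oplus> b))"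
      using ab u c by (simp add: g_el S.alg_norm_el)
    also have "\<dots> = a \<otimes> a \<otimes> m' \<oplus> (a \<otimes> t' \<otimes> b \<oplus> b \<otimes> b)"
      unfolding t' m' using ab t m u c by algebra
    also have "\<dots> = alg_norm R T.Q T.con 2 X" using ab by (simp add: T.alg_norm_el)
    finally show "alg_norm R S.Q S.con 2 (g X) = alg_norm R T.Q T.con 2 X" .
  qed
  show "\<exists>!g. g \<in> extensional (carrier T.Q) \<and> quad_norm_preserving R (t', m') (t, m) g \<and> g T.gen = S.el u c"
  proof (rule ex1I[of _ g])
    fix k assume "k \<in> extensional (carrier T.Q) \<and> quad_norm_preserving R (t', m') (t, m) k \<and> k T.gen = S.el u c"
    hence "k \<in> extensional (carrier T.Q)" "alg_hom R T.Q T.con S.Q S.con k" "k T.gen = S.el u c"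
      by (simp_all add: quad_norm_preserving_def norm_preserving_hom_def)
    thus "k = g" by (rule unique)
  qed (use ext g_gen pres in \<open>simp add: quad_norm_preserving_def\<close>)
  assume unit: "u \<in> Units R"
  let ?v = "inv u"
  have v: "?v \<in> carrier R" "u \<otimes> ?v = \<one>" using unit by auto
  have cancel: "a = b" if "a \<in> carrier R" "b \<in> carrier R" "a \<otimes> u = b \<otimes> u" for a b
  proof -
    have "a \<otimes> (u \<otimes> ?v) = b \<otimes> (u \<otimes> ?v)" using that u v(1) by (simp flip: m_assoc)
    thus ?thesis using that v(2) by simp
  qed
  have "inj_on g (carrier T.Q)"
  proof (rule inj_onI)
    fix X Y assume X: "X \<in> carrier T.Q" and Y: "Y \<in> carrier T.Q" and eq: "g X = g Y"
    obtain a b where ab: "a \<in> carrier R" "b \<in> carrier R" "X = T.el a b" using X by (rule T.el_cases)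
    obtain a' b' where ab': "a' \<in> carrier R" "b' \<in> carrier R" "Y = T.el a' b'" using Y by (rule T.el_cases)
    have *: "a \<otimes> u = a' \<otimes> u \<and> a \<otimes> c \<oplus> b = a' \<otimes> c \<oplus> b'"
      using eq ab ab' u c by (intro S.el_inj) (simp_all add: g_el)
    hence "a = a'" using cancel ab ab' by blast
    thus "X = Y" using * ab ab' c by simp
  qed
  moreover have "X \<in> g ` carrier T.Q" if "X \<in> carrier S.Q" for X
  proof -
    obtain x y where xy: "x \<in> carrier R" "y \<in> carrier R" "X = S.el x y" using \<open>X \<in> carrier S.Q\<close> by (rule S.el_cases)
    \<comment> \<open>A preimage \<open>a x + b\<close> has to satisfy \<open>a u = x\<close> and
      \<open>a c + b = y\<close>.\<close>
    let ?a = "x \<otimes> ?v"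
    have "?a \<otimes> u = x \<otimes> (u \<otimes> ?v)" using xy u v(1) by (simp add: m_ac)
    hence "g (T.el ?a (\<ominus> (?a \<otimes> c) \<oplus> y)) = X"
      using xy u c v by (simp add: g_el r_neg2)
    thus ?thesis using xy v c by (intro rev_image_eqI[of "T.el ?a (\<ominus> (?a \<otimes> c) \<oplus> y)"]) auto
  qed
  ultimately have "bij_betw g (carrier T.Q) (carrier S.Q)"
    using ring_hom_closed[OF g_hom] by (auto simp: bij_betw_def)
  hence iso: "alg_iso R T.Q T.con S.Q S.con g"
    using g_alg g_hom by (simp add: alg_iso_def ring_iso_def)
  show "\<exists>!g. g \<in> extensional (carrier T.Q) \<and> quad_iso R (t', m') (t, m) g \<and> g T.gen = S.el u c"
  proof (rule ex1I[of _ g])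
    fix k assume "k \<in> extensional (carrier T.Q) \<and> quad_iso R (t', m') (t, m) k \<and> k T.gen = S.el u c"
    hence "k \<in> extensional (carrier T.Q)" "alg_hom R T.Q T.con S.Q S.con k" "k T.gen = S.el u c"
      by (simp_all add: quad_iso_def alg_iso_def)
    thus "k = g" by (rule unique)
  qed (use ext g_gen iso in \<open>simp add: quad_iso_def\<close>)
qed

text \<open>The norm of \<open>x + b\<close> is compared with that of its image:
  \<open>b = 0\<close> yields \<open>m'\<close>, and \<open>b = 1\<close>, after subtraction of
  \<open>m'\<close> and \<open>1\<close>, yields \<open>t'\<close>.\<close>

lemma (in cring) quad_norm_preserving_params:
  assumes closed: "t \<in> carrier R" "m \<in> carrier R" "t' \<in> carrier R" "m' \<in> carrier R" "u \<in> carrier R" "c \<in> carrier R"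
    and f: "quad_norm_preserving R (t', m') (t, m) f" "f (quad_gen R t' m') = quad_elem R t m u c"
  shows "t' = u \<otimes> t \<oplus> (c \<oplus> c)" "m' = u \<otimes> u \<otimes> m \<oplus> (u \<otimes> t \<otimes> c \<oplus> c \<otimes> c)"
proof -
  interpret S: quadratic R t m using closed by unfold_locales
  interpret T: quadratic R t' m' using closed by unfold_locales
  have hom: "f \<in> Ring.ring_hom T.Q S.Q" and con: "\<And>r. r \<in> carrier R \<Longrightarrow> f (T.con r) = S.con r"
    and norm: "\<And>X. X \<in> carrier T.Q \<Longrightarrow> alg_norm R S.Q S.con 2 (f X) = alg_norm R T.Q T.con 2 X"
    using f(1) by (auto simp: quad_norm_preserving_def norm_preserving_hom_def alg_hom_def)
  interpret f: ring_hom_cring T.Q S.Q f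
    by (intro ring_hom_cring.intro ring_hom_cring_axioms.intro T.cring_Q S.cring_Q hom)
  have "f (T.el \<one> b) = S.el u (c \<oplus> b)" if "b \<in> carrier R" for b
    using that closed by (simp add: T.el_eq con f(2)) (simp add: S.el_eq S.Q.a_assoc)
  hence n: "u \<otimes> u \<otimes> m \<oplus> (u \<otimes> t \<otimes> (c \<oplus> b) \<oplus> (c \<oplus> b) \<otimes> (c \<oplus> b)) = m' \<oplus> (t' \<otimes> b \<oplus> b \<otimes> b)" if "b \<in> carrier R" for b
    using norm[of "T.el \<one> b"] that closed by (simp add: S.alg_norm_el T.alg_norm_el)
  show m': "m' = u \<otimes> u \<otimes> m \<oplus> (u \<otimes> t \<otimes> c \<oplus> c \<otimes> c)" using n[of \<zero>] closed by simp
  have "t' = (m' \<oplus> (t' \<otimes> \<one> \<oplus> \<one> \<otimes> \<one>)) \<ominus> m' \<ominus> \<one>" using closed by algebra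
  also have "m' \<oplus> (t' \<otimes> \<one> \<oplus> \<one> \<otimes> \<one>) = u \<otimes> u \<otimes> m \<oplus> (u \<otimes> t \<otimes> (c \<oplus> \<one>) \<oplus> (c \<oplus> \<one>) \<otimes> (c \<oplus> \<one>))"
    by (rule n[OF one_closed, symmetric])
  also have "u \<otimes> u \<otimes> m \<oplus> (u \<otimes> t \<otimes> (c \<oplus> \<one>) \<oplus> (c \<oplus> \<one>) \<otimes> (c \<oplus> \<one>)) \<ominus> m' \<ominus> \<one> = u \<otimes> t \<oplus> (c \<oplus> c)"
    unfolding m' using closed by algebra
  finally show "t' = u \<otimes> t \<oplus> (c \<oplus> c)" .
qed

text \<open>Surjectivity replaces the norms: a preimage \<open>a x + b\<close> of the generator
  gives \<open>a u = 1\<close>. Comparing coefficients in \<open>f(x)^2 = t' f(x) - m'\<close> then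
  gives \<open>t' u = u (u t + 2 c)\<close>, where \<open>u\<close> cancels, and afterwards
  \<open>m'\<close>.\<close>

lemma (in cring) quad_iso_params:
  assumes closed: "t \<in> carrier R" "m \<in> carrier R" "t' \<in> carrier R" "m' \<in> carrier R" "u \<in> carrier R" "c \<in> carrier R"
    and f: "quad_iso R (t', m') (t, m) f" "f (quad_gen R t' m') = quad_elem R t m u c"
  shows "u \<in> Units R" "t' = u \<otimes> t \<oplus> (c \<oplus> c)" "m' = u \<otimes> u \<otimes> m \<oplus> (u \<otimes> t \<otimes> c \<oplus> c \<otimes> c)"
proof -
  interpret S: quadratic R t m using closed by unfold_locales
  interpret T: quadratic R t' m' using closed by unfold_locales
  have hom: "f \<in> Ring.ring_hom T.Q S.Q" and con: "\<And>r. r \<in> carrier R \<Longrightarrow> f (T.con r) = S.con r"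
    and bij: "bij_betw f (carrier T.Q) (carrier S.Q)"
    using f(1) by (auto simp: quad_iso_def alg_iso_def alg_hom_def ring_iso_def)
  interpret f: ring_hom_cring T.Q S.Q f
    by (intro ring_hom_cring.intro ring_hom_cring_axioms.intro T.cring_Q S.cring_Q hom)
  have fel: "f (T.el a b) = S.el (a \<otimes> u) (a \<otimes> c \<oplus> b)" if "a \<in> carrier R" "b \<in> carrier R" for a b
    using that closed by (simp add: T.el_eq con f(2)) (simp add: S.el_eq S.Q.r_distr S.Q.m_assoc S.Q.a_assoc)
  have "S.gen \<in> f ` carrier T.Q" using bij by (simp add: bij_betw_def)
  then obtain X where X: "X \<in> carrier T.Q" "S.gen = f X" by blast
  obtain a b where ab: "a \<in> carrier R" "b \<in> carrier R" "X = T.el a b" using X(1) by (rule T.el_cases)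
  have "S.el \<one> \<zero> = S.el (a \<otimes> u) (a \<otimes> c \<oplus> b)" using X(2) ab by (simp add: fel flip: S.gen_el)
  hence au: "\<one> = a \<otimes> u" using ab closed S.el_inj[of \<one> \<zero> "a \<otimes> u" "a \<otimes> c \<oplus> b"] by simp
  thus unit: "u \<in> Units R" using ab closed by (auto simp: Units_def m_comm intro!: bexI[of _ a])
  have "f (T.gen \<otimes>\<^bsub>T.Q\<^esub> T.gen) = f T.gen \<otimes>\<^bsub>S.Q\<^esub> f T.gen" by simp
  moreover have "T.gen \<otimes>\<^bsub>T.Q\<^esub> T.gen = T.el t' (\<ominus> m')"
    using closed by (simp add: T.gen_el T.el_mult a_minus_def)
  ultimately have "S.el (t' \<otimes> u) (t' \<otimes> c \<oplus> \<ominus> m') = S.el u c \<otimes>\<^bsub>S.Q\<^esub> S.el u c"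
    using closed by (simp add: fel f(2))
  also have "\<dots> = S.el (u \<otimes> u \<otimes> t \<oplus> (u \<otimes> c \<oplus> c \<otimes> u)) (c \<otimes> c \<ominus> u \<otimes> u \<otimes> m)"
    using closed by (intro S.el_mult)
  finally have eq: "t' \<otimes> u = u \<otimes> u \<otimes> t \<oplus> (u \<otimes> c \<oplus> c \<otimes> u)" "t' \<otimes> c \<oplus> \<ominus> m' = c \<otimes> c \<ominus> u \<otimes> u \<otimes> m"
    using S.el_inj[of "t' \<otimes> u" "t' \<otimes> c \<oplus> \<ominus> m'" "u \<otimes> u \<otimes> t \<oplus> (u \<otimes> c \<oplus> c \<otimes> u)" "c \<otimes> c \<ominus> u \<otimes> u \<otimes> m"] closed by auto
  have "t' = t' \<otimes> (a \<otimes> u)" using au[symmetric] closed by simp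
  also have "\<dots> = a \<otimes> (t' \<otimes> u)" using closed ab by (simp add: m_ac)
  also have "\<dots> = (a \<otimes> u) \<otimes> (u \<otimes> t \<oplus> (c \<oplus> c))" unfolding eq(1) using closed ab by (simp add: m_ac r_distr)
  also have "\<dots> = u \<otimes> t \<oplus> (c \<oplus> c)" using au[symmetric] closed by simp
  finally show t': "t' = u \<otimes> t \<oplus> (c \<oplus> c)" .
  have "m' = t' \<otimes> c \<ominus> (t' \<otimes> c \<oplus> \<ominus> m')" using closed by algebra
  also have "\<dots> = u \<otimes> u \<otimes> m \<oplus> (u \<otimes> t \<otimes> c \<oplus> c \<otimes> c)"
    unfolding eq(2) unfolding t' using closed by algebra
  finally show "m' = u \<otimes> u \<otimes> m \<oplus> (u \<otimes> t \<otimes> c \<oplus> c \<otimes> c)" .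
qed

lemma (in ranked_algebra) Nm_params_eq:
  assumes "T \<in> carrier B"
  shows "Nm_params A B \<phi> n T N = (nm T, nm_diff (-4) N (T \<otimes>\<^bsub>B\<^esub> T))"
  using assms by (simp add: Nm_params_def alg_norm_eq nm_diff_def numeral_2_eq_2)

lemma (in ranked_algebra) nm_Units:
  assumes "U \<in> Units B"
  shows "nm U \<in> Units A"
proof -
  let ?V = "inv\<^bsub>B\<^esub> U"
  have U: "U \<in> carrier B" "?V \<in> carrier B" "U \<otimes>\<^bsub>B\<^esub> ?V = \<one>\<^bsub>B\<^esub>" using assms by auto
  have "nm U \<otimes> nm ?V = \<one>" using nm_mult[OF U(1,2)] U(3) nm_one by simp
  thus ?thesis using nm_closed U by (auto simp: Units_def A.m_comm intro!: bexI[of _ "nm ?V"])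
qed

text \<open>That the assignment defines a homomorphism is rendered as unique existence of an
  extensional map with the prescribed value at the generator. The relations read off from
  \<open>f\<close> over \<open>B\<close> descend to the same relations between norms, with
  \<open>nm_diff 2 C (U T)\<close> in the place of \<open>C\<close>.\<close>

theorem proposition3p7:
  fixes A :: "('a, 'm) ring_scheme" and B :: "('b, 'n) ring_scheme"
    and \<phi> :: "'a \<Rightarrow> 'b" and n :: nat
    and T N T' N' U C :: 'b
    and f :: "(nat \<Rightarrow> 'b) set \<Rightarrow> (nat \<Rightarrow> 'b) set"
  assumes "rank_algebra A B \<phi> n"
    and "T \<in> carrier B" "N \<in> carrier B" "T' \<in> carrier B" "N' \<in> carrier B"
    and "U \<in> carrier B" "C \<in> carrier B"
    and "f (quad_gen B T' N') = quad_elem B T N U C"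
  shows
    "let P' = Nm_params A B \<phi> n T' N'; P = Nm_params A B \<phi> n T N;
         Q' = quad A (fst P') (snd P');
         x' = quad_gen A (fst P') (snd P');
         y = quad_elem A (fst P) (snd P) (alg_norm A B \<phi> n U)
               (\<Oplus>\<^bsub>A\<^esub>k\<in>{1..n}. [((2 :: int) ^ (k - 1))] \<cdot>\<^bsub>A\<^esub>
                  (polarized_norm A B \<phi> n k (n - k) C (U \<otimes>\<^bsub>B\<^esub> T)))
     in (quad_iso B (T', N') (T, N) f \<longrightarrow>
          (\<exists>!g. g \<in> extensional (carrier Q') \<and> quad_iso A P' P g \<and> g x' = y)) \<and>
        (quad_norm_preserving B (T', N') (T, N) f \<longrightarrow>
          (\<exists>!g. g \<in> extensional (carrier Q') \<and> quad_norm_preserving A P' P g \<and> g x' = y))"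
proof -
  note closed = assms(2-7)
  obtain m g \<theta> where "ranked_algebra A B \<phi> n m g \<theta>"
    using rank_algebra_ranked_algebra[OF assms(1)] by blast
  then interpret ranked_algebra A B \<phi> n m g \<theta> .
  let ?c = "nm_diff 2 C (U \<otimes>\<^bsub>B\<^esub> T)"
  have cl: "nm T \<in> carrier A" "nm_diff (-4) N (T \<otimes>\<^bsub>B\<^esub> T) \<in> carrier A" "nm U \<in> carrier A" "?c \<in> carrier A"
    using closed by (auto intro: nm_closed nm_diff_closed)
  have params: "nm T' = nm U \<otimes>\<^bsub>A\<^esub> nm T \<oplus>\<^bsub>A\<^esub> (?c \<oplus>\<^bsub>A\<^esub> ?c)"
      "nm_diff (-4) N' (T' \<otimes>\<^bsub>B\<^esub> T') = nm U \<otimes>\<^bsub>A\<^esub> nm U \<otimes>\<^bsub>A\<^esub> nm_diff (-4) N (T \<otimes>\<^bsub>B\<^esub> T) \<oplus>\<^bsub>A\<^esub>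
        (nm U \<otimes>\<^bsub>A\<^esub> nm T \<otimes>\<^bsub>A\<^esub> ?c \<oplus>\<^bsub>A\<^esub> ?c \<otimes>\<^bsub>A\<^esub> ?c)"
    if "T' = U \<otimes>\<^bsub>B\<^esub> T \<oplus>\<^bsub>B\<^esub> (C \<oplus>\<^bsub>B\<^esub> C)"
      "N' = U \<otimes>\<^bsub>B\<^esub> U \<otimes>\<^bsub>B\<^esub> N \<oplus>\<^bsub>B\<^esub> (U \<otimes>\<^bsub>B\<^esub> T \<otimes>\<^bsub>B\<^esub> C \<oplus>\<^bsub>B\<^esub> C \<otimes>\<^bsub>B\<^esub> C)"
    using that nm_trace[of U T C] nm_norm[of U T N C T' N'] closed by auto
  have iso: "\<exists>!g. g \<in> extensional (carrier (quad A (nm T') (nm_diff (-4) N' (T' \<otimes>\<^bsub>B\<^esub> T')))) \<and>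
      quad_iso A (nm T', nm_diff (-4) N' (T' \<otimes>\<^bsub>B\<^esub> T')) (nm T, nm_diff (-4) N (T \<otimes>\<^bsub>B\<^esub> T)) g \<and>
      g (quad_gen A (nm T') (nm_diff (-4) N' (T' \<otimes>\<^bsub>B\<^esub> T'))) = quad_elem A (nm T) (nm_diff (-4) N (T \<otimes>\<^bsub>B\<^esub> T)) (nm U) ?c"
    if "quad_iso B (T', N') (T, N) f"
  proof -
    note p = B.quad_iso_params[OF closed(1-6) that assms(8)]
    show ?thesis by (rule A.quad_iso_exists[OF cl params[OF p(2,3)] nm_Units[OF p(1)]])
  qed
  have np: "\<exists>!g. g \<in> extensional (carrier (quad A (nm T') (nm_diff (-4) N' (T' \<otimes>\<^bsub>B\<^esub> T')))) \<and>
      quad_norm_preserving A (nm T', nm_diff (-4) N' (T' \<otimes>\<^bsub>B\<^esub> T')) (nm T, nm_diff (-4) N (T \<otimes>\<^bsub>B\<^esub> T)) g \<and>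
      g (quad_gen A (nm T') (nm_diff (-4) N' (T' \<otimes>\<^bsub>B\<^esub> T'))) = quad_elem A (nm T) (nm_diff (-4) N (T \<otimes>\<^bsub>B\<^esub> T)) (nm U) ?c"
    if "quad_norm_preserving B (T', N') (T, N) f"
  proof -
    note p = B.quad_norm_preserving_params[OF closed(1-6) that assms(8)]
    show ?thesis by (rule A.quad_norm_preserving_exists[OF cl params[OF p]])
  qed
  have "alg_norm A B \<phi> n U = nm U" using closed by (simp add: alg_norm_eq)
  thus ?thesis
    unfolding Let_def Nm_params_eq[OF closed(1)] Nm_params_eq[OF closed(3)] fst_conv snd_conv
      nm_diff_def[of 2, symmetric]
    using iso np by simp
qed

end
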